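(* Let $N\ge2$, let $\Omega\subset\mathbb{R}^N$ be a smooth bounded domain, and let $q(p)$ be a function of $p$ with $N<q(p)<p$ and $\lim_{p\to\infty}q(p)/p=Q\in(0,1)$. For every $\Lambda>\Lambda_\infty$, every choice of $\lambda_p>0$ with $\lim_{p\to\infty}(\lambda_p)^{1/p}=\Lambda$, and every limit pair $(u_\Lambda,x_\Lambda)$ for $(\lambda_p)$ (as defined in the context), one has $$\|u_\Lambda\|_\infty=\frac1{\Lambda_\infty}\left(\frac{\Lambda_\infty}{\Lambda}\right)^{\frac1{1-Q}}\quad\text{and}\quad\Lambda_\infty=\frac{\|\nabla u_\Lambda\|_\infty}{\|u_\Lambda\|_\infty}.$$ Therefore, $x_\Lambda$ is also a maximum point of the distance function to the boundary $\rho$, and $$0\le u_\Lambda(x)\le\left(\frac{\Lambda_\infty}{\Lambda}\right)^{\frac1{1-Q}}\rho(x)\qquad\text{for all }x\in\overline\Omega,$$ with equality in the second inequality holding on $\partial\Omega\cup\{x_\Lambda\}$.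
   Context: $\|\cdot\|_s$ is the norm of $L^s(\Omega)$. $\rho(x):=\inf\{|x-y|:y\in\partial\Omega\}$ for $x\in\overline\Omega$. $C_0(\overline\Omega):=\{u\in C(\overline\Omega):u=0\text{ on }\partial\Omega\}$ and $\Lambda_\infty:=\min\{\|\nabla u\|_\infty/\|u\|_\infty:0\not\equiv u\in W^{1,\infty}(\Omega)\cap C_0(\overline\Omega)\}$; it is known that $\Lambda_\infty=\|\rho\|_\infty^{-1}$. Least energy solutions (case $N<q<p$): for $\lambda>0$, let $X_{p,q}:=W_0^{1,p}(\Omega)\hookrightarrow C(\overline\Omega)$, $J_\lambda(u):=\frac1p\|\nabla u\|_p^p+\frac1q\|\nabla u\|_q^q-\frac{\lambda}{p}\|u\|_\infty^p$ for $u\in X_{p,q}$, and $\mathcal N_{\lambda,\infty}:=\{u\in X_{p,q}\setminus\{0\}:\|\nabla u\|_p^p+\|\nabla u\|_q^q=\lambda\|u\|_\infty^p\}$. A least energy solution of $$-(\Delta_p+\Delta_q)u=\lambda\|u\|_\infty^{p-1}\delta_{x_u}\text{ in }\Omega,\quad u=0\text{ on }\partial\Omega$$ (where $(\Delta_p+\Delta_q)u:=\operatorname{div}[(|\nabla u|^{p-2}+|\nabla u|^{q-2})\nabla u]$, $x_u$ is the maximum point of $|u|$ and $\delta_{x_u}$ the Dirac delta at $x_u$) is a function $u\in\mathcal N_{\lambda,\infty}$ minimizing $J_\lambda$ over $\mathcal N_{\lambda,\infty}$. For $q=q(p)$, $\lambda=\lambda_p$ as in the claim and $p$ large, nonnegative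 least energy solutions exist and have a unique maximum point. Limit pair: for $p$ large let $u_p$ be a nonnegative least energy solution of the problem $-(\Delta_p+\Delta_{q(p)})u=\lambda_p\|u\|_\infty^{p-1}\delta_{x_u}$ in $\Omega$, $u=0$ on $\partial\Omega$, and let $x_p$ be its only maximum point. A limit pair for $(\lambda_p)$ is a pair $(u_\Lambda,x_\Lambda)$ with $u_\Lambda\in W^{1,\infty}(\Omega)\cap C_0(\overline\Omega)$, $x_\Lambda\in\Omega$, such that for some sequence $p_n\to\infty$ one has $x_{p_n}\to x_\Lambda$ and $u_{p_n}\to u_\Lambda$ uniformly in $\overline\Omega$. (Limit pairs exist.) *)

theory Defs
  imports "HOL-Analysis.Analysis" "HOL-Probability.Essential_Supremum"
begin

section \<open>Smooth functions and smooth bounded domains\<close>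

text \<open>\<open>C_diff k f S\<close>: \<open>f\<close> is of class \<open>C\<^sup>k\<close> on the open set \<open>S\<close>.\<close>

primrec C_diff :: "nat \<Rightarrow> ('a::euclidean_space \<Rightarrow> real) \<Rightarrow> 'a set \<Rightarrow> bool" where
  "C_diff 0 f S \<longleftrightarrow> continuous_on S f"
| "C_diff (Suc k) f S \<longleftrightarrow>
     (\<forall>x\<in>S. f differentiable (at x)) \<and>
     (\<forall>b\<in>Basis. C_diff k (\<lambda>x. frechet_derivative f (at x) b) S)"

definition C_infinity :: "('a::euclidean_space \<Rightarrow> real) \<Rightarrow> 'a set \<Rightarrow> bool" where
  "C_infinity f S \<longleftrightarrow> (\<forall>k. C_diff k f S)"

text \<open>Near each boundary point the domain is, in suitable orthonormal coordinates with last axis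
  \<open>\<nu>\<close>, the region above the graph of a smooth function of the other coordinates;
  \<open>x - (x \<bullet> \<nu>) *\<^sub>R \<nu>\<close> is the projection of \<open>x\<close> to the hyperplane orthogonal to \<open>\<nu>\<close>.\<close>

definition smooth_boundary :: "'a::euclidean_space set \<Rightarrow> bool" where
  "smooth_boundary \<Omega> \<longleftrightarrow>
     (\<forall>z\<in>frontier \<Omega>. \<exists>r>0. \<exists>\<nu> \<gamma>. norm \<nu> = 1 \<and> C_infinity \<gamma> UNIV \<and>
        \<Omega> \<inter> ball z r = {x \<in> ball z r. x \<bullet> \<nu> > \<gamma> (x - (x \<bullet> \<nu>) *\<^sub>R \<nu>)})"

definition smooth_bounded_domain :: "'a::euclidean_space set \<Rightarrow> bool" where
  "smooth_bounded_domain \<Omega> \<longleftrightarrow>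
     open \<Omega> \<and> connected \<Omega> \<and> \<Omega> \<noteq> {} \<and> bounded \<Omega> \<and> smooth_boundary \<Omega>"


section \<open>Lebesgue and Sobolev spaces\<close>

text \<open>Elements of these spaces are represented by functions on the whole space; only their
  values on \<open>\<Omega>\<close> (or \<open>closure \<Omega>\<close>, for continuous representatives) matter.\<close>

definition Lp_space :: "'a::euclidean_space set \<Rightarrow> real \<Rightarrow> ('a \<Rightarrow> 'b::real_normed_vector) set" where
  "Lp_space \<Omega> s = {f. f \<in> borel_measurable (lebesgue_on \<Omega>) \<and>
                      integrable (lebesgue_on \<Omega>) (\<lambda>x. norm (f x) powr s)}"

definition Lp_norm :: "'a::euclidean_space set \<Rightarrow> real \<Rightarrow> ('a \<Rightarrow> 'b::real_normed_vector) \<Rightarrow> real" where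
  "Lp_norm \<Omega> s f = (LINT x|lebesgue_on \<Omega>. norm (f x) powr s) powr (1 / s)"

definition Linf_space :: "'a::euclidean_space set \<Rightarrow> ('a \<Rightarrow> 'b::real_normed_vector) set" where
  "Linf_space \<Omega> = {f. f \<in> borel_measurable (lebesgue_on \<Omega>) \<and>
                      esssup (lebesgue_on \<Omega>) (\<lambda>x. ereal (norm (f x))) < \<infinity>}"

definition Linf_norm :: "'a::euclidean_space set \<Rightarrow> ('a \<Rightarrow> 'b::real_normed_vector) \<Rightarrow> real" where
  "Linf_norm \<Omega> f = real_of_ereal (esssup (lebesgue_on \<Omega>) (\<lambda>x. ereal (norm (f x))))"

definition locally_integrable :: "'a::euclidean_space set \<Rightarrow> ('a \<Rightarrow> 'b::euclidean_space) \<Rightarrow> bool" where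
  "locally_integrable \<Omega> f \<longleftrightarrow> (\<forall>K. compact K \<and> K \<subseteq> \<Omega> \<longrightarrow> integrable (lebesgue_on K) f)"

definition test_functions :: "'a::euclidean_space set \<Rightarrow> ('a \<Rightarrow> real) set" where
  "test_functions \<Omega> = {\<phi>. C_infinity \<phi> UNIV \<and>
     compact (closure {x. \<phi> x \<noteq> 0}) \<and> closure {x. \<phi> x \<noteq> 0} \<subseteq> \<Omega>}"

definition has_weak_gradient ::
    "'a::euclidean_space set \<Rightarrow> ('a \<Rightarrow> real) \<Rightarrow> ('a \<Rightarrow> 'a) \<Rightarrow> bool" where
  "has_weak_gradient \<Omega> u G \<longleftrightarrow> locally_integrable \<Omega> u \<and> locally_integrable \<Omega> G \<and>
     (\<forall>\<phi>\<in>test_functions \<Omega>. \<forall>b\<in>Basis.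
        (LINT x|lebesgue_on \<Omega>. u x * frechet_derivative \<phi> (at x) b)
        = - (LINT x|lebesgue_on \<Omega>. (G x \<bullet> b) * \<phi> x))"

text \<open>The weak gradient is unique up to null sets, so the choice below does not affect norms.\<close>

definition weak_gradient :: "'a::euclidean_space set \<Rightarrow> ('a \<Rightarrow> real) \<Rightarrow> 'a \<Rightarrow> 'a" where
  "weak_gradient \<Omega> u = (SOME G. has_weak_gradient \<Omega> u G)"

definition W1p :: "'a::euclidean_space set \<Rightarrow> real \<Rightarrow> ('a \<Rightarrow> real) set" where
  "W1p \<Omega> s = {u \<in> Lp_space \<Omega> s. \<exists>G\<in>Lp_space \<Omega> s. has_weak_gradient \<Omega> u G}"

definition W1p_norm :: "'a::euclidean_space set \<Rightarrow> real \<Rightarrow> ('a \<Rightarrow> real) \<Rightarrow> real" where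
  "W1p_norm \<Omega> s u = Lp_norm \<Omega> s u + Lp_norm \<Omega> s (weak_gradient \<Omega> u)"

definition W1inf :: "'a::euclidean_space set \<Rightarrow> ('a \<Rightarrow> real) set" where
  "W1inf \<Omega> = {u \<in> Linf_space \<Omega>. \<exists>G\<in>Linf_space \<Omega>. has_weak_gradient \<Omega> u G}"

text \<open>The closure of the test functions in \<open>W1p\<close>.\<close>

definition W01p :: "'a::euclidean_space set \<Rightarrow> real \<Rightarrow> ('a \<Rightarrow> real) set" where
  "W01p \<Omega> s = {u \<in> W1p \<Omega> s. \<exists>\<phi>. (\<forall>n::nat. \<phi> n \<in> test_functions \<Omega>) \<and>
     (\<lambda>n. W1p_norm \<Omega> s (\<lambda>x. u x - \<phi> n x)) \<longlonglongrightarrow> 0}"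

definition C0 :: "'a::euclidean_space set \<Rightarrow> ('a \<Rightarrow> real) set" where
  "C0 \<Omega> = {u. continuous_on (closure \<Omega>) u \<and> (\<forall>x\<in>frontier \<Omega>. u x = 0)}"


section \<open>Distance to the boundary and \<open>\<Lambda>\<^sub>\<infinity>\<close>\<close>

definition boundary_dist :: "'a::euclidean_space set \<Rightarrow> 'a \<Rightarrow> real" where
  "boundary_dist \<Omega> x = infdist x (frontier \<Omega>)"

text \<open>For a bounded domain the infimum is attained, i.e. it is a minimum.\<close>

definition Lambda_inf :: "'a::euclidean_space set \<Rightarrow> real" where
  "Lambda_inf \<Omega> = Inf {Linf_norm \<Omega> (weak_gradient \<Omega> u) / Linf_norm \<Omega> u |u.
     u \<in> W1inf \<Omega> \<inter> C0 \<Omega> \<and> \<not> (\<forall>x\<in>\<Omega>. u x = 0)}"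


section \<open>Least energy solutions\<close>

text \<open>For \<open>p\<close> larger than the dimension, every element of \<open>W01p \<Omega> p\<close> has a
  unique representative continuous on \<open>closure \<Omega>\<close>; the energy space consists of these.\<close>

definition X_space :: "'a::euclidean_space set \<Rightarrow> real \<Rightarrow> ('a \<Rightarrow> real) set" where
  "X_space \<Omega> p = {u \<in> W01p \<Omega> p. continuous_on (closure \<Omega>) u}"

definition energy ::
    "'a::euclidean_space set \<Rightarrow> real \<Rightarrow> real \<Rightarrow> real \<Rightarrow> ('a \<Rightarrow> real) \<Rightarrow> real" where
  "energy \<Omega> p q l u =
     1 / p * Lp_norm \<Omega> p (weak_gradient \<Omega> u) powr p
     + 1 / q * Lp_norm \<Omega> q (weak_gradient \<Omega> u) powr q
     - l / p * Linf_norm \<Omega> u powr p"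

definition nehari ::
    "'a::euclidean_space set \<Rightarrow> real \<Rightarrow> real \<Rightarrow> real \<Rightarrow> ('a \<Rightarrow> real) set" where
  "nehari \<Omega> p q l = {u \<in> X_space \<Omega> p. \<not> (\<forall>x\<in>\<Omega>. u x = 0) \<and>
     Lp_norm \<Omega> p (weak_gradient \<Omega> u) powr p + Lp_norm \<Omega> q (weak_gradient \<Omega> u) powr q
     = l * Linf_norm \<Omega> u powr p}"

definition least_energy_solution ::
    "'a::euclidean_space set \<Rightarrow> real \<Rightarrow> real \<Rightarrow> real \<Rightarrow> ('a \<Rightarrow> real) \<Rightarrow> bool" where
  "least_energy_solution \<Omega> p q l u \<longleftrightarrow>
     u \<in> nehari \<Omega> p q l \<and> (\<forall>v\<in>nehari \<Omega> p q l. energy \<Omega> p q l u \<le> energy \<Omega> p q l v)"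


section \<open>Limit pairs\<close>

definition is_max_point :: "('a \<Rightarrow> real) \<Rightarrow> 'a set \<Rightarrow> 'a \<Rightarrow> bool" where
  "is_max_point f S x \<longleftrightarrow> x \<in> S \<and> (\<forall>y\<in>S. f y \<le> f x)"

text \<open>\<open>v p\<close> and \<open>y p\<close> are the nonnegative least energy solution for the parameter \<open>p\<close> and
  its only maximum point; nothing is required of them for small \<open>p\<close>.\<close>

definition limit_pair ::
    "'a::euclidean_space set \<Rightarrow> (real \<Rightarrow> real) \<Rightarrow> (real \<Rightarrow> real) \<Rightarrow> ('a \<Rightarrow> real) \<Rightarrow> 'a \<Rightarrow> bool" where
  "limit_pair \<Omega> q l u x \<longleftrightarrow>
     u \<in> W1inf \<Omega> \<inter> C0 \<Omega> \<and> x \<in> \<Omega> \<and>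
     (\<exists>(v :: real \<Rightarrow> 'a \<Rightarrow> real) (y :: real \<Rightarrow> 'a).
        (\<forall>\<^sub>F p in at_top.
           least_energy_solution \<Omega> p (q p) (l p) (v p) \<and>
           (\<forall>z\<in>closure \<Omega>. 0 \<le> v p z) \<and>
           (\<forall>z. is_max_point (v p) (closure \<Omega>) z \<longleftrightarrow> z = y p)) \<and>
        (\<exists>P :: nat \<Rightarrow> real. filterlim P at_top sequentially \<and>
           (\<lambda>n. y (P n)) \<longlonglongrightarrow> x \<and>
           uniform_limit (closure \<Omega>) (\<lambda>n. v (P n)) u sequentially))"

end

theory Submission
  imports Defs "HOL-Computational_Algebra.Polynomial" "HOL-Real_Asymp.Real_Asymp"
begin

text \<open>Let \<open>R\<close> be the maximum of the boundary distance \<open>\<rho>\<close> and \<open>T = (R \<Lambda>) powr (- 1 / (1 - Q))\<close>.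
  A function in \<open>W1inf \<Omega> \<inter> C0 \<Omega>\<close> is bounded by \<open>\<rho>\<close> times the norm of its gradient, and smoothed cones
  on the largest inscribed ball show that this is sharp, so \<open>\<Lambda>\<^sub>\<infinity> = 1 / R\<close>.

  On the Nehari set the energy is \<open>(1/q - 1/p) \<parallel>\<nabla>u\<parallel>\<^sub>q\<^sup>q\<close>. Comparing with multiples of the smoothed
  cones gives \<open>limsup \<parallel>\<nabla>u\<^sub>p\<parallel>\<^sub>q \<le> T\<close>. Morrey's inequality, averaged over small cubes of fixed size, has a
  constant tending to 1 as \<open>q \<rightarrow> \<infinity>\<close>; it turns this bound into \<open>u\<^sub>\<Lambda> \<le> T \<rho>\<close> and the Lipschitz constant \<open>T\<close>
  for the limit, and, applied to the Nehari identity
  \<open>\<lambda> \<parallel>u\<^sub>p\<parallel>\<^sub>\<infinity>\<^sup>p \<ge> \<parallel>\<nabla>u\<^sub>p\<parallel>\<^sub>q\<^sup>q\<close>, into \<open>liminf \<parallel>u\<^sub>p\<parallel>\<^sub>\<infinity> \<ge> R T\<close>. Hence all these inequalities are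
  equalities at the limit of the maximum points.\<close>

section \<open>Calculus of smooth functions\<close>

text \<open>The value of T comes from p-th roots. The competitor has amplitude about (l
  m^p)^(-1/(p-q)), with m close to R and l^(1/p) close to \<Lambda>, and p/(p-q) tends to 1/(1-Q).
  In the lower bound, with L the sup norm of the solution, the Nehari identity and Morrey's
  inequality give L^(p-q) >= 1/(l K^q) with K close to R; the limit is (\<Lambda> R^Q)^(-1/(1-Q)) =
  R T. The two bounds meet only because Morrey's factor is exactly 1 in the limit: a constant with a
  surviving dimensional factor would leave a gap. The price is an additive error of order \<epsilon>
  in the distance, removed by letting p tend to infinity first and \<epsilon> to 0 afterwards.
  Morrey's estimate is run on test functions, which are defined on the whole space and vanish
  outside \<Omega>. It therefore holds with the Euclidean distance between any two points of
  \<Omega>, and it reaches the continuous elements of the energy space by density. Since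
  \<open>weak_gradient\<close> is a \<open>SOME\<close> choice, uniqueness of weak gradients up to
  null sets underlies every norm computation.\<close>

lemma C_diff_SucD:
  assumes "C_diff (Suc k) f S"
  shows "C_diff k f S"
  using assms
proof (induction k arbitrary: f)
  case 0
  then show ?case
    by (auto intro!: continuous_at_imp_continuous_on differentiable_imp_continuous_within)
next
  case (Suc k)
  then show ?case by (metis C_diff.simps(2))
qed

lemma C_diff_cong:
  assumes "open S" "\<And>x. x \<in> S \<Longrightarrow> f x = g x" "C_diff k f S"
  shows "C_diff k g S"
  using assms(2,3)
proof (induction k arbitrary: f g)
  case 0
  then show ?case using continuous_on_cong by fastforce
next
  case (Suc k)
  have D: "(f has_derivative D) (at x) \<longleftrightarrow> (g has_derivative D) (at x)" if "x \<in> S" for x D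
    using has_derivative_transform_within_open[OF _ \<open>open S\<close> that] Suc.prems(1) by metis
  have "frechet_derivative f (at x) = frechet_derivative g (at x)" if "x \<in> S" for x
    unfolding frechet_derivative_def using D[OF that] by simp
  moreover have "g differentiable (at x)" if "x \<in> S" for x
    using D[OF that] Suc.prems(2) that by (metis C_diff.simps(2) differentiable_def)
  moreover have "C_diff k (\<lambda>x. frechet_derivative g (at x) b) S" if "b \<in> Basis" for b
    by (rule Suc.IH[of "\<lambda>x. frechet_derivative f (at x) b"])
       (use calculation Suc.prems that in auto)
  ultimately show ?case by simp
qed

text \<open>\<open>C_diff\<close> is phrased through \<open>frechet_derivative\<close>; this form
  accepts any explicit formula for the derivative on an open set, so inductions on k can work with
  product and chain rules.\<close>

lemma C_diff_SucI:
  assumes "open S"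
    and "\<And>x. x \<in> S \<Longrightarrow> (f has_derivative f' x) (at x)"
    and "\<And>b. b \<in> Basis \<Longrightarrow> C_diff k (\<lambda>x. f' x b) S"
  shows "C_diff (Suc k) f S"
proof -
  have "f differentiable (at x)" if "x \<in> S" for x
    using assms(2)[OF that] by (auto simp: differentiable_def)
  moreover have "C_diff k (\<lambda>x. frechet_derivative f (at x) b) S" if "b \<in> Basis" for b
    by (rule C_diff_cong[OF assms(1) _ assms(3)[OF that]])
       (metis assms(2) frechet_derivative_at)
  ultimately show ?thesis by simp
qed

lemma C_diff_Suc_derivative:
  assumes "C_diff (Suc k) f S" "x \<in> S"
  shows "(f has_derivative frechet_derivative f (at x)) (at x)"
  using assms frechet_derivative_works by auto

lemma C_diff_const: "open S \<Longrightarrow> C_diff k (\<lambda>_. c) S"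
proof (induction k arbitrary: c)
  case (Suc k)
  show ?case
    by (rule C_diff_SucI[where f' = "\<lambda>_ _. 0"]) (use Suc in auto)
qed auto

lemma C_diff_linear:
  assumes "open S" "bounded_linear f"
  shows "C_diff k f S"
proof (cases k)
  case 0
  then show ?thesis using assms by (simp add: linear_continuous_on)
next
  case (Suc j)
  show ?thesis unfolding Suc
    by (rule C_diff_SucI[where f' = "\<lambda>_. f"])
       (use assms C_diff_const in \<open>auto intro: bounded_linear_imp_has_derivative\<close>)
qed

lemma C_diff_add:
  assumes "open S" "C_diff k f S" "C_diff k g S"
  shows "C_diff k (\<lambda>x. f x + g x) S"
  using assms(2,3)
proof (induction k arbitrary: f g)
  case (Suc k)
  show ?case
    by (rule C_diff_SucI[where
          f' = "\<lambda>x b. frechet_derivative f (at x) b + frechet_derivative g (at x) b"])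
       (use assms(1) Suc in \<open>auto intro!: has_derivative_add C_diff_Suc_derivative\<close>)
qed (auto intro: continuous_intros)

lemma C_diff_mult:
  assumes "open S" "C_diff k f S" "C_diff k g S"
  shows "C_diff k (\<lambda>x. f x * g x) S"
  using assms(2,3)
proof (induction k arbitrary: f g)
  case (Suc k)
  show ?case
  proof (rule C_diff_SucI[where f' = "\<lambda>x b. f x * frechet_derivative g (at x) b
        + frechet_derivative f (at x) b * g x"])
    fix b :: 'a assume "b \<in> Basis"
    then show "C_diff k (\<lambda>x. f x * frechet_derivative g (at x) b
        + frechet_derivative f (at x) b * g x) S"
      using Suc.prems C_diff_SucD[OF Suc.prems(1)] C_diff_SucD[OF Suc.prems(2)]
      by (intro C_diff_add[OF assms(1)] Suc.IH) auto
  qed (use assms(1) Suc.prems in \<open>auto intro!: has_derivative_mult C_diff_Suc_derivative\<close>)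
qed (auto intro: continuous_intros)

text \<open>The derivative of f o g is g' times f' o g, and f' lies again in F. Inducting over all
  members of F at once therefore avoids any formula for higher derivatives of a composition.
  Derivatives are required only on I, which allows functions such as the square root.\<close>

lemma C_diff_compose:
  fixes F :: "(real \<Rightarrow> real) set"
  assumes "open S" "\<And>k. C_diff k g S" "g ` S \<subseteq> I" "f \<in> F"
    and "\<And>f. f \<in> F \<Longrightarrow> \<exists>f'\<in>F. \<forall>t\<in>I. (f has_real_derivative f' t) (at t)"
  shows "C_diff k (\<lambda>x. f (g x)) S"
  using assms(4)
proof (induction k arbitrary: f)
  case 0
  obtain f' where f': "\<forall>t\<in>I. (f has_real_derivative f' t) (at t)"
    using assms(5)[OF 0] by blast
  have "continuous_on S (\<lambda>x. f (g x))"
  proof (rule continuous_on_compose2[of I f])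
    show "continuous_on I f"
      using f' by (meson DERIV_isCont continuous_at_imp_continuous_on)
    show "continuous_on S g" using assms(2)[of 0] by simp
  qed (use assms(3) in auto)
  then show ?case by simp
next
  case (Suc k)
  obtain f' where f': "f' \<in> F" "\<forall>t\<in>I. (f has_real_derivative f' t) (at t)"
    using assms(5)[OF Suc.prems] by blast
  show ?case
  proof (rule C_diff_SucI[where f' = "\<lambda>x b. frechet_derivative g (at x) b * f' (g x)"])
    fix x assume x: "x \<in> S"
    then have "g x \<in> I" using assms(3) by auto
    then have "(f has_derivative (*) (f' (g x))) (at (g x))"
      using f'(2) unfolding has_field_derivative_def by blast
    from has_derivative_compose[OF C_diff_Suc_derivative[OF assms(2) x] this]
    show "((\<lambda>x. f (g x)) has_derivative
        (\<lambda>b. frechet_derivative g (at x) b * f' (g x))) (at x)"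
      by (simp add: mult.commute)
  next
    fix b :: 'a assume b: "b \<in> Basis"
    show "C_diff k (\<lambda>x. frechet_derivative g (at x) b * f' (g x)) S"
      using assms(2)[of "Suc k"] b by (intro C_diff_mult[OF assms(1)] Suc.IH f'(1)) auto
  qed (rule assms(1))
qed

lemma C_infinity_const: "C_infinity (\<lambda>_. c) UNIV"
  by (simp add: C_infinity_def C_diff_const)

lemma C_infinity_add:
  "C_infinity f UNIV \<Longrightarrow> C_infinity g UNIV \<Longrightarrow> C_infinity (\<lambda>x. f x + g x) UNIV"
  by (simp add: C_infinity_def C_diff_add)

lemma C_infinity_mult:
  "C_infinity f UNIV \<Longrightarrow> C_infinity g UNIV \<Longrightarrow> C_infinity (\<lambda>x. f x * g x) UNIV"
  by (simp add: C_infinity_def C_diff_mult)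

lemma C_infinity_diff:
  assumes "C_infinity f UNIV" "C_infinity g UNIV"
  shows "C_infinity (\<lambda>x. f x - g x) UNIV"
  using C_infinity_add[OF assms(1) C_infinity_mult[OF C_infinity_const[of "-1"] assms(2)]] by simp

lemma C_infinity_sum:
  "(\<And>i. i \<in> A \<Longrightarrow> C_infinity (f i) UNIV) \<Longrightarrow> C_infinity (\<lambda>x. \<Sum>i\<in>A. f i x) UNIV"
  by (induction A rule: infinite_finite_induct) (auto intro: C_infinity_const C_infinity_add)

lemma C_infinity_compose:
  fixes F :: "(real \<Rightarrow> real) set"
  assumes "C_infinity g UNIV" "range g \<subseteq> I" "f \<in> F"
    and "\<And>f. f \<in> F \<Longrightarrow> \<exists>f'\<in>F. \<forall>t\<in>I. (f has_real_derivative f' t) (at t)"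
  shows "C_infinity (\<lambda>x. f (g x)) UNIV"
  using assms C_diff_compose[of UNIV g I f F] by (simp add: C_infinity_def)

lemma C_infinity_norm_squared: "C_infinity (\<lambda>x::'a::euclidean_space. (norm (x - c))\<^sup>2) UNIV"
proof -
  have lin: "C_infinity (\<lambda>x::'a. x \<bullet> b + d) UNIV" for b d
    unfolding C_infinity_def
    by (intro allI C_diff_add C_diff_const C_diff_linear bounded_linear_inner_left open_UNIV)
  have "(\<lambda>x. (norm (x - c))\<^sup>2) = (\<lambda>x. \<Sum>b\<in>Basis. (x \<bullet> b + - (c \<bullet> b)) * (x \<bullet> b + - (c \<bullet> b)))"
    unfolding power2_norm_eq_inner
    by (rule ext, subst euclidean_inner) (simp add: inner_diff_left)
  then show ?thesis
    by (simp only:) (intro C_infinity_sum C_infinity_mult lin)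
qed

lemma C_infinity_has_derivative:
  "C_infinity f UNIV \<Longrightarrow> (f has_derivative frechet_derivative f (at x)) (at x)"
  unfolding C_infinity_def using C_diff_Suc_derivative by blast

lemma C_infinity_continuous: "C_infinity f UNIV \<Longrightarrow> continuous_on S f"
  unfolding C_infinity_def by (metis C_diff.simps(1) continuous_on_subset subset_UNIV)

lemma frechet_derivative_eq_sum_Basis:
  fixes f :: "'a::euclidean_space \<Rightarrow> real"
  assumes "f differentiable (at x)"
  shows "frechet_derivative f (at x) e = (\<Sum>b\<in>Basis. (e \<bullet> b) * frechet_derivative f (at x) b)"
proof -
  interpret linear "frechet_derivative f (at x)"
    using assms by (rule linear_frechet_derivative)
  show ?thesis
    by (subst (1) euclidean_representation[of e, symmetric]) (simp add: sum scale)
qed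

lemma C_infinity_continuous_derivative:
  fixes f :: "'a::euclidean_space \<Rightarrow> real"
  assumes "C_infinity f UNIV"
  shows "continuous_on S (\<lambda>x. frechet_derivative f (at x) e)"
proof -
  have d: "f differentiable (at x)" for x
    using C_infinity_has_derivative[OF assms] differentiable_def by blast
  have "continuous_on UNIV (\<lambda>x. frechet_derivative f (at x) b)" if "b \<in> Basis" for b
    using assms that unfolding C_infinity_def by (metis C_diff.simps(1) C_diff.simps(2))
  then show ?thesis
    unfolding frechet_derivative_eq_sum_Basis[OF d, of _ e]
    by (intro continuous_intros) (auto intro: continuous_on_subset)
qed

section \<open>Test functions\<close>

text \<open>The flat function exp(-1/t), extended by 0, together with all factors p(1/t) that its
  derivatives produce: a family closed under differentiation, as \<open>C_diff_compose\<close>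
  wants.\<close>

definition cutoff :: "real poly \<Rightarrow> real \<Rightarrow> real" where
  "cutoff p t = (if t > 0 then poly p (1 / t) * exp (- 1 / t) else 0)"

text \<open>The free exponent k absorbs the factor s that \<open>pCons\<close> splits off, so the
  induction reduces to a single power against the exponential.\<close>

lemma power_poly_exp_tendsto_0:
  "((\<lambda>s::real. s ^ k * poly p s * exp (- s)) \<longlongrightarrow> 0) at_top"
proof (induction p arbitrary: k)
  case (pCons a p)
  have "((\<lambda>s. a * (s ^ k / exp s) + s ^ Suc k * poly p s * exp (- s)) \<longlongrightarrow> a * 0 + 0) at_top"
    by (intro tendsto_intros tendsto_power_div_exp_0 pCons)
  then show ?case
    by (simp add: algebra_simps exp_minus divide_inverse)
qed simp

text \<open>For t > 0, with s = 1/t, differentiating p(s) exp(-s) in t gives s^2 (p(s) - p'(s))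
  exp(-s). At t = 0 the right difference quotient becomes s p(s) exp(-s) with s tending to infinity,
  hence 0.\<close>

lemma cutoff_has_derivative:
  "(cutoff p has_real_derivative cutoff (monom 1 2 * (p - pderiv p)) t) (at t)"
proof -
  consider "t > 0" | "t < 0" | "t = 0" by linarith
  then show ?thesis
  proof cases
    case 1
    have "((\<lambda>t. poly p (1 / t) * exp (- 1 / t)) has_real_derivative
        cutoff (monom 1 2 * (p - pderiv p)) t) (at t)"
      using 1 unfolding cutoff_def
      by (auto intro!: derivative_eq_intros DERIV_chain2[OF poly_DERIV]
          simp: poly_monom field_simps power2_eq_square)
    then show ?thesis
      by (rule has_field_derivative_transform_within_open[where S = "{0<..}"])
        (use 1 in \<open>auto simp: cutoff_def\<close>)
  next
    case 2
    have "((\<lambda>t. 0) has_real_derivative cutoff (monom 1 2 * (p - pderiv p)) t) (at t)"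
      using 2 by (simp add: cutoff_def)
    then show ?thesis
      by (rule has_field_derivative_transform_within_open[where S = "{..<0}"])
        (use 2 in \<open>auto simp: cutoff_def\<close>)
  next
    case 3
    have "((\<lambda>s. s ^ 1 * poly p s * exp (- s)) \<longlongrightarrow> 0) at_top"
      by (rule power_poly_exp_tendsto_0)
    then have "((\<lambda>s. cutoff p (inverse s) / inverse s) \<longlongrightarrow> 0) at_top"
      by (rule Lim_transform_eventually)
        (auto simp: cutoff_def field_simps intro!: eventually_mono[OF eventually_gt_at_top[of 0]])
    then have "((\<lambda>h. cutoff p h / h) \<longlongrightarrow> 0) (at_right 0)"
      by (simp add: filterlim_at_right_to_top)
    moreover have "((\<lambda>h. cutoff p h / h) \<longlongrightarrow> 0) (at_left 0)"
      by (rule tendsto_eventually) (auto simp: eventually_at_left_field cutoff_def intro: exI[of _ "-1"])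
    ultimately have "((\<lambda>h. cutoff p h / h) \<longlongrightarrow> 0) (at 0)"
      using filterlim_split_at by blast
    then show ?thesis using 3 by (simp add: DERIV_def cutoff_def)
  qed
qed

lemma C_infinity_cutoff: "C_infinity f UNIV \<Longrightarrow> C_infinity (\<lambda>x. cutoff p (f x)) UNIV"
  by (rule C_infinity_compose[of f UNIV "cutoff p" "range cutoff"])
     (use cutoff_has_derivative in blast)+

lemma C_infinity_sqrt:
  assumes "C_infinity f UNIV" "\<And>x. f x > 0"
  shows "C_infinity (\<lambda>x. sqrt (f x)) UNIV"
proof -
  define F where "F = range (\<lambda>(c, a) t. c * t powr a :: real)"
  have "C_infinity (\<lambda>x. (\<lambda>t. 1 * t powr (1 / 2)) (f x)) UNIV"
  proof (rule C_infinity_compose[of f "{0<..}" _ F])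
    fix h assume "h \<in> F"
    then obtain c a where h: "h = (\<lambda>t. c * t powr a)" by (auto simp: F_def)
    have "\<forall>t\<in>{0<..}. (h has_real_derivative (c * a) * t powr (a - 1)) (at t)"
      unfolding h by (auto intro!: derivative_eq_intros)
    moreover have "(\<lambda>t. (c * a) * t powr (a - 1)) \<in> F"
      unfolding F_def by (rule image_eqI[of _ _ "(c * a, a - 1)"]) auto
    ultimately show "\<exists>h'\<in>F. \<forall>t\<in>{0<..}. (h has_real_derivative h' t) (at t)" by (rule bexI)
  qed (use assms in \<open>auto simp: F_def intro!: image_eqI[of _ _ "(1, 1/2)"]\<close>)
  then show ?thesis using assms(2) by (simp add: powr_half_sqrt less_imp_le)
qed

text \<open>A smooth saturation: it keeps 0 at 0, maps nonnegative values into [0, 1), and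
  approaches 1 on positive values as k grows. It turns a positive smooth function into an
  approximate indicator.\<close>

lemma C_infinity_one_minus_exp:
  assumes "C_infinity f UNIV"
  shows "C_infinity (\<lambda>x. 1 - exp (- (k * f x))) UNIV"
proof -
  define F where "F = range (\<lambda>c t. c * exp (- (k * t)) :: real)"
  have "C_infinity (\<lambda>x. (\<lambda>t. 1 * exp (- (k * t))) (f x)) UNIV"
  proof (rule C_infinity_compose[of f UNIV _ F])
    fix h assume "h \<in> F"
    then obtain c where h: "h = (\<lambda>t. c * exp (- (k * t)))" by (auto simp: F_def)
    have "\<forall>t\<in>UNIV. (h has_real_derivative (- c * k) * exp (- (k * t))) (at t)"
      unfolding h by (auto intro!: derivative_eq_intros)
    moreover have "(\<lambda>t. (- c * k) * exp (- (k * t))) \<in> F" unfolding F_def by blast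
    ultimately show "\<exists>h'\<in>F. \<forall>t\<in>UNIV. (h has_real_derivative h' t) (at t)" by (rule bexI)
  qed (use assms in \<open>auto simp: F_def intro!: image_eqI[of _ _ 1]\<close>)
  then show ?thesis using C_infinity_diff[OF C_infinity_const] by fastforce
qed

lemma test_functionsI:
  fixes \<phi> :: "'a::euclidean_space \<Rightarrow> real"
  assumes "C_infinity \<phi> UNIV" "compact K" "K \<subseteq> \<Omega>" "\<And>x. x \<notin> K \<Longrightarrow> \<phi> x = 0"
  shows "\<phi> \<in> test_functions \<Omega>"
proof -
  have "closure {x. \<phi> x \<noteq> 0} \<subseteq> K"
    by (rule closure_minimal) (use assms in \<open>auto simp: compact_imp_closed\<close>)
  then show ?thesis
    using assms closed_Int_compact[OF closed_closure[of "{x. \<phi> x \<noteq> 0}"] \<open>compact K\<close>]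
    unfolding test_functions_def by (simp add: Int_absorb2)
qed

lemma test_functionsE:
  assumes "\<phi> \<in> test_functions \<Omega>"
  obtains K where "C_infinity \<phi> UNIV" "compact K" "K \<subseteq> \<Omega>" "\<And>x. x \<notin> K \<Longrightarrow> \<phi> x = 0"
  using assms closure_subset[of "{x. \<phi> x \<noteq> 0}"]
  by (intro that[of "closure {x. \<phi> x \<noteq> 0}"]) (auto simp: test_functions_def)

lemma test_functions_cmult:
  assumes "\<phi> \<in> test_functions \<Omega>"
  shows "(\<lambda>x. c * \<phi> x) \<in> test_functions \<Omega>"
proof -
  obtain K where K: "C_infinity \<phi> UNIV" "compact K" "K \<subseteq> \<Omega>" "\<And>x. x \<notin> K \<Longrightarrow> \<phi> x = 0"
    using test_functionsE[OF assms] by blast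
  show ?thesis
    by (rule test_functionsI[of _ K]) (use K in \<open>auto intro!: C_infinity_mult C_infinity_const\<close>)
qed

text \<open>The usual mollifier profile, left unnormalised: its integral does not depend on the
  centre and is divided out where it is used.\<close>

definition bump :: "'a::euclidean_space \<Rightarrow> real \<Rightarrow> 'a \<Rightarrow> real" where
  "bump c r x = cutoff 1 (r\<^sup>2 - (norm (x - c))\<^sup>2)"

lemma C_infinity_bump: "C_infinity (bump c r) UNIV"
  unfolding bump_def
  by (intro C_infinity_cutoff C_infinity_diff C_infinity_const C_infinity_norm_squared)

lemma bump_nonneg: "bump c r x \<ge> 0"
  by (simp add: bump_def cutoff_def)

lemma bump_pos_iff: "r > 0 \<Longrightarrow> bump c r x > 0 \<longleftrightarrow> x \<in> ball c r"
  by (auto simp: bump_def cutoff_def dist_norm norm_minus_commute abs_square_less_1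
      power_strict_mono intro: power2_less_imp_less)

lemma bump_eq_0: "r > 0 \<Longrightarrow> x \<notin> ball c r \<Longrightarrow> bump c r x = 0"
  using bump_pos_iff bump_nonneg by (metis less_eq_real_def)

lemma bump_test_function:
  assumes "r > 0" "cball c r \<subseteq> \<Omega>"
  shows "bump c r \<in> test_functions \<Omega>"
  by (rule test_functionsI[of _ "cball c r"])
     (use assms in \<open>auto intro!: C_infinity_bump bump_eq_0\<close>)

text \<open>The smoothed cone \<open>\<theta> (R - sqrt (\<bar>x - c\<bar>\<^sup>2 + d\<^sup>2))\<close> with \<open>\<theta> t = t * exp (- d / t)\<close>
  for \<open>t > 0\<close>: then \<open>0 \<le> \<theta>' \<le> 1\<close> and \<open>\<theta> t \<ge> t - d\<close>.\<close>

definition smooth_cone :: "'a::euclidean_space \<Rightarrow> real \<Rightarrow> real \<Rightarrow> 'a \<Rightarrow> real" where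
  "smooth_cone c R d x =
     (let r = R - sqrt ((norm (x - c))\<^sup>2 + d\<^sup>2) in r * cutoff 1 (1 / d * r))"

lemma smooth_cone_test_function:
  assumes "0 < d" "d < R" "ball c R \<subseteq> \<Omega>"
  shows "smooth_cone c R d \<in> test_functions \<Omega>"
\<comment> \<open>The regularised distance sqrt(|x - c|^2 + d^2) is below R exactly when |x - c|^2 <
  R^2 - d^2, so the support stays compactly inside the open ball of radius R.\<close>
proof (rule test_functionsI[of _ "cball c (sqrt (R\<^sup>2 - d\<^sup>2))"])
  have "C_infinity (\<lambda>x. sqrt ((norm (x - c))\<^sup>2 + d\<^sup>2)) UNIV"
    using assms by (intro C_infinity_sqrt C_infinity_add C_infinity_norm_squared C_infinity_const)
      (simp add: add_nonneg_pos)
  then show "C_infinity (smooth_cone c R d) UNIV"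
    unfolding smooth_cone_def Let_def
    by (intro C_infinity_mult C_infinity_cutoff C_infinity_diff C_infinity_const)
  have "sqrt (R\<^sup>2 - d\<^sup>2) < R"
    using assms by (intro real_less_lsqrt) auto
  then show "cball c (sqrt (R\<^sup>2 - d\<^sup>2)) \<subseteq> \<Omega>"
    using assms(3) by (auto simp: subset_iff)
  fix x assume "x \<notin> cball c (sqrt (R\<^sup>2 - d\<^sup>2))"
  then have "sqrt (R\<^sup>2 - d\<^sup>2) < norm (x - c)"
    by (simp add: dist_norm norm_minus_commute)
  then have "R\<^sup>2 - d\<^sup>2 < (norm (x - c))\<^sup>2"
    by (meson norm_ge_zero not_less real_le_rsqrt real_sqrt_le_iff real_le_lsqrt)
  then have "R < sqrt ((norm (x - c))\<^sup>2 + d\<^sup>2)"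
    using assms by (intro real_less_rsqrt) auto
  then show "smooth_cone c R d x = 0"
    using assms(1) by (simp add: smooth_cone_def cutoff_def Let_def zero_less_divide_iff)
qed auto

text \<open>At the centre the regularised distance is d, so the value is (R - d) exp(-d/(R - d)),
  and exp(-a) >= 1 - a.\<close>

lemma smooth_cone_center:
  assumes "0 < d" "d < R"
  shows "R - 2 * d \<le> smooth_cone c R d c"
proof -
  have "1 - d / (R - d) \<le> exp (- d / (R - d))"
    using exp_ge_add_one_self[of "- d / (R - d)"] by simp
  then have "(R - d) * (1 - d / (R - d)) \<le> (R - d) * exp (- d / (R - d))"
    using assms by (intro mult_left_mono) auto
  moreover have "(R - d) * (1 - d / (R - d)) = R - 2 * d"
    using assms by (simp add: field_simps)
  ultimately show ?thesis
    using assms by (simp add: smooth_cone_def cutoff_def Let_def)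
qed

text \<open>Chain rule: the regularised distance s has gradient (x - c)/s of norm at most 1, and the
  outer derivative is (1 + 1/r) exp(-1/r) for r > 0, which lies in [0, 1] because 1 + a <= exp
  a.\<close>

lemma smooth_cone_derivative_le:
  assumes "0 < d"
  shows "\<bar>frechet_derivative (smooth_cone c R d) (at x) e\<bar> \<le> norm e"
proof -
  define s where "s = sqrt ((norm (x - c))\<^sup>2 + d\<^sup>2)"
  define r where "r = 1 / d * (R - s)"
  define D where "D = cutoff 1 r + r * cutoff (monom 1 2 * (1 - pderiv 1)) r"
  have pos: "(norm (x - c))\<^sup>2 + d\<^sup>2 > 0" using assms by (simp add: add_nonneg_pos)
  have D: "0 \<le> D" "D \<le> 1"
  proof -
    show "0 \<le> D" by (auto simp: D_def cutoff_def poly_monom pderiv_1)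
    have "(1 + 1 / r) * exp (- 1 / r) \<le> 1" if "r > 0"
      using exp_ge_add_one_self[of "1 / r"] that by (simp add: exp_minus field_simps)
    moreover have "D = (1 + 1 / r) * exp (- 1 / r)" if "r > 0"
      using that by (simp add: D_def cutoff_def poly_monom pderiv_1 field_simps power2_eq_square)
    moreover have "D = 0" if "\<not> r > 0" using that by (simp add: D_def cutoff_def)
    ultimately show "D \<le> 1" by (cases "r > 0") auto
  qed
  have sq: "((\<lambda>x. sqrt ((norm (x - c))\<^sup>2 + d\<^sup>2)) has_derivative (\<lambda>h. ((x - c) \<bullet> h) / s)) (at x)"
    unfolding power2_norm_eq_inner s_def
    using pos unfolding power2_norm_eq_inner
    by (auto intro!: derivative_eq_intros simp: field_simps inner_commute)
  have "((\<lambda>t. t * cutoff 1 (1 / d * t)) has_real_derivative D) (at (R - s))"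
    unfolding D_def r_def using assms
    by (auto intro!: derivative_eq_intros DERIV_chain2[OF cutoff_has_derivative])
  then have "((\<lambda>t. t * cutoff 1 (1 / d * t)) has_derivative (*) D) (at (R - s))"
    by (simp add: has_field_derivative_def)
  from has_derivative_compose[OF has_derivative_diff[OF has_derivative_const sq]
      this[unfolded s_def]]
  have "(smooth_cone c R d has_derivative (\<lambda>h. D * (0 - ((x - c) \<bullet> h) / s))) (at x)"
    unfolding smooth_cone_def[abs_def] Let_def s_def .
  then have "frechet_derivative (smooth_cone c R d) (at x) e = D * (0 - ((x - c) \<bullet> e) / s)"
    using frechet_derivative_at by metis
  moreover have "\<bar>D * (0 - ((x - c) \<bullet> e) / s)\<bar> \<le> 1 * norm e"
    unfolding abs_mult
  proof (rule mult_mono)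
    have "norm (x - c) \<le> s" unfolding s_def by (rule real_le_rsqrt) simp
    then have "\<bar>(x - c) \<bullet> e\<bar> \<le> s * norm e"
      by (meson Cauchy_Schwarz_ineq2 mult_right_mono norm_ge_zero order_trans)
    moreover have "s > 0" using pos by (simp add: s_def)
    ultimately show "\<bar>0 - ((x - c) \<bullet> e) / s\<bar> \<le> norm e"
      by (simp add: field_simps)
  qed (use D in auto)
  ultimately show ?thesis by simp
qed

section \<open>Smooth approximation of indicators and uniqueness of weak gradients\<close>

text \<open>No convolution is involved. Finitely many bumps of radius \<open>r n\<close> centred in
  C have a sum \<eta> that is positive on C and zero outside the \<open>r n\<close>-neighbourhood;
  saturating \<eta> by 1 - exp(-k \<eta>) with large k pushes it to 1 on C. The common compact K
  later provides the majorant for dominated convergence.\<close>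

lemma compact_indicator_approx:
  fixes C :: "'a::euclidean_space set"
  assumes "compact C" "open \<Omega>" "C \<subseteq> \<Omega>"
  obtains K \<phi> where "compact K" "K \<subseteq> \<Omega>" "\<And>n::nat. \<phi> n \<in> test_functions \<Omega>"
    "\<And>n x. 0 \<le> \<phi> n x" "\<And>n x. \<phi> n x \<le> 1" "\<And>n x. x \<notin> K \<Longrightarrow> \<phi> n x = 0"
    "\<And>x. (\<lambda>n. \<phi> n x) \<longlonglongrightarrow> indicator C x"
proof (cases "C = {}")
  case True
  show thesis
    by (rule that[of "{}" "\<lambda>_ _. 0"]) (auto simp: True test_functions_def C_infinity_const)
next
  case False
  obtain \<delta> where \<delta>: "\<delta> > 0" "{x. infdist x C \<le> \<delta>} \<subseteq> \<Omega>"
    using compact_in_open_separated[OF False assms(1,2,3)] by blast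
  define K where "K r = {x. infdist x C \<le> r}" for r
  have K: "compact (K r)" if "r > 0" for r
    unfolding K_def by (rule compact_infdist_le) (use False assms that in auto)
  define r where "r n = \<delta> / real (Suc n)" for n
  have r: "r n > 0" "r n \<le> \<delta>" for n
    using \<delta>(1) by (auto simp: r_def field_simps)
  have "\<exists>\<phi>. C_infinity \<phi> UNIV \<and> (\<forall>x. 0 \<le> \<phi> x \<and> \<phi> x \<le> 1) \<and> (\<forall>x. x \<notin> K (r n) \<longrightarrow> \<phi> x = 0)
      \<and> (\<forall>x\<in>C. 1 - exp (- real n) \<le> \<phi> x)" for n
  proof -
    obtain D where D: "D \<subseteq> C" "finite D" "C \<subseteq> (\<Union>c\<in>D. ball c (r n))"
    proof (rule compactE_image[OF assms(1), of C "\<lambda>c. ball c (r n)"])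
      show "C \<subseteq> (\<Union>c\<in>C. ball c (r n))" using r(1)[of n] by force
    qed auto
    define \<eta> where "\<eta> x = (\<Sum>c\<in>D. bump c (r n) x)" for x
    have sm: "C_infinity \<eta> UNIV"
      unfolding \<eta>_def by (intro C_infinity_sum C_infinity_bump)
    have nonneg: "\<eta> x \<ge> 0" for x
      unfolding \<eta>_def by (intro sum_nonneg bump_nonneg)
    have pos: "\<eta> x > 0" if "x \<in> C" for x
    proof -
      obtain c where "c \<in> D" "x \<in> ball c (r n)" using D(3) \<open>x \<in> C\<close> by blast
      then show ?thesis
        unfolding \<eta>_def using bump_pos_iff[OF r(1)]
        by (intro sum_pos2[OF D(2), of c]) (auto intro: bump_nonneg)
    qed
    obtain z where z: "z \<in> C" "\<And>x. x \<in> C \<Longrightarrow> \<eta> z \<le> \<eta> x"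
      using continuous_attains_inf[OF assms(1) False C_infinity_continuous[OF sm]] by blast
    \<comment> \<open>Dividing by the minimum of \<eta> over C makes the exponent at least n
      everywhere on C.\<close>
    define \<phi> where "\<phi> x = 1 - exp (- (real n / \<eta> z * \<eta> x))" for x
    have "\<phi> x = 0" if "x \<notin> K (r n)" for x
    proof -
      have "x \<notin> ball c (r n)" if "c \<in> D" for c
        using that D(1) \<open>x \<notin> K (r n)\<close> infdist_le[of c C x]
        by (auto simp: K_def dist_commute)
      then have "\<eta> x = 0" unfolding \<eta>_def using bump_eq_0[OF r(1)[of n]] by (intro sum.neutral) blast
      then show ?thesis by (simp add: \<phi>_def)
    qed
    moreover have "1 - exp (- real n) \<le> \<phi> x" if "x \<in> C" for x
    proof -
      have "real n * 1 \<le> real n * (\<eta> x / \<eta> z)"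
        using z(2)[OF that] pos[OF z(1)] by (intro mult_left_mono) auto
      then show ?thesis by (simp add: \<phi>_def)
    qed
    moreover have "0 \<le> \<phi> x \<and> \<phi> x \<le> 1" for x
      using nonneg[of x] pos[OF z(1)] by (simp add: \<phi>_def)
    moreover have "C_infinity \<phi> UNIV"
      unfolding \<phi>_def by (rule C_infinity_one_minus_exp[OF sm])
    ultimately show ?thesis by blast
  qed
  then obtain \<phi> where \<phi>: "\<And>n. C_infinity (\<phi> n) UNIV" "\<And>n x. 0 \<le> \<phi> n x"
      "\<And>n x. \<phi> n x \<le> 1" "\<And>n x. x \<notin> K (r n) \<Longrightarrow> \<phi> n x = 0"
      "\<And>n x. x \<in> C \<Longrightarrow> 1 - exp (- real n) \<le> \<phi> n x"
    by metis
  have Kmono: "K (r n) \<subseteq> K \<delta>" for n using r(2)[of n] by (auto simp: K_def)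
  show thesis
  proof (rule that[of "K \<delta>" \<phi>])
    show "compact (K \<delta>)" by (rule K) (rule \<delta>(1))
    show "K \<delta> \<subseteq> \<Omega>" using \<delta>(2) by (simp add: K_def)
    show "\<phi> n \<in> test_functions \<Omega>" for n
      by (rule test_functionsI[of _ "K (r n)"])
        (rule \<phi>(1) K[OF r(1)] order_trans[OF Kmono \<open>K \<delta> \<subseteq> \<Omega>\<close>] \<phi>(4), assumption?)+
    show "\<phi> n x = 0" if "x \<notin> K \<delta>" for n x using \<phi>(4) Kmono that by blast
    show "(\<lambda>n. \<phi> n x) \<longlonglongrightarrow> indicator C x" for x
    proof (cases "x \<in> C")
      case True
      have "(\<lambda>n. \<phi> n x) \<longlonglongrightarrow> 1"
      proof (rule tendsto_sandwich)
        show "(\<lambda>n. 1 - exp (- real n)) \<longlonglongrightarrow> 1" by real_asymp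
      qed (use \<phi> True in auto)
      then show ?thesis using True by simp
    next
      case False
      then have "infdist x C > 0"
        using assms(1) \<open>C \<noteq> {}\<close> in_closed_iff_infdist_zero[of C x] infdist_nonneg[of x C]
        by (auto simp: compact_imp_closed less_le)
      moreover have "r \<longlonglongrightarrow> 0" unfolding r_def by real_asymp
      ultimately have "eventually (\<lambda>n. r n < infdist x C) sequentially"
        by (rule order_tendstoD(2)[rotated])
      then have "eventually (\<lambda>n. \<phi> n x = 0) sequentially"
        by eventually_elim (use \<phi>(4) in \<open>auto simp: K_def\<close>)
      then show ?thesis using False by (simp add: tendsto_eventually)
    qed
    show "0 \<le> \<phi> n x" "\<phi> n x \<le> 1" for n x by (rule \<phi>)+
  qed
qed

section \<open>Local integrability and pairing with test functions\<close>

lemma C_infinity_measurable: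
  "C_infinity f UNIV \<Longrightarrow> f \<in> borel_measurable borel"
  using borel_measurable_continuous_onI C_infinity_continuous by blast

lemma borel_measurable_lebesgue:
  fixes f :: "'a::euclidean_space \<Rightarrow> 'b::topological_space"
  shows "f \<in> borel_measurable borel \<Longrightarrow> f \<in> borel_measurable lebesgue"
  by (simp add: measurable_completion)

lemma test_function_measurable:
  "\<phi> \<in> test_functions \<Omega> \<Longrightarrow> \<phi> \<in> borel_measurable borel"
  by (simp add: test_functions_def C_infinity_measurable)

lemma test_function_bounded:
  assumes "\<phi> \<in> test_functions \<Omega>"
  obtains B where "\<And>x. \<bar>\<phi> x\<bar> \<le> B"
proof -
  obtain K where K: "C_infinity \<phi> UNIV" "compact K" "K \<subseteq> \<Omega>" "\<And>x. x \<notin> K \<Longrightarrow> \<phi> x = 0"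
    using test_functionsE[OF assms] by blast
  have "bounded (\<phi> ` K)"
    by (intro compact_imp_bounded compact_continuous_image C_infinity_continuous K)
  then obtain B where B: "\<And>x. x \<in> K \<Longrightarrow> \<bar>\<phi> x\<bar> \<le> B"
    unfolding bounded_iff by auto
  show thesis
  proof (rule that)
    show "\<bar>\<phi> x\<bar> \<le> max 0 B" for x
      by (cases "x \<in> K") (use B[of x] K(4)[of x] in auto)
  qed
qed

lemma locally_integrable_compact:
  fixes f :: "'a::euclidean_space \<Rightarrow> 'b::euclidean_space"
  assumes "locally_integrable \<Omega> f" "compact K" "K \<subseteq> \<Omega>"
  shows "integrable lebesgue (\<lambda>x. if x \<in> K then f x else 0)"
proof -
  have "K \<in> sets lebesgue" using assms(2) by (simp add: lmeasurable_compact fmeasurableD)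
  then show ?thesis
    using assms by (simp add: locally_integrable_def Lebesgue_Measure.integrable_restrict_UNIV)
qed

lemma locally_integrable_measurable:
  fixes f :: "'a::euclidean_space \<Rightarrow> 'b::euclidean_space"
  assumes "locally_integrable \<Omega> f" "open \<Omega>"
  shows "f \<in> borel_measurable (lebesgue_on \<Omega>)"
proof -
  obtain C where C: "\<And>n. compact (C n)" "\<And>n. C n \<subseteq> \<Omega>" "\<And>n. C n \<subseteq> C (Suc n)" "\<Union>(range C) = \<Omega>"
    using open_Union_compact_subsets[OF assms(2)] by (metis interior_subset subset_trans)
  have mono: "C m \<subseteq> C n" if "m \<le> n" for m n using lift_Suc_mono_le[of C] C(3) that by blast
  have "(\<lambda>x. if x \<in> \<Omega> then f x else 0) \<in> borel_measurable lebesgue"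
  proof (rule borel_measurable_LIMSEQ_metric)
    show "(\<lambda>x. if x \<in> C n then f x else 0) \<in> borel_measurable lebesgue" for n
      using locally_integrable_compact[OF assms(1) C(1) C(2)]
      by (rule borel_measurable_integrable)
    fix x
    show "(\<lambda>n. if x \<in> C n then f x else 0) \<longlonglongrightarrow> (if x \<in> \<Omega> then f x else 0)"
    proof (cases "x \<in> \<Omega>")
      case True
      then obtain m where "x \<in> C m" using C(4) by auto
      then have "eventually (\<lambda>n. (if x \<in> C n then f x else 0) = f x) sequentially"
        using mono by (auto simp: eventually_sequentially intro!: exI[of _ m])
      then show ?thesis using True by (simp add: tendsto_eventually)
    next
      case False
      then have "x \<notin> C n" for n using C(2) by blast
      then show ?thesis using False by simp
    qed
  qed
  then show ?thesis
    using assms(2) by (simp add: borel_measurable_if lborelD_Collect)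
qed

lemma has_weak_gradient_measurable:
  "open \<Omega> \<Longrightarrow> has_weak_gradient \<Omega> u G \<Longrightarrow> u \<in> borel_measurable (lebesgue_on \<Omega>)"
  "open \<Omega> \<Longrightarrow> has_weak_gradient \<Omega> u G \<Longrightarrow> G \<in> borel_measurable (lebesgue_on \<Omega>)"
  by (simp_all add: has_weak_gradient_def locally_integrable_measurable)

lemma integral_test_function_eq:
  fixes g :: "'a::euclidean_space \<Rightarrow> real"
  assumes "open \<Omega>" "K \<subseteq> \<Omega>" "\<And>x. x \<notin> K \<Longrightarrow> \<phi> x = 0"
  shows "(LINT x|lebesgue_on \<Omega>. g x * \<phi> x) = (LINT x|lebesgue. (if x \<in> K then g x else 0) * \<phi> x)"
proof -
  have "(LINT x|lebesgue_on \<Omega>. g x * \<phi> x) = (LINT x|lebesgue. (if x \<in> \<Omega> then g x * \<phi> x else 0))"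
    using assms(1) by (simp add: Lebesgue_Measure.integral_restrict_UNIV)
  also have "(\<lambda>x. if x \<in> \<Omega> then g x * \<phi> x else 0) = (\<lambda>x. (if x \<in> K then g x else 0) * \<phi> x)"
    by (rule ext) (use assms(2,3) in auto)
  finally show ?thesis .
qed

lemma integrable_mult_bounded:
  fixes f g :: "'a \<Rightarrow> real"
  assumes "integrable M f" "g \<in> borel_measurable M" "\<And>x. \<bar>g x\<bar> \<le> B"
  shows "integrable M (\<lambda>x. f x * g x)"
proof (rule Bochner_Integration.integrable_bound)
  show "integrable M (\<lambda>x. B * f x)" using assms(1) by simp
  show "(\<lambda>x. f x * g x) \<in> borel_measurable M"
    by (rule borel_measurable_times[OF borel_measurable_integrable[OF assms(1)] assms(2)])
  have "\<bar>g x\<bar> \<le> \<bar>B\<bar>" for x using assms(3)[of x] by linarith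
  then show "AE x in M. norm (f x * g x) \<le> norm (B * f x)"
    by (intro AE_I2) (simp add: abs_mult mult.commute[of "\<bar>f _\<bar>"] mult_right_mono)
qed

lemma integrable_test_function:
  fixes g :: "'a::euclidean_space \<Rightarrow> real"
  assumes "open \<Omega>" "locally_integrable \<Omega> g" "\<phi> \<in> test_functions \<Omega>"
  shows "integrable (lebesgue_on \<Omega>) (\<lambda>x. g x * \<phi> x)"
proof -
  obtain K where K: "C_infinity \<phi> UNIV" "compact K" "K \<subseteq> \<Omega>" "\<And>x. x \<notin> K \<Longrightarrow> \<phi> x = 0"
    using test_functionsE[OF assms(3)] by blast
  obtain B where B: "\<And>x. \<bar>\<phi> x\<bar> \<le> B" using test_function_bounded[OF assms(3)] by blast
  have \<phi>m: "\<phi> \<in> borel_measurable lebesgue"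
    using test_function_measurable[OF assms(3)] by (rule borel_measurable_lebesgue)
  have "integrable lebesgue (\<lambda>x. (if x \<in> K then g x else 0) * \<phi> x)"
    by (rule integrable_mult_bounded[OF locally_integrable_compact[OF assms(2) K(2,3)] \<phi>m B])
  also have "(\<lambda>x. (if x \<in> K then g x else 0) * \<phi> x) = (\<lambda>x. if x \<in> \<Omega> then g x * \<phi> x else 0)"
    by (rule ext) (use K in auto)
  finally show ?thesis
    using assms(1) by (simp add: Lebesgue_Measure.integrable_restrict_UNIV)
qed

text \<open>The fundamental lemma of the calculus of variations in one-sided form, so that it yields
  uniqueness (applied to g and -g) as well as pointwise bounds on weak gradients. Approximating
  indicators gives a nonnegative integral over every compact subset; compact sets on which g < 0 are
  then null, and inner regularity handles the whole set where g < 0.\<close>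

lemma AE_nonneg_if_test_integrals_nonneg:
  fixes g :: "'a::euclidean_space \<Rightarrow> real"
  assumes "open \<Omega>" "locally_integrable \<Omega> g"
    and "\<And>\<phi>. \<phi> \<in> test_functions \<Omega> \<Longrightarrow> (\<And>x. 0 \<le> \<phi> x) \<Longrightarrow> 0 \<le> (LINT x|lebesgue_on \<Omega>. g x * \<phi> x)"
  shows "AE x in lebesgue_on \<Omega>. 0 \<le> g x"
proof -
  have nonneg: "0 \<le> (LINT x|lebesgue_on C. g x)" if C: "compact C" "C \<subseteq> \<Omega>" for C
  proof -
    obtain K \<phi> where K: "compact K" "K \<subseteq> \<Omega>" "\<And>n::nat. \<phi> n \<in> test_functions \<Omega>"
      "\<And>n x. 0 \<le> \<phi> n x" "\<And>n x. \<phi> n x \<le> 1" "\<And>n x. x \<notin> K \<Longrightarrow> \<phi> n x = 0"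
      "\<And>x. (\<lambda>n. \<phi> n x) \<longlonglongrightarrow> indicator C x"
      using compact_indicator_approx[OF C(1) assms(1) C(2)] by blast
    define gK where "gK x = (if x \<in> K then g x else 0)" for x
    have i: "integrable lebesgue gK"
      unfolding gK_def by (rule locally_integrable_compact[OF assms(2) K(1,2)])
    have [measurable]: "gK \<in> borel_measurable lebesgue" using i by (rule borel_measurable_integrable)
    have [measurable]: "\<phi> n \<in> borel_measurable lebesgue" for n
      using test_function_measurable[OF K(3)] by (rule borel_measurable_lebesgue)
    have Cs: "C \<in> sets lebesgue" using C(1) by (simp add: lmeasurable_compact fmeasurableD)
    have "(\<lambda>n. LINT x|lebesgue. gK x * \<phi> n x) \<longlonglongrightarrow> (LINT x|lebesgue. gK x * indicator C x)"
    proof (rule integral_dominated_convergence[where w = "\<lambda>x. \<bar>gK x\<bar>"])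
      show "AE x in lebesgue. norm (gK x * \<phi> n x) \<le> \<bar>gK x\<bar>" for n
        using K(4,5) by (intro always_eventually allI) (simp add: abs_mult mult_left_le)
      show "AE x in lebesgue. (\<lambda>n. gK x * \<phi> n x) \<longlonglongrightarrow> gK x * indicator C x"
        by (intro always_eventually allI tendsto_mult tendsto_const K(7))
      show "(\<lambda>x. gK x * indicat_real C x) \<in> borel_measurable lebesgue"
        using Cs by (intro borel_measurable_times borel_measurable_indicator) simp_all
      show "integrable lebesgue (\<lambda>x. \<bar>gK x\<bar>)" using i by (rule integrable_abs)
      show "(\<lambda>x. gK x * \<phi> n x) \<in> borel_measurable lebesgue" for n
        by (intro borel_measurable_times) fact+
    qed
    moreover have "0 \<le> (LINT x|lebesgue. gK x * \<phi> n x)" for n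
    proof -
      have "(LINT x|lebesgue_on \<Omega>. g x * \<phi> n x) = (LINT x|lebesgue. gK x * \<phi> n x)"
        unfolding gK_def by (rule integral_test_function_eq[OF assms(1) K(2,6)])
      then show ?thesis using assms(3)[OF K(3) K(4), of n] by simp
    qed
    ultimately have "0 \<le> (LINT x|lebesgue. gK x * indicator C x)"
      by (intro LIMSEQ_le_const[of _ _ 0]) auto
    also have "(\<lambda>x. gK x * indicator C x) = (\<lambda>x. if x \<in> C then g x else 0)"
    proof -
      \<comment> \<open>K is known only to contain the supports; C lies in it because the
        approximations converge to 1 on C.\<close>
      have "C \<subseteq> K"
      proof
        fix x assume "x \<in> C"
        then have "(\<lambda>n. \<phi> n x) \<longlonglongrightarrow> 1" using K(7)[of x] by simp
        then have "x \<in> K" if "\<And>n. \<phi> n x = 0" using that LIMSEQ_unique[of "\<lambda>n. 0 :: real" 1 0] by simp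
        then show "x \<in> K" using K(6) by blast
      qed
      then show ?thesis
        by (intro ext) (auto simp: gK_def indicator_def)
    qed
    also have "(LINT x|lebesgue. (if x \<in> C then g x else 0)) = (LINT x|lebesgue_on C. g x)"
      by (rule Lebesgue_Measure.integral_restrict_UNIV[OF Cs])
    finally show ?thesis .
  qed
  have null: "C \<in> null_sets lebesgue" if C: "compact C" "C \<subseteq> \<Omega>" "\<And>x. x \<in> C \<Longrightarrow> g x < 0" for C
  proof -
    have Cs: "C \<in> sets lebesgue" using C(1) by (simp add: lmeasurable_compact fmeasurableD)
    have i: "integrable (lebesgue_on C) (\<lambda>x. - g x)"
      using assms(2) C unfolding locally_integrable_def by simp
    have pos: "AE x in lebesgue_on C. 0 \<le> - g x"
      using C(3) by (intro AE_I2) (auto simp: less_imp_le)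
    have "(LINT x|lebesgue_on C. - g x) = 0"
      using nonneg[OF C(1,2)] integral_nonneg_AE[OF pos] by simp
    then have "AE x in lebesgue_on C. - g x = 0"
      using integral_nonneg_eq_0_iff_AE[OF i pos] by simp
    then have "AE x in lebesgue. x \<in> C \<longrightarrow> - g x = 0"
      using Cs by (simp add: AE_restrict_space_iff)
    then have "AE x in lebesgue. x \<notin> C"
    proof eventually_elim
      case (elim x)
      then show ?case using C(3)[of x] by auto
    qed
    then show ?thesis using Cs by (simp add: AE_iff_null_sets)
  qed
  define N where "N = {x \<in> \<Omega>. g x < 0}"
  have gm: "g \<in> borel_measurable (lebesgue_on \<Omega>)"
    by (rule locally_integrable_measurable[OF assms(2,1)])
  have Os: "\<Omega> \<in> sets lebesgue" using assms(1) by simp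
  have "{x \<in> space (lebesgue_on \<Omega>). g x < 0} \<in> sets (lebesgue_on \<Omega>)"
    using gm unfolding borel_measurable_iff_less by blast
  then have Ns: "N \<in> sets lebesgue"
    using Os by (simp add: N_def sets_restrict_space_iff)
  have "emeasure lebesgue N \<le> 0 + ennreal e" if "e > 0" for e :: real
  proof -
    obtain T where T: "closed T" "T \<subseteq> N" "N - T \<in> lmeasurable" "emeasure lebesgue (N - T) < ennreal e"
      using sets_lebesgue_inner_closed[OF Ns \<open>e > 0\<close>] by blast
    \<comment> \<open>Inner regularity yields a closed set only; intersecting it with balls makes
      the pieces compact.\<close>
    have "T \<inter> cball 0 (real n) \<in> null_sets lebesgue" for n
      by (rule null) (use T in \<open>auto simp: N_def closed_Int_compact\<close>)
    then have "(\<Union>n::nat. T \<inter> cball 0 (real n)) \<in> null_sets lebesgue"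
      by (rule null_sets_UN)
    moreover have "(\<Union>n::nat. T \<inter> cball 0 (real n)) = T"
      by (auto simp: real_arch_simple)
    ultimately have "T \<in> null_sets lebesgue" by (simp only:)
    then have "emeasure lebesgue N = emeasure lebesgue (N - T)"
      using Ns by (simp add: emeasure_Diff_null_set)
    then show ?thesis using T(4) by simp
  qed
  then have "emeasure lebesgue N \<le> 0" by (rule ennreal_le_epsilon) auto
  then have "N \<in> null_sets lebesgue" using Ns by (intro null_setsI) simp_all
  then have "AE x in lebesgue. x \<notin> N" by (rule AE_not_in)
  then have "AE x in lebesgue. x \<in> \<Omega> \<longrightarrow> 0 \<le> g x"
    by eventually_elim (auto simp: N_def)
  then show ?thesis
    using Os by (simp add: AE_restrict_space_iff)
qed

lemma locally_integrable_inner: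
  fixes G :: "'a::euclidean_space \<Rightarrow> 'a"
  shows "locally_integrable \<Omega> G \<Longrightarrow> locally_integrable \<Omega> (\<lambda>x. G x \<bullet> b)"
  by (simp add: locally_integrable_def)

lemma locally_integrable_diff:
  fixes f g :: "'a::euclidean_space \<Rightarrow> 'b::euclidean_space"
  shows "locally_integrable \<Omega> f \<Longrightarrow> locally_integrable \<Omega> g \<Longrightarrow> locally_integrable \<Omega> (\<lambda>x. f x - g x)"
  by (simp add: locally_integrable_def)

lemma locally_integrable_uminus:
  fixes f :: "'a::euclidean_space \<Rightarrow> 'b::euclidean_space"
  shows "locally_integrable \<Omega> f \<Longrightarrow> locally_integrable \<Omega> (\<lambda>x. - f x)"
  by (simp add: locally_integrable_def)

lemma locally_integrable_continuous:
  fixes f :: "'a::euclidean_space \<Rightarrow> 'b::euclidean_space"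
  assumes "continuous_on \<Omega> f"
  shows "locally_integrable \<Omega> f"
  unfolding locally_integrable_def
proof safe
  fix K :: "'a set" assume K: "compact K" "K \<subseteq> \<Omega>"
  then have "integrable lborel (\<lambda>x. indicator K x *\<^sub>R f x)"
    using borel_integrable_compact continuous_on_subset[OF assms] by blast
  then have "integrable lebesgue (\<lambda>x. indicator K x *\<^sub>R f x)"
    by (subst integrable_completion) auto
  then show "integrable (lebesgue_on K) f"
    using K by (simp add: integrable_restrict_space lmeasurable_compact fmeasurableD)
qed

text \<open>Each coordinate of G - H integrates to 0 against every test function, so both it and its
  negative are nonnegative almost everywhere.\<close>

lemma has_weak_gradient_unique:
  assumes "open \<Omega>" "has_weak_gradient \<Omega> u G" "has_weak_gradient \<Omega> u H"
  shows "AE x in lebesgue_on \<Omega>. G x = H x"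
proof -
  have "AE x in lebesgue_on \<Omega>. \<forall>b\<in>Basis. G x \<bullet> b = H x \<bullet> b"
  proof (subst AE_finite_all[OF finite_Basis], intro ballI)
    fix b :: 'a assume b: "b \<in> Basis"
    define g where "g x = G x \<bullet> b - H x \<bullet> b" for x
    have l: "locally_integrable \<Omega> (\<lambda>x. G x \<bullet> b)" "locally_integrable \<Omega> (\<lambda>x. H x \<bullet> b)"
      using assms by (auto simp: has_weak_gradient_def intro!: locally_integrable_inner)
    then have "locally_integrable \<Omega> g"
      unfolding g_def by (rule locally_integrable_diff)
    moreover have 0: "(LINT x|lebesgue_on \<Omega>. g x * \<phi> x) = 0" if "\<phi> \<in> test_functions \<Omega>" for \<phi>
    proof -
      have "(LINT x|lebesgue_on \<Omega>. (G x \<bullet> b) * \<phi> x) = (LINT x|lebesgue_on \<Omega>. (H x \<bullet> b) * \<phi> x)"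
      proof -
        have "(LINT x|lebesgue_on \<Omega>. u x * frechet_derivative \<phi> (at x) b)
            = - (LINT x|lebesgue_on \<Omega>. (F x \<bullet> b) * \<phi> x)" if "has_weak_gradient \<Omega> u F" for F
          using that b \<open>\<phi> \<in> test_functions \<Omega>\<close> unfolding has_weak_gradient_def by blast
        from this[OF assms(2)] this[OF assms(3)] show ?thesis by linarith
      qed
      moreover have "(LINT x|lebesgue_on \<Omega>. g x * \<phi> x) =
          (LINT x|lebesgue_on \<Omega>. (G x \<bullet> b) * \<phi> x) - (LINT x|lebesgue_on \<Omega>. (H x \<bullet> b) * \<phi> x)"
        unfolding g_def left_diff_distrib
        by (intro Bochner_Integration.integral_diff integrable_test_function assms(1) l that)
      ultimately show ?thesis by simp
    qed
    ultimately have "AE x in lebesgue_on \<Omega>. 0 \<le> g x"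
      by (intro AE_nonneg_if_test_integrals_nonneg assms(1)) auto
    moreover have "AE x in lebesgue_on \<Omega>. 0 \<le> - g x"
      using 0 locally_integrable_uminus[OF \<open>locally_integrable \<Omega> g\<close>]
      by (intro AE_nonneg_if_test_integrals_nonneg assms(1)) auto
    ultimately show "AE x in lebesgue_on \<Omega>. G x \<bullet> b = H x \<bullet> b"
      by eventually_elim (simp add: g_def)
  qed
  then show ?thesis
    by eventually_elim (auto intro: euclidean_eqI)
qed

lemma has_weak_gradient_weak_gradient:
  "has_weak_gradient \<Omega> u G \<Longrightarrow> has_weak_gradient \<Omega> u (weak_gradient \<Omega> u)"
  unfolding weak_gradient_def by (rule someI[of "has_weak_gradient \<Omega> u"])

lemma weak_gradient_AE_eq:
  assumes "open \<Omega>" "has_weak_gradient \<Omega> u G"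
  shows "AE x in lebesgue_on \<Omega>. weak_gradient \<Omega> u x = G x"
  using has_weak_gradient_unique[OF assms(1) has_weak_gradient_weak_gradient[OF assms(2)] assms(2)] .

section \<open>Integration by parts\<close>

definition gradient :: "('a::euclidean_space \<Rightarrow> real) \<Rightarrow> 'a \<Rightarrow> 'a" where
  "gradient f x = (\<Sum>b\<in>Basis. frechet_derivative f (at x) b *\<^sub>R b)"

lemma gradient_inner:
  "f differentiable (at x) \<Longrightarrow> gradient f x \<bullet> e = frechet_derivative f (at x) e"
  by (simp add: gradient_def inner_sum_left frechet_derivative_eq_sum_Basis[of f x e]
      inner_commute[of e] mult.commute)

lemma C_infinity_differentiable: "C_infinity f UNIV \<Longrightarrow> f differentiable (at x)"
  using C_infinity_has_derivative differentiable_def by blast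

lemma C_infinity_continuous_gradient: "C_infinity f UNIV \<Longrightarrow> continuous_on S (gradient f)"
  unfolding gradient_def[abs_def] by (intro continuous_intros C_infinity_continuous_derivative)

lemma C_infinity_derivative:
  assumes "C_infinity f UNIV"
  shows "C_infinity (\<lambda>x. frechet_derivative f (at x) e) UNIV"
proof -
  have "C_infinity (\<lambda>x. frechet_derivative f (at x) b) UNIV" if "b \<in> Basis" for b
    using assms that unfolding C_infinity_def by (metis C_diff.simps(2))
  then show ?thesis
    unfolding frechet_derivative_eq_sum_Basis[OF C_infinity_differentiable[OF assms], of _ e]
    by (intro C_infinity_sum C_infinity_mult C_infinity_const)
qed

lemma frechet_derivative_eq_0_outside:
  assumes "closed K" "\<And>x. x \<notin> K \<Longrightarrow> f x = (0::real)" "x \<notin> K"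
  shows "frechet_derivative f (at x) = (\<lambda>_. 0)"
proof -
  have "((\<lambda>_. 0::real) has_derivative (\<lambda>_. 0)) (at x)" by simp
  then have "(f has_derivative (\<lambda>_. 0)) (at x)"
    by (rule has_derivative_transform_within_open[where s = "- K"]) (use assms in auto)
  then show ?thesis using frechet_derivative_at by metis
qed

lemma test_function_derivative:
  assumes "\<phi> \<in> test_functions \<Omega>"
  shows "(\<lambda>x. frechet_derivative \<phi> (at x) e) \<in> test_functions \<Omega>"
proof -
  obtain K where K: "C_infinity \<phi> UNIV" "compact K" "K \<subseteq> \<Omega>" "\<And>x. x \<notin> K \<Longrightarrow> \<phi> x = 0"
    using test_functionsE[OF assms] by blast
  show ?thesis
  proof (rule test_functionsI[OF C_infinity_derivative[OF K(1)] K(2,3)])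
    show "frechet_derivative \<phi> (at x) e = 0" if "x \<notin> K" for x
      using frechet_derivative_eq_0_outside[OF compact_imp_closed[OF K(2)], of \<phi> x] K(4) that
      by auto
  qed
qed

lemma test_functions_0: "\<phi> \<in> test_functions \<Omega> \<Longrightarrow> x \<notin> \<Omega> \<Longrightarrow> \<phi> x = 0"
  using closure_subset[of "{x. \<phi> x \<noteq> 0}"] by (auto simp: test_functions_def)

lemma test_function_gradient_0:
  assumes "\<phi> \<in> test_functions \<Omega>" "x \<notin> \<Omega>"
  shows "gradient \<phi> x = 0"
  using test_functions_0[OF test_function_derivative[OF assms(1)] assms(2)]
  by (simp add: gradient_def)

lemma test_function_gradient_bounded:
  assumes "\<phi> \<in> test_functions \<Omega>"
  obtains B where "\<And>x. norm (gradient \<phi> x) \<le> B"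
proof -
  have "\<exists>B. \<forall>x. \<bar>frechet_derivative \<phi> (at x) b\<bar> \<le> B" for b
    using test_function_bounded[OF test_function_derivative[OF assms]] by metis
  then obtain B where B: "\<And>b x. \<bar>frechet_derivative \<phi> (at x) b\<bar> \<le> B b" by metis
  show thesis
  proof (rule that)
    fix x
    have "norm (gradient \<phi> x) \<le> (\<Sum>b\<in>Basis. norm (frechet_derivative \<phi> (at x) b *\<^sub>R b))"
      unfolding gradient_def by (rule norm_sum)
    also have "\<dots> \<le> (\<Sum>b\<in>Basis. B b)"
      by (rule sum_mono) (use B in auto)
    finally show "norm (gradient \<phi> x) \<le> (\<Sum>b\<in>Basis. B b)" .
  qed
qed

text \<open>Supplies the uniform bound on difference quotients that dominated convergence needs
  below.\<close>

lemma test_function_lipschitz: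
  assumes "\<phi> \<in> test_functions \<Omega>"
  obtains L where "\<And>x y. \<bar>\<phi> x - \<phi> y\<bar> \<le> L * norm (x - y)"
proof -
  obtain B where B: "\<And>x. norm (gradient \<phi> x) \<le> B"
    using test_function_gradient_bounded[OF assms] by blast
  have C: "C_infinity \<phi> UNIV" using assms by (simp add: test_functions_def)
  have "norm (\<phi> x - \<phi> y) \<le> B * norm (x - y)" for x y
  proof (rule differentiable_bound[where S = UNIV and f' = "\<lambda>x. frechet_derivative \<phi> (at x)"])
    fix x
    show "onorm (frechet_derivative \<phi> (at x)) \<le> B"
    proof (rule onorm_le)
      fix e
      have "norm (frechet_derivative \<phi> (at x) e) = \<bar>gradient \<phi> x \<bullet> e\<bar>"
        by (simp add: gradient_inner[OF C_infinity_differentiable[OF C]])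
      also have "\<dots> \<le> norm (gradient \<phi> x) * norm e" by (rule Cauchy_Schwarz_ineq2)
      also have "\<dots> \<le> B * norm e" by (intro mult_right_mono B) auto
      finally show "norm (frechet_derivative \<phi> (at x) e) \<le> B * norm e" .
    qed
  qed (use C_infinity_has_derivative[OF C] in auto)
  then show thesis by (intro that) auto
qed

lemma integrable_continuous_compact_support:
  fixes f :: "'a::euclidean_space \<Rightarrow> 'b::euclidean_space"
  assumes "continuous_on UNIV f" "compact K" "\<And>x. x \<notin> K \<Longrightarrow> f x = 0"
  shows "integrable lborel f"
proof -
  have "integrable lborel (\<lambda>x. indicator K x *\<^sub>R f x)"
    using borel_integrable_compact assms continuous_on_subset by blast
  also have "(\<lambda>x. indicator K x *\<^sub>R f x) = f"
    using assms(3) by (intro ext) (auto simp: indicator_def)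
  finally show ?thesis .
qed

lemma test_function_integrable:
  assumes "\<phi> \<in> test_functions \<Omega>"
  shows "integrable lborel \<phi>"
proof -
  obtain K where K: "C_infinity \<phi> UNIV" "compact K" "K \<subseteq> \<Omega>" "\<And>x. x \<notin> K \<Longrightarrow> \<phi> x = 0"
    using test_functionsE[OF assms] by blast
  show ?thesis
    by (rule integrable_continuous_compact_support[OF C_infinity_continuous K(2)]) (use K in auto)
qed

lemma integrable_mult_test_function:
  fixes U :: "'a::euclidean_space \<Rightarrow> real"
  assumes "integrable lborel U" "\<phi> \<in> test_functions \<Omega>"
  shows "integrable lborel (\<lambda>x. U x * \<phi> x)"
proof -
  obtain B where B: "\<And>x. \<bar>\<phi> x\<bar> \<le> B" using test_function_bounded[OF assms(2)] by blast
  show ?thesis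
    by (rule integrable_mult_bounded[OF assms(1) _ B]) (simp add: test_function_measurable[OF assms(2)])
qed

lemma integral_lborel_translate:
  fixes f :: "'a::euclidean_space \<Rightarrow> real"
  assumes "f \<in> borel_measurable borel"
  shows "(LINT x|lborel. f (a + x)) = (LINT x|lborel. f x)"
proof -
  have "(LINT x|lborel. f x) = (LINT x|distr lborel borel ((+) a). f x)"
    by (simp add: lborel_distr_plus)
  also have "\<dots> = (LINT x|lborel. f (a + x))"
    by (rule integral_distr) (use assms in auto)
  finally show ?thesis by simp
qed

lemma integrable_lborel_translate:
  fixes f :: "'a::euclidean_space \<Rightarrow> real"
  assumes "integrable lborel f"
  shows "integrable lborel (\<lambda>x. f (a + x))"
proof -
  have "integrable (distr lborel borel ((+) a)) f"
    using assms by (simp add: lborel_distr_plus)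
  then show ?thesis
    by (subst (asm) integrable_distr_eq) (use borel_measurable_integrable[OF assms] in auto)
qed

text \<open>U is merely integrable; all regularity sits on \<phi>, whose Lipschitz constant L gives
  the integrable majorant L |e| |U|.\<close>

lemma integral_difference_quotient_tendsto:
  fixes U :: "'a::euclidean_space \<Rightarrow> real"
  assumes "integrable lborel U" "\<phi> \<in> test_functions \<Omega>"
  shows "((\<lambda>h. LINT x|lborel. U x * ((\<phi> (x + h *\<^sub>R e) - \<phi> x) / h))
    \<longlongrightarrow> (LINT x|lborel. U x * frechet_derivative \<phi> (at x) e)) (at 0)"
  unfolding tendsto_at_iff_sequentially
proof (intro allI impI)
  fix X :: "nat \<Rightarrow> real" assume X: "\<forall>i. X i \<in> UNIV - {0}" "X \<longlonglongrightarrow> 0"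
  define D where "D x = frechet_derivative \<phi> (at x)" for x
  define d where "d i x = (\<phi> (x + X i *\<^sub>R e) - \<phi> x) / X i" for i x
  obtain L where L: "\<And>x y. \<bar>\<phi> x - \<phi> y\<bar> \<le> L * norm (x - y)"
    using test_function_lipschitz[OF assms(2)] by blast
  have C: "C_infinity \<phi> UNIV" using assms(2) by (simp add: test_functions_def)
  have \<phi>m: "\<phi> \<in> borel_measurable borel" by (rule test_function_measurable[OF assms(2)])
  have Um: "U \<in> borel_measurable lborel" by (rule borel_measurable_integrable[OF assms(1)])
  have "(\<lambda>i. LINT x|lborel. U x * (d i x))
      \<longlonglongrightarrow> (LINT x|lborel. U x * D x e)"
  proof (rule integral_dominated_convergence[where w = "\<lambda>x. (L * norm e) * \<bar>U x\<bar>"])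
    show "AE x in lborel. norm (U x * (d i x)) \<le> (L * norm e) * \<bar>U x\<bar>"
      for i
    proof (intro always_eventually allI)
      fix x
      have "X i \<noteq> 0" using X(1) by auto
      then have "\<bar>d i x\<bar> \<le> L * norm e"
        using L[of "x + X i *\<^sub>R e" x] by (simp add: d_def field_simps)
      then have "\<bar>U x\<bar> * \<bar>d i x\<bar> \<le> \<bar>U x\<bar> * (L * norm e)"
        by (rule mult_left_mono) simp
      then show "norm (U x * (d i x)) \<le> (L * norm e) * \<bar>U x\<bar>"
        by (simp add: abs_mult mult_ac)
    qed
    show "AE x in lborel. (\<lambda>i. U x * (d i x))
        \<longlonglongrightarrow> U x * D x e"
    proof (intro always_eventually allI tendsto_mult tendsto_const)
      fix x
      have "((\<lambda>h::real. x + h *\<^sub>R e) has_derivative (\<lambda>h. h *\<^sub>R e)) (at 0)"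
        by (auto intro!: derivative_eq_intros)
      from has_derivative_compose[OF this, of \<phi> "D x"]
      have "((\<lambda>h. \<phi> (x + h *\<^sub>R e)) has_derivative (\<lambda>h. D x (h *\<^sub>R e))) (at 0)"
        using C_infinity_has_derivative[OF C, of x] by (simp add: D_def)
      moreover have "D x (h *\<^sub>R e) = D x e * h" for h
        using linear_frechet_derivative[OF C_infinity_differentiable[OF C]]
        by (simp add: D_def linear_cmul mult.commute)
      ultimately have "((\<lambda>h. \<phi> (x + h *\<^sub>R e)) has_field_derivative D x e) (at 0)"
        by (simp add: has_field_derivative_def)
      then have "((\<lambda>h. (\<phi> (x + h *\<^sub>R e) - \<phi> x) / h) \<longlongrightarrow> D x e) (at 0)"
        by (simp add: DERIV_def)
      then show "(\<lambda>i. d i x) \<longlonglongrightarrow> D x e"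
        unfolding tendsto_at_iff_sequentially comp_def d_def using X by blast
    qed
    show "integrable lborel (\<lambda>x. (L * norm e) * \<bar>U x\<bar>)"
      using assms(1) by (intro integrable_mult_right integrable_abs)
    show "(\<lambda>x. U x * D x e) \<in> borel_measurable lborel"
      using Um test_function_measurable[OF test_function_derivative[OF assms(2)]]
      by (intro borel_measurable_times) (simp_all add: D_def)
    have "(\<lambda>x. \<phi> (x + X i *\<^sub>R e)) \<in> borel_measurable lborel" for i
      using measurable_compose[of "\<lambda>x. x + X i *\<^sub>R e" borel borel \<phi> borel] \<phi>m by simp
    then show "(\<lambda>x. U x * (d i x)) \<in> borel_measurable lborel" for i
      using Um \<phi>m unfolding d_def
      by (intro borel_measurable_times borel_measurable_divide borel_measurable_diff) simp_all
  qed
  then show "((\<lambda>h. LINT x|lborel. U x * ((\<phi> (x + h *\<^sub>R e) - \<phi> x) / h)) \<circ> X)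
      \<longlonglongrightarrow> (LINT x|lborel. U x * frechet_derivative \<phi> (at x) e)"
    by (simp add: comp_def d_def D_def)
qed

text \<open>Discrete integration by parts: translation invariance of Lebesgue measure moves the
  difference quotient from \<phi> to U and reverses the sign of the step.\<close>

lemma integral_difference_quotient_swap:
  fixes U :: "'a::euclidean_space \<Rightarrow> real"
  assumes "integrable lborel U" "\<phi> \<in> test_functions \<Omega>"
  shows "(LINT x|lborel. U x * ((\<phi> (x + h *\<^sub>R e) - \<phi> x) / h))
    = - (LINT x|lborel. \<phi> x * ((U (x + (- h) *\<^sub>R e) - U x) / (- h)))"
proof -
  have int: "integrable lborel (\<lambda>x. U x * \<phi> x)"
    by (rule integrable_mult_test_function[OF assms])
  have int1: "integrable lborel (\<lambda>x. U (- h *\<^sub>R e + x) * \<phi> x)"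
    by (rule integrable_mult_test_function[OF integrable_lborel_translate[OF assms(1)] assms(2)])
  have m: "(\<lambda>x. U (- h *\<^sub>R e + x) * \<phi> x) \<in> borel_measurable borel"
    using borel_measurable_integrable[OF int1] by simp
  have int2: "integrable lborel (\<lambda>x. U x * \<phi> (h *\<^sub>R e + x))"
    using integrable_lborel_translate[OF int1, of "h *\<^sub>R e"] by (simp add: algebra_simps)
  have eq: "(LINT x|lborel. U x * \<phi> (h *\<^sub>R e + x)) = (LINT x|lborel. U (- h *\<^sub>R e + x) * \<phi> x)"
    using integral_lborel_translate[OF m, of "h *\<^sub>R e"] by (simp add: algebra_simps)
  have "(LINT x|lborel. U x * ((\<phi> (x + h *\<^sub>R e) - \<phi> x) / h))
      = (LINT x|lborel. (U x * \<phi> (h *\<^sub>R e + x) - U x * \<phi> x) / h)"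
    by (rule Bochner_Integration.integral_cong) (simp_all add: right_diff_distrib add.commute)
  also have "\<dots> = ((LINT x|lborel. U (- h *\<^sub>R e + x) * \<phi> x) - (LINT x|lborel. U x * \<phi> x)) / h"
    using int int2 by (simp add: eq)
  also have "\<dots> = (LINT x|lborel. (U (- h *\<^sub>R e + x) * \<phi> x - U x * \<phi> x) / h)"
    using int int1 by simp
  also have "\<dots> = (LINT x|lborel. - (\<phi> x * ((U (x + (- h) *\<^sub>R e) - U x) / (- h))))"
    by (rule Bochner_Integration.integral_cong) (simp_all add: algebra_simps diff_divide_distrib)
  finally show ?thesis by simp
qed

text \<open>Both sides of \<open>integral_difference_quotient_swap\<close> are limits of difference
  quotients, one with step h and the other with step -h.\<close>

lemma integral_by_parts_test_functions:
  fixes \<phi> \<psi> :: "'a::euclidean_space \<Rightarrow> real"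
  assumes "\<phi> \<in> test_functions \<Omega>" "\<psi> \<in> test_functions \<Omega>'"
  shows "(LINT x|lborel. \<phi> x * frechet_derivative \<psi> (at x) e)
    = - (LINT x|lborel. \<psi> x * frechet_derivative \<phi> (at x) e)"
proof (rule LIM_unique)
  note i = assms[THEN test_function_integrable]
  show "((\<lambda>h. LINT x|lborel. \<phi> x * ((\<psi> (x + h *\<^sub>R e) - \<psi> x) / h))
      \<longlongrightarrow> (LINT x|lborel. \<phi> x * frechet_derivative \<psi> (at x) e)) (at 0)"
    by (rule integral_difference_quotient_tendsto[OF i(1) assms(2)])
  have "filterlim (\<lambda>h::real. - h) (at 0) (at 0)"
    by (intro filterlim_atI) (auto intro!: tendsto_eq_intros simp: eventually_at_filter)
  from filterlim_compose[OF integral_difference_quotient_tendsto[OF i(2) assms(1)] this, of e]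
  show "((\<lambda>h. LINT x|lborel. \<phi> x * ((\<psi> (x + h *\<^sub>R e) - \<psi> x) / h))
      \<longlongrightarrow> - (LINT x|lborel. \<psi> x * frechet_derivative \<phi> (at x) e)) (at 0)"
    unfolding integral_difference_quotient_swap[OF i(1) assms(2)] by (rule tendsto_minus)
qed

lemma integral_lebesgue_on_eq_lborel:
  fixes f :: "'a::euclidean_space \<Rightarrow> real"
  assumes "open \<Omega>" "f \<in> borel_measurable borel" "\<And>x. x \<notin> \<Omega> \<Longrightarrow> f x = 0"
  shows "(LINT x|lebesgue_on \<Omega>. f x) = (LINT x|lborel. f x)"
proof -
  have "(\<lambda>x. if x \<in> \<Omega> then f x else 0) = f" using assms(3) by auto
  then have "(LINT x|lebesgue_on \<Omega>. f x) = (LINT x|lebesgue. f x)"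
    using Lebesgue_Measure.integral_restrict_UNIV[of \<Omega> f] assms(1) by simp
  also have "\<dots> = (LINT x|lborel. f x)"
    by (rule integral_completion) (use assms(2) in simp)
  finally show ?thesis .
qed

lemma integrable_lebesgue_on_eq_lborel:
  fixes f :: "'a::euclidean_space \<Rightarrow> real"
  assumes "open \<Omega>" "f \<in> borel_measurable borel" "\<And>x. x \<notin> \<Omega> \<Longrightarrow> f x = 0"
  shows "integrable (lebesgue_on \<Omega>) f \<longleftrightarrow> integrable lborel f"
proof -
  have "(\<lambda>x. if x \<in> \<Omega> then f x else 0) = f" using assms(3) by auto
  then have "integrable (lebesgue_on \<Omega>) f \<longleftrightarrow> integrable lebesgue f"
    using Lebesgue_Measure.integrable_restrict_UNIV[of \<Omega> f] assms(1) by simp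
  also have "\<dots> \<longleftrightarrow> integrable lborel f"
    by (rule integrable_completion) (use assms(2) in simp)
  finally show ?thesis .
qed

lemma has_weak_gradient_test_function:
  assumes "open \<Omega>" "\<phi> \<in> test_functions \<Omega>"
  shows "has_weak_gradient \<Omega> \<phi> (gradient \<phi>)"
  unfolding has_weak_gradient_def
proof (intro conjI ballI)
  have C: "C_infinity \<phi> UNIV" using assms(2) by (simp add: test_functions_def)
  show "locally_integrable \<Omega> \<phi>"
    by (intro locally_integrable_continuous C_infinity_continuous C)
  show "locally_integrable \<Omega> (gradient \<phi>)"
    by (intro locally_integrable_continuous C_infinity_continuous_gradient C)
  fix \<psi> and b :: 'a assume \<psi>: "\<psi> \<in> test_functions \<Omega>"
  have "(LINT x|lebesgue_on \<Omega>. \<phi> x * frechet_derivative \<psi> (at x) b)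
      = (LINT x|lborel. \<phi> x * frechet_derivative \<psi> (at x) b)"
    by (intro integral_lebesgue_on_eq_lborel assms(1) borel_measurable_times
        test_function_measurable[OF assms(2)]
        test_function_measurable[OF test_function_derivative[OF \<psi>]])
      (simp add: test_functions_0[OF assms(2)])
  also have "\<dots> = - (LINT x|lborel. \<psi> x * frechet_derivative \<phi> (at x) b)"
    by (rule integral_by_parts_test_functions[OF assms(2) \<psi>])
  also have "(LINT x|lborel. \<psi> x * frechet_derivative \<phi> (at x) b)
      = (LINT x|lebesgue_on \<Omega>. \<psi> x * frechet_derivative \<phi> (at x) b)"
    by (intro integral_lebesgue_on_eq_lborel[symmetric] assms(1) borel_measurable_times
        test_function_measurable[OF \<psi>]
        test_function_measurable[OF test_function_derivative[OF assms(2)]])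
      (simp add: test_functions_0[OF \<psi>])
  finally show "(LINT x|lebesgue_on \<Omega>. \<phi> x * frechet_derivative \<psi> (at x) b)
      = - (LINT x|lebesgue_on \<Omega>. (gradient \<phi> x \<bullet> b) * \<psi> x)"
    by (simp add: gradient_inner[OF C_infinity_differentiable[OF C]] mult.commute)
qed

text \<open>The definition tests basis directions only; linearity in e gives the arbitrary
  directions needed for bounds on the norm of G.\<close>

lemma has_weak_gradient_direction:
  assumes "open \<Omega>" "has_weak_gradient \<Omega> u G" "\<phi> \<in> test_functions \<Omega>"
  shows "(LINT x|lebesgue_on \<Omega>. u x * frechet_derivative \<phi> (at x) e)
    = - (LINT x|lebesgue_on \<Omega>. (G x \<bullet> e) * \<phi> x)"
proof -
  have C: "C_infinity \<phi> UNIV" using assms(3) by (simp add: test_functions_def)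
  have loc: "locally_integrable \<Omega> u" "locally_integrable \<Omega> G"
    using assms(2) by (auto simp: has_weak_gradient_def)
  have "(LINT x|lebesgue_on \<Omega>. u x * frechet_derivative \<phi> (at x) e)
      = (LINT x|lebesgue_on \<Omega>. (\<Sum>b\<in>Basis. (e \<bullet> b) * (u x * frechet_derivative \<phi> (at x) b)))"
    by (rule Bochner_Integration.integral_cong)
      (simp_all add: frechet_derivative_eq_sum_Basis[OF C_infinity_differentiable[OF C], of _ e]
        sum_distrib_left mult_ac)
  also have "\<dots> = (\<Sum>b\<in>Basis. (e \<bullet> b) * (LINT x|lebesgue_on \<Omega>. u x * frechet_derivative \<phi> (at x) b))"
    using integrable_test_function[OF assms(1) loc(1) test_function_derivative[OF assms(3)]]
    by (simp add: Bochner_Integration.integral_sum)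
  also have "\<dots> = (\<Sum>b\<in>Basis. (e \<bullet> b) * - (LINT x|lebesgue_on \<Omega>. (G x \<bullet> b) * \<phi> x))"
    using assms(2,3) by (intro sum.cong) (auto simp: has_weak_gradient_def)
  also have "\<dots> = - (\<Sum>b\<in>Basis. (e \<bullet> b) * (LINT x|lebesgue_on \<Omega>. (G x \<bullet> b) * \<phi> x))"
    by (simp add: sum_negf)
  also have "(\<Sum>b\<in>Basis. (e \<bullet> b) * (LINT x|lebesgue_on \<Omega>. (G x \<bullet> b) * \<phi> x))
      = (LINT x|lebesgue_on \<Omega>. (\<Sum>b\<in>Basis. (e \<bullet> b) * ((G x \<bullet> b) * \<phi> x)))"
    using integrable_test_function[OF assms(1) locally_integrable_inner[OF loc(2)] assms(3)]
    by (simp add: Bochner_Integration.integral_sum)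
  also have "\<dots> = (LINT x|lebesgue_on \<Omega>. (G x \<bullet> e) * \<phi> x)"
  proof (rule Bochner_Integration.integral_cong)
    fix x
    show "(\<Sum>b\<in>Basis. (e \<bullet> b) * ((G x \<bullet> b) * \<phi> x)) = (G x \<bullet> e) * \<phi> x"
      using euclidean_inner[of "G x" e] by (simp add: sum_distrib_left mult_ac)
  qed simp
  finally show ?thesis .
qed

section \<open>Weak gradients and Lipschitz bounds\<close>

text \<open>The inequality survives closure and may then be tested with e = v. A dense set of
  directions matters because only countably many exceptional null sets can be combined.\<close>

lemma norm_le_if_inner_dense_le:
  fixes v :: "'a::euclidean_space"
  assumes "UNIV \<subseteq> closure D" "\<And>e. e \<in> D \<Longrightarrow> v \<bullet> e \<le> T * norm e" "T \<ge> 0"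
  shows "norm v \<le> T"
proof (cases "v = 0")
  case False
  have c: "closed {e. v \<bullet> e \<le> T * norm e}"
    by (rule closed_Collect_le) (intro continuous_intros)+
  have "D \<subseteq> {e. v \<bullet> e \<le> T * norm e}" using assms(2) by blast
  from closure_minimal[OF this c] have "v \<in> {e. v \<bullet> e \<le> T * norm e}"
    using assms(1) by blast
  then have "norm v * norm v \<le> T * norm v"
    by (simp add: dot_square_norm power2_eq_square)
  then show ?thesis using False by simp
qed (use assms(3) in simp)

text \<open>Moving the difference quotient from \<phi> to U bounds it by T |e|, so T |e| - G . e has
  nonnegative integral against nonnegative test functions. The one-sided fundamental lemma makes
  this pointwise for each e, and a countable dense set of directions gives the norm.\<close>

lemma weak_gradient_le_lipschitz:
  fixes U :: "'a::euclidean_space \<Rightarrow> real"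
  assumes "open \<Omega>" "has_weak_gradient \<Omega> u G" "\<And>x. x \<in> \<Omega> \<Longrightarrow> U x = u x"
    and "integrable lborel U" "T \<ge> 0" "\<And>x y. \<bar>U x - U y\<bar> \<le> T * norm (x - y)"
  shows "AE x in lebesgue_on \<Omega>. norm (G x) \<le> T"
proof -
  have loc: "locally_integrable \<Omega> G" using assms(2) by (auto simp: has_weak_gradient_def)
  have *: "AE x in lebesgue_on \<Omega>. G x \<bullet> e \<le> T * norm e" for e
  proof -
    define g where "g x = T * norm e - G x \<bullet> e" for x
    have g: "locally_integrable \<Omega> g"
      unfolding g_def
      by (intro locally_integrable_diff locally_integrable_inner loc locally_integrable_continuous
          continuous_intros)
    have "0 \<le> (LINT x|lebesgue_on \<Omega>. g x * \<phi> x)"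
      if \<phi>: "\<phi> \<in> test_functions \<Omega>" and pos: "\<And>x. 0 \<le> \<phi> x" for \<phi>
    proof -
      have i: "integrable (lebesgue_on \<Omega>) (\<lambda>x. (G x \<bullet> e) * \<phi> x)"
        by (rule integrable_test_function[OF assms(1) locally_integrable_inner[OF loc] \<phi>])
      have ib: "integrable lborel \<phi>" by (rule test_function_integrable[OF \<phi>])
      have mb: "\<phi> \<in> borel_measurable borel" by (rule test_function_measurable[OF \<phi>])
      have io: "integrable (lebesgue_on \<Omega>) \<phi>"
        using integrable_lebesgue_on_eq_lborel[OF assms(1) mb] test_functions_0[OF \<phi>] ib by blast
      have "(LINT x|lebesgue_on \<Omega>. g x * \<phi> x)
          = T * norm e * (LINT x|lebesgue_on \<Omega>. \<phi> x) - (LINT x|lebesgue_on \<Omega>. (G x \<bullet> e) * \<phi> x)"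
        using i io by (simp add: g_def left_diff_distrib)
      also have "(LINT x|lebesgue_on \<Omega>. \<phi> x) = (LINT x|lborel. \<phi> x)"
        by (rule integral_lebesgue_on_eq_lborel[OF assms(1) mb test_functions_0[OF \<phi>]])
      also have "(LINT x|lebesgue_on \<Omega>. (G x \<bullet> e) * \<phi> x)
          = - (LINT x|lebesgue_on \<Omega>. u x * frechet_derivative \<phi> (at x) e)"
        by (simp add: has_weak_gradient_direction[OF assms(1,2) \<phi>])
      also have "(LINT x|lebesgue_on \<Omega>. u x * frechet_derivative \<phi> (at x) e)
          = (LINT x|lebesgue_on \<Omega>. U x * frechet_derivative \<phi> (at x) e)"
        by (rule Bochner_Integration.integral_cong) (use assms(3) in auto)
      also have "\<dots> = (LINT x|lborel. U x * frechet_derivative \<phi> (at x) e)"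
        using borel_measurable_integrable[OF assms(4)]
          test_function_measurable[OF test_function_derivative[OF \<phi>]]
        by (intro integral_lebesgue_on_eq_lborel assms(1) borel_measurable_times)
          (auto simp: test_functions_0[OF test_function_derivative[OF \<phi>]])
      finally have eq: "(LINT x|lebesgue_on \<Omega>. g x * \<phi> x)
          = T * norm e * (LINT x|lborel. \<phi> x) + (LINT x|lborel. U x * frechet_derivative \<phi> (at x) e)"
        by simp
      have "- (T * norm e * (LINT x|lborel. \<phi> x)) \<le> (LINT x|lborel. U x * frechet_derivative \<phi> (at x) e)"
      proof (rule tendsto_lowerbound[OF integral_difference_quotient_tendsto[OF assms(4) \<phi>]])
        have "- (T * norm e * (LINT x|lborel. \<phi> x))
            \<le> (LINT x|lborel. U x * ((\<phi> (x + h *\<^sub>R e) - \<phi> x) / h))" if "h \<noteq> 0" for h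
        proof -
          have "(LINT x|lborel. \<phi> x * ((U (x + (- h) *\<^sub>R e) - U x) / (- h)))
              \<le> (LINT x|lborel. \<phi> x * (T * norm e))"
          proof (rule integral_mono')
            show "integrable lborel (\<lambda>x. \<phi> x * (T * norm e))" using ib by simp
            fix x
            have "(U (x + (- h) *\<^sub>R e) - U x) / (- h) \<le> \<bar>(U (x + (- h) *\<^sub>R e) - U x) / (- h)\<bar>"
              by (rule abs_ge_self)
            also have "\<dots> \<le> T * norm e"
              using assms(6)[of "x + (- h) *\<^sub>R e" x] that by (simp add: field_simps)
            finally show "\<phi> x * ((U (x + (- h) *\<^sub>R e) - U x) / (- h)) \<le> \<phi> x * (T * norm e)"
              by (rule mult_left_mono) (rule pos)
            show "0 \<le> \<phi> x * (T * norm e)" using pos assms(5) by simp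
          qed
          then show ?thesis
            unfolding integral_difference_quotient_swap[OF assms(4) \<phi>] by (simp add: mult.commute)
        qed
        then show "\<forall>\<^sub>F h in at 0. - (T * norm e * (LINT x|lborel. \<phi> x))
            \<le> (LINT x|lborel. U x * ((\<phi> (x + h *\<^sub>R e) - \<phi> x) / h))"
          by (simp add: eventually_at_filter)
      qed simp
      then show ?thesis unfolding eq by simp
    qed
    from AE_nonneg_if_test_integrals_nonneg[OF assms(1) g this]
    show ?thesis by (simp add: g_def)
  qed
  obtain D :: "'a set" where D: "countable D" "UNIV \<subseteq> closure D"
    by (rule separable[of "UNIV :: 'a set"])
  have "AE x in lebesgue_on \<Omega>. \<forall>e\<in>D. G x \<bullet> e \<le> T * norm e"
    by (rule AE_ball_countable'[OF * D(1)])
  then show ?thesis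
  proof eventually_elim
    case (elim x)
    then show ?case by (intro norm_le_if_inner_dense_le[OF D(2) _ assms(5)]) simp
  qed
qed

section \<open>Gradient bounds along segments and up to the boundary\<close>

lemma integral_bump:
  fixes c :: "'a::euclidean_space"
  shows "(LINT y|lborel. bump c r y) = (LINT y|lborel. bump (0::'a) r y)"
proof -
  have "bump c r (c + y) = bump 0 r y" for y by (simp add: bump_def)
  then show ?thesis
    using integral_lborel_translate[OF C_infinity_measurable[OF C_infinity_bump], of c r c]
    by (simp only:)
qed

lemma integral_bump_pos:
  assumes "r > 0"
  shows "0 < (LINT y|lborel. bump (0::'a::euclidean_space) r y)"
proof -
  have i: "integrable lborel (bump (0::'a) r)"
    using test_function_integrable[OF bump_test_function[OF assms order_refl]] .
  have "(LINT y|lborel. bump (0::'a) r y) \<noteq> 0"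
  proof
    assume "(LINT y|lborel. bump (0::'a) r y) = 0"
    then have "AE y in lborel. bump (0::'a) r y = 0"
      using integral_nonneg_eq_0_iff_AE[OF i] bump_nonneg by blast
    then have "AE y in lebesgue. bump (0::'a) r y = 0" by (rule AE_completion)
    then have "AE y in lebesgue. y \<notin> ball (0::'a) r"
    proof eventually_elim
      case (elim y)
      then show ?case using bump_pos_iff[OF assms, of 0 y] by auto
    qed
    then have "ball (0::'a) r \<in> null_sets lebesgue" by (subst (asm) AE_iff_null_sets[symmetric]) auto
    then show False
      using open_not_negligible[of "ball (0::'a) r"] assms by (simp add: negligible_iff_null_sets)
  qed
  moreover have "0 \<le> (LINT y|lborel. bump (0::'a) r y)"
    by (intro integral_nonneg_AE always_eventually allI bump_nonneg)
  ultimately show ?thesis by simp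
qed

text \<open>A mean value inequality for a weak gradient: average U with a bump whose centre moves
  along the segment. The average g is differentiable, its derivative tests the weak gradient against
  a bump supported in \<Omega>, and at both endpoints it is close to U times the mass I of the
  bump.\<close>

lemma weak_gradient_bound_segment:
  fixes U :: "'a::euclidean_space \<Rightarrow> real"
  assumes "open \<Omega>" "has_weak_gradient \<Omega> u G" "\<And>x. x \<in> \<Omega> \<Longrightarrow> U x = u x"
    and "integrable lborel U" "continuous_on UNIV U"
    and "M \<ge> 0" "AE x in lebesgue_on \<Omega>. norm (G x) \<le> M"
    and "closed_segment x z \<subseteq> \<Omega>"
  shows "\<bar>U z - U x\<bar> \<le> M * norm (z - x)"
proof (rule field_le_epsilon)
  fix \<alpha> :: real assume "\<alpha> > 0"
  define e where "e = z - x"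
  have loc: "locally_integrable \<Omega> G" using assms(2) by (auto simp: has_weak_gradient_def)
  obtain r0 where r0: "r0 > 0" "{y. infdist y (closed_segment x z) \<le> r0} \<subseteq> \<Omega>"
    using compact_in_open_separated[of "closed_segment x z" \<Omega>] assms(1,8) by auto
  have "\<exists>d>0. \<forall>y. dist y w < d \<longrightarrow> dist (U y) (U w) < \<alpha> / 2" for w
    using assms(5) \<open>\<alpha> > 0\<close> half_gt_zero[OF \<open>\<alpha> > 0\<close>] unfolding continuous_on_iff by blast
  then obtain d where d: "\<And>w. d w > 0" "\<And>w y. dist y w < d w \<Longrightarrow> dist (U y) (U w) < \<alpha> / 2"
    by metis
  \<comment> \<open>\<open>r0\<close> keeps every bump along the segment inside \<Omega>;
    \<open>d x\<close> and \<open>d z\<close> make U vary by less than \<alpha>/2 on the bumps at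
    the endpoints.\<close>
  define r where "r = Min {r0, d x, d z}"
  have r: "r > 0" "r \<le> r0" "r \<le> d x" "r \<le> d z"
    using r0 d by (auto simp: r_def)
  define I where "I = (LINT y|lborel. bump (0::'a) r y)"
  have I: "I > 0" unfolding I_def by (rule integral_bump_pos[OF r(1)])
  define g where "g t = (LINT y|lborel. U y * bump (x + t *\<^sub>R e) r y)" for t
  have test: "bump c r \<in> test_functions UNIV" for c :: 'a
    by (rule bump_test_function[OF r(1)]) simp
  have near: "\<bar>(LINT y|lborel. U y * bump c r y) - U c * I\<bar> \<le> \<alpha> / 2 * I" if "r \<le> d c" for c
  proof -
    have "(LINT y|lborel. U y * bump c r y) - U c * I
        = (LINT y|lborel. (U y - U c) * bump c r y)"
      using integrable_mult_test_function[OF assms(4) test] test_function_integrable[OF test]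
      by (simp add: left_diff_distrib I_def integral_bump[of c])
    also have "\<bar>\<dots>\<bar> \<le> (LINT y|lborel. \<alpha> / 2 * bump c r y)"
    proof (rule integral_abs_bound_integral)
      show "integrable lborel (\<lambda>y. (U y - U c) * bump c r y)"
        using integrable_mult_test_function[OF assms(4) test] test_function_integrable[OF test]
        by (simp add: left_diff_distrib)
      fix y
      show "\<bar>(U y - U c) * bump c r y\<bar> \<le> \<alpha> / 2 * bump c r y"
      proof (cases "y \<in> ball c r")
        case True
        then have "\<bar>U y - U c\<bar> \<le> \<alpha> / 2"
          using d(2)[of y c] that by (auto simp: dist_commute dist_real_def abs_minus_commute)
        then have "\<bar>U y - U c\<bar> * bump c r y \<le> \<alpha> / 2 * bump c r y"
          by (rule mult_right_mono) (rule bump_nonneg)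
        then show ?thesis using bump_nonneg[of c r y] by (simp only: abs_mult abs_of_nonneg)
      qed (simp add: bump_eq_0[OF r(1)])
    qed (simp add: test_function_integrable[OF test])
    finally show ?thesis by (simp add: I_def integral_bump[of c])
  qed
  have "norm (g 1 - g 0) \<le> M * norm e * I * norm (1 - 0 :: real)"
  proof (rule field_differentiable_bound[where S = "{0..1}"])
    fix t :: real assume t: "t \<in> {0..1}"
    define c where "c = x + t *\<^sub>R e"
    \<comment> \<open>Shifting the centre by e shifts the argument by -e, which explains the
      sign.\<close>
    define D where "D y = frechet_derivative (bump c r) (at y) (- e)" for y
    have c: "c \<in> closed_segment x z"
      using t by (auto simp: c_def e_def in_segment algebra_simps intro!: exI[of _ t])
    have "cball c r \<subseteq> \<Omega>"
    proof
      fix y assume "y \<in> cball c r"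
      then have "infdist y (closed_segment x z) \<le> r0"
        using infdist_le[OF c, of y] r(2) by (auto simp: dist_commute)
      then show "y \<in> \<Omega>" using r0(2) by auto
    qed
    then have tc: "bump c r \<in> test_functions \<Omega>" by (rule bump_test_function[OF r(1)])
    show "(g has_field_derivative (LINT y|lborel. U y * D y))
        (at t within {0..1})"
    proof (rule has_field_derivative_at_within)
      have quot: "(g (t + h) - g t) / h
          = (LINT y|lborel. U y * ((bump c r (y + h *\<^sub>R (- e)) - bump c r y) / h))" for h
      proof -
        have shift: "bump (c + h *\<^sub>R e) r y = bump c r (y + h *\<^sub>R (- e))" for y
          by (simp add: bump_def algebra_simps)
        then have "g (t + h) = (LINT y|lborel. U y * bump c r (y + h *\<^sub>R (- e)))"
          unfolding g_def shift[symmetric] by (simp add: c_def scaleR_left_distrib add.assoc)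
        moreover have "integrable lborel (\<lambda>y. U y * bump c r (y + h *\<^sub>R (- e)))"
          using integrable_mult_test_function[OF assms(4) test, of "c + h *\<^sub>R e"]
          unfolding shift .
        ultimately show ?thesis
          using integrable_mult_test_function[OF assms(4) test, of c]
          by (simp add: g_def c_def[symmetric] right_diff_distrib diff_divide_distrib)
      qed
      show "(g has_field_derivative
          (LINT y|lborel. U y * D y)) (at t)"
        unfolding DERIV_def quot D_def by (rule integral_difference_quotient_tendsto[OF assms(4) test])
    qed
    have mb: "bump c r \<in> borel_measurable borel" by (rule C_infinity_measurable[OF C_infinity_bump])
    have ib: "integrable (lebesgue_on \<Omega>) (bump c r)"
      using integrable_lebesgue_on_eq_lborel[OF assms(1) mb] test_functions_0[OF tc]
        test_function_integrable[OF tc] by blast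
    have "(LINT y|lborel. U y * D y)
        = (LINT y|lebesgue_on \<Omega>. U y * D y)"
      using borel_measurable_integrable[OF assms(4)]
        test_function_measurable[OF test_function_derivative[OF tc]]
      unfolding D_def
      by (intro integral_lebesgue_on_eq_lborel[symmetric] assms(1) borel_measurable_times)
        (auto simp: test_functions_0[OF test_function_derivative[OF tc]])
    also have "\<dots> = (LINT y|lebesgue_on \<Omega>. u y * D y)"
      by (rule Bochner_Integration.integral_cong) (use assms(3) in auto)
    also have "\<dots> = - (LINT y|lebesgue_on \<Omega>. (G y \<bullet> (- e)) * bump c r y)"
      unfolding D_def by (rule has_weak_gradient_direction[OF assms(1,2) tc])
    also have "\<bar>\<dots>\<bar> \<le> (LINT y|lebesgue_on \<Omega>. \<bar>(G y \<bullet> (- e)) * bump c r y\<bar>)"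
      using integral_abs_bound by simp
    also have "\<dots> \<le> (LINT y|lebesgue_on \<Omega>. M * norm e * bump c r y)"
    proof (rule integral_mono_AE)
      show "AE y in lebesgue_on \<Omega>. \<bar>(G y \<bullet> (- e)) * bump c r y\<bar> \<le> M * norm e * bump c r y"
        using assms(7)
      proof eventually_elim
        case (elim y)
        have "\<bar>G y \<bullet> (- e)\<bar> \<le> norm (G y) * norm (- e)" by (rule Cauchy_Schwarz_ineq2)
        also have "\<dots> \<le> M * norm e" using elim by (simp add: mult_right_mono)
        finally have "\<bar>G y \<bullet> (- e)\<bar> * bump c r y \<le> M * norm e * bump c r y"
          by (rule mult_right_mono) (rule bump_nonneg)
        then show ?case using bump_nonneg[of c r y] by (simp only: abs_mult abs_of_nonneg)
      qed
      show "integrable (lebesgue_on \<Omega>) (\<lambda>y. \<bar>(G y \<bullet> (- e)) * bump c r y\<bar>)"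
        by (intro integrable_abs integrable_test_function assms(1) locally_integrable_inner loc tc)
    qed (use ib in simp)
    also have "\<dots> = M * norm e * (LINT y|lebesgue_on \<Omega>. bump c r y)" by simp
    also have "(LINT y|lebesgue_on \<Omega>. bump c r y) = (LINT y|lborel. bump c r y)"
      by (rule integral_lebesgue_on_eq_lborel[OF assms(1) mb test_functions_0[OF tc]])
    also have "\<dots> = I" by (simp add: I_def integral_bump[of c])
    finally show "norm (LINT y|lborel. U y * D y) \<le> M * norm e * I"
      by simp
  qed auto
  then have "\<bar>g 1 - g 0\<bar> \<le> M * norm e * I" by simp
  moreover have "\<bar>g 1 - U z * I\<bar> \<le> \<alpha> / 2 * I"
    using near[OF r(4)] by (simp add: g_def e_def)
  moreover have "\<bar>g 0 - U x * I\<bar> \<le> \<alpha> / 2 * I"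
    using near[OF r(3)] by (simp add: g_def)
  ultimately have "\<bar>U z * I - U x * I\<bar> \<le> M * norm e * I + \<alpha> * I" by argo
  then have "\<bar>U z - U x\<bar> * I \<le> (M * norm e + \<alpha>) * I"
    using I by (simp add: abs_mult left_diff_distrib[symmetric] distrib_right)
  then show "\<bar>U z - U x\<bar> \<le> M * norm (z - x) + \<alpha>"
    using I by (simp add: e_def)
qed

text \<open>A segment from x to a point outside S crosses the frontier no farther away than that
  point.\<close>

lemma ball_infdist_frontier_subset:
  fixes S :: "'a::euclidean_space set"
  assumes "x \<in> S"
  shows "ball x (infdist x (frontier S)) \<subseteq> S"
proof
  fix w assume w: "w \<in> ball x (infdist x (frontier S))"
  show "w \<in> S"
  proof (rule ccontr)
    assume "w \<notin> S"
    then obtain y where y: "y \<in> closed_segment x w" "y \<in> frontier S"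
      using connected_Int_frontier[OF connected_segment(1)[of x w], of S] assms by auto
    have "dist x y \<le> dist x w" using dist_in_closed_segment[OF y(1)] by (simp add: dist_commute)
    then show False using w infdist_le[OF y(2), of x] by simp
  qed
qed

lemma C0_extension:
  fixes u :: "'a::euclidean_space \<Rightarrow> real"
  assumes "open \<Omega>" "bounded \<Omega>" "u \<in> C0 \<Omega>"
  shows "continuous_on UNIV (\<lambda>x. if x \<in> \<Omega> then u x else 0)"
    and "integrable lborel (\<lambda>x. if x \<in> \<Omega> then u x else 0)"
proof -
  have "continuous_on (closure \<Omega> \<union> - \<Omega>) (\<lambda>x. if x \<in> \<Omega> then u x else 0)"
  proof (rule continuous_on_cases)
    show "continuous_on (closure \<Omega>) u" using assms(3) by (simp add: C0_def)
    show "\<forall>x. x \<in> closure \<Omega> \<and> x \<notin> \<Omega> \<or> x \<in> - \<Omega> \<and> x \<in> \<Omega> \<longrightarrow> u x = 0"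
      using assms(1,3) by (auto simp: C0_def frontier_def interior_open)
  qed (use assms(1) in auto)
  moreover have "closure \<Omega> \<union> - \<Omega> = UNIV" using closure_subset[of \<Omega>] by auto
  ultimately show c: "continuous_on UNIV (\<lambda>x. if x \<in> \<Omega> then u x else 0)" by simp
  show "integrable lborel (\<lambda>x. if x \<in> \<Omega> then u x else 0)"
    by (rule integrable_continuous_compact_support[OF c, of "closure \<Omega>"])
      (use assms(2) closure_subset[of \<Omega>] in auto)
qed

lemma frontier_nonempty_bounded:
  fixes \<Omega> :: "'a::euclidean_space set"
  assumes "bounded \<Omega>" "\<Omega> \<noteq> {}"
  shows "frontier \<Omega> \<noteq> {}"
  using assms by (metis frontier_eq_empty not_bounded_UNIV)

text \<open>The segment from x to a nearest boundary point y lies in \<Omega> except for y itself,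
  so the segment bound is used up to parameter s < 1 and s tends to 1 by continuity of the zero
  extension.\<close>

lemma C0_le_weak_gradient_boundary_dist:
  fixes u :: "'a::euclidean_space \<Rightarrow> real"
  assumes "open \<Omega>" "bounded \<Omega>" "u \<in> C0 \<Omega>" "has_weak_gradient \<Omega> u G"
    and "M \<ge> 0" "AE x in lebesgue_on \<Omega>. norm (G x) \<le> M" "x \<in> \<Omega>"
  shows "\<bar>u x\<bar> \<le> M * boundary_dist \<Omega> x"
proof -
  define U where "U x = (if x \<in> \<Omega> then u x else 0)" for x
  have U: "continuous_on UNIV U" "integrable lborel U"
    unfolding U_def[abs_def] by (rule C0_extension[OF assms(1-3)])+
  define d where "d = infdist x (frontier \<Omega>)"
  have ne: "frontier \<Omega> \<noteq> {}" using frontier_nonempty_bounded assms(2,7) by blast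
  obtain y where y: "y \<in> frontier \<Omega>" "d = dist x y"
    using infdist_attains_inf[OF frontier_closed ne, of x] by (auto simp: d_def)
  have yO: "y \<notin> \<Omega>" using y(1) assms(1) by (simp add: frontier_def interior_open)
  have d: "d > 0" using y yO assms(7) by auto
  have *: "\<bar>U (x + s *\<^sub>R (y - x)) - U x\<bar> \<le> M * d" if s: "0 \<le> s" "s < 1" for s
  proof -
    have nrm: "norm (s *\<^sub>R (y - x)) = s * d"
      using s y(2) by (simp add: dist_norm norm_minus_commute)
    then have sd: "norm (s *\<^sub>R (y - x)) < d" unfolding nrm using s d by simp
    have "closed_segment x (x + s *\<^sub>R (y - x)) \<subseteq> ball x d"
      by (rule closed_segment_subset) (use d sd in \<open>auto simp: dist_norm\<close>)
    then have "closed_segment x (x + s *\<^sub>R (y - x)) \<subseteq> \<Omega>"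
      using ball_infdist_frontier_subset[OF assms(7)] d_def by blast
    from weak_gradient_bound_segment[OF assms(1,4) _ U(2,1) assms(5,6) this]
    have "\<bar>U (x + s *\<^sub>R (y - x)) - U x\<bar> \<le> M * norm (s *\<^sub>R (y - x))"
      by (simp add: U_def)
    also have "\<dots> \<le> M * d" using sd assms(5) by (intro mult_left_mono) auto
    finally show ?thesis .
  qed
  have "continuous_on UNIV (\<lambda>s::real. \<bar>U (x + s *\<^sub>R (y - x)) - U x\<bar>)"
    by (intro continuous_intros continuous_on_compose2[OF U(1)]) auto
  then have "isCont (\<lambda>s::real. \<bar>U (x + s *\<^sub>R (y - x)) - U x\<bar>) 1"
    by (simp add: continuous_on_eq_continuous_at)
  then have lim: "((\<lambda>s::real. \<bar>U (x + s *\<^sub>R (y - x)) - U x\<bar>) \<longlongrightarrow> \<bar>U (x + 1 *\<^sub>R (y - x)) - U x\<bar>) (at_left 1)"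
    unfolding isCont_def by (rule tendsto_within_subset) simp
  have "\<bar>U (x + 1 *\<^sub>R (y - x)) - U x\<bar> \<le> M * d"
  proof (rule tendsto_upperbound[OF lim])
    show "\<forall>\<^sub>F s in at_left 1. \<bar>U (x + s *\<^sub>R (y - x)) - U x\<bar> \<le> M * d"
      using eventually_at_left_real[of 0 "1::real"] * by (auto elim!: eventually_mono)
  qed simp
  then show ?thesis using yO assms(7) by (simp add: U_def boundary_dist_def d_def)
qed

section \<open>Morrey's estimate with asymptotically sharp constant\<close>

text \<open>The right-hand side, as a function of \<tau> = t^q, is the tangent line of the concave
  function \<tau>^(1/q) at \<tau> = \<kappa>^q; Young's inequality expresses this.\<close>

lemma young_powr_le:
  fixes t \<kappa> q :: real
  assumes "t \<ge> 0" "\<kappa> > 0" "q \<ge> 1"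
  shows "t \<le> \<kappa> * (1 - 1 / q) + \<kappa> powr (1 - q) / q * t powr q"
proof (cases "t = 0")
  case False
  then have t: "t > 0" using assms(1) by simp
  have "((t / \<kappa>) powr q) powr (1 / q) * 1 powr (1 - 1 / q) \<le> 1 / q * (t / \<kappa>) powr q + (1 - 1 / q) * 1"
    by (rule Youngs_inequality_0) (use assms t in auto)
  then have "t / \<kappa> \<le> 1 / q * (t / \<kappa>) powr q + (1 - 1 / q)"
    using assms t by (simp add: powr_powr)
  then have "t / \<kappa> * \<kappa> \<le> (1 / q * (t / \<kappa>) powr q + (1 - 1 / q)) * \<kappa>"
    using assms by (intro mult_right_mono) auto
  then show ?thesis
    using assms t by (simp add: powr_divide powr_diff field_simps)
qed (use assms in auto)

lemma continuous_on_norm_powr: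
  fixes f :: "'a::topological_space \<Rightarrow> 'b::real_normed_vector"
  assumes "continuous_on S f" "(q::real) > 0"
  shows "continuous_on S (\<lambda>x. norm (f x) powr q)"
  by (rule continuous_on_powr') (use assms in \<open>auto intro: continuous_intros\<close>)

lemma integral_cbox_jensen:
  fixes f :: "'a::euclidean_space \<Rightarrow> real"
  assumes "continuous_on (cbox a b) f" "\<And>z. 0 \<le> f z" "\<kappa> > 0" "q \<ge> 1"
    and "integral (cbox a b) (\<lambda>z. f z powr q) \<le> measure lborel (cbox a b) * \<kappa> powr q"
  shows "integral (cbox a b) f \<le> measure lborel (cbox a b) * \<kappa>"
proof -
  have c: "continuous_on (cbox a b) (\<lambda>z. f z powr q)"
    using assms(2,4) by (intro continuous_on_powr' assms(1) continuous_intros) auto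
  have "integral (cbox a b) f
      \<le> integral (cbox a b) (\<lambda>z. \<kappa> * (1 - 1 / q) + \<kappa> powr (1 - q) / q * f z powr q)"
    using assms c by (intro integral_le integrable_continuous young_powr_le
        continuous_on_add continuous_on_mult continuous_on_const) auto
  also have "\<dots> = measure lborel (cbox a b) * (\<kappa> * (1 - 1 / q))
      + \<kappa> powr (1 - q) / q * integral (cbox a b) (\<lambda>z. f z powr q)"
    by (subst integral_add[OF integrable_const integrable_continuous[OF
            continuous_on_mult[OF continuous_on_const c]]]) simp
  also have "\<dots> \<le> measure lborel (cbox a b) * (\<kappa> * (1 - 1 / q))
      + \<kappa> powr (1 - q) / q * (measure lborel (cbox a b) * \<kappa> powr q)"
    using assms by (intro add_left_mono mult_left_mono) auto
  also have "\<dots> = measure lborel (cbox a b) * \<kappa>"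
  proof -
    have "\<kappa> powr (1 - q) * \<kappa> powr q = \<kappa>"
      using assms(3) by (simp flip: powr_add)
    then have "\<kappa> powr (1 - q) / q * (measure lborel (cbox a b) * \<kappa> powr q) = measure lborel (cbox a b) * (\<kappa> / q)"
      by (metis (no_types, opaque_lifting) mult.assoc mult.commute times_divide_eq_left times_divide_eq_right)
    then show ?thesis by (simp add: algebra_simps)
  qed
  finally show ?thesis .
qed

text \<open>Contracting towards x by the factor s costs the Jacobian s^(-N); enlarging the image of
  the box to the whole space costs nothing since g is nonnegative.\<close>

lemma integral_cbox_affine_le:
  fixes g :: "'a::euclidean_space \<Rightarrow> real"
  assumes "integrable lborel g" "\<And>z. 0 \<le> g z" "s > 0" "continuous_on UNIV g"
  shows "integral (cbox a b) (\<lambda>z. g (x + s *\<^sub>R (z - x))) \<le> s powr (- real DIM('a)) * (LINT z|lborel. g z)"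
proof -
  define t where "t = x - s *\<^sub>R x"
  have t: "x + s *\<^sub>R (z - x) = t + s *\<^sub>R z" for z
    by (simp add: t_def algebra_simps)
  have gm: "g \<in> borel_measurable borel" using borel_measurable_continuous_onI[OF assms(4)] .
  have lb: "(lborel :: 'a measure) = density (distr lborel borel (\<lambda>x. t + s *\<^sub>R x)) (\<lambda>_. \<bar>s\<bar> ^ DIM('a))"
    using assms(3) by (intro lborel_affine) simp
  have "(LINT z|lborel. g z) = (LINT z|distr lborel borel (\<lambda>x. t + s *\<^sub>R x). \<bar>s\<bar> ^ DIM('a) *\<^sub>R g z)"
    by (subst lb, rule integral_density) (use gm in auto)
  also have "\<dots> = (LINT z|lborel. \<bar>s\<bar> ^ DIM('a) *\<^sub>R g (t + s *\<^sub>R z))"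
    by (rule integral_distr) (use gm in auto)
  finally have eq: "(LINT z|lborel. g z) = s ^ DIM('a) * (LINT z|lborel. g (t + s *\<^sub>R z))"
    using assms(3) by simp
  have "integrable (density (distr lborel borel (\<lambda>x. t + s *\<^sub>R x)) (\<lambda>_. \<bar>s\<bar> ^ DIM('a))) g"
    using assms(1) lb by simp
  then have "integrable (distr lborel borel (\<lambda>x. t + s *\<^sub>R x)) (\<lambda>z. \<bar>s\<bar> ^ DIM('a) *\<^sub>R g z)"
    by (subst (asm) integrable_density) (use gm in auto)
  then have "integrable lborel (\<lambda>z. \<bar>s\<bar> ^ DIM('a) *\<^sub>R g (t + s *\<^sub>R z))"
    by (subst (asm) integrable_distr_eq) (use gm in auto)
  then have i: "integrable lborel (\<lambda>z. g (t + s *\<^sub>R z))" using assms(3) by simp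
  have "integral (cbox a b) (\<lambda>z. g (t + s *\<^sub>R z)) \<le> integral UNIV (\<lambda>z. g (t + s *\<^sub>R z))"
  proof (rule integral_subset_le)
    show "(\<lambda>z. g (t + s *\<^sub>R z)) integrable_on cbox a b"
      by (intro integrable_continuous continuous_on_compose2[OF assms(4)] continuous_intros) auto
    show "(\<lambda>z. g (t + s *\<^sub>R z)) integrable_on UNIV"
      using has_integral_integral_lborel[OF i] by (rule has_integral_integrable)
  qed (use assms(2) in auto)
  also have "\<dots> = (LINT z|lborel. g (t + s *\<^sub>R z))"
    using has_integral_integral_lborel[OF i] by (rule integral_unique)
  also have "\<dots> = s powr (- real DIM('a)) * (LINT z|lborel. g z)"
    unfolding eq using assms(3) by (simp add: powr_minus powr_realpow)
  finally show ?thesis by (simp add: t)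
qed

text \<open>A cube rather than a ball: averages are then integrals over a \<open>cbox\<close>, where
  continuous functions are integrable and the Leibniz rule applies directly.\<close>

definition cube :: "'a::euclidean_space \<Rightarrow> real \<Rightarrow> 'a set" where
  "cube y \<epsilon> = cbox (y - \<epsilon> *\<^sub>R One) (y + \<epsilon> *\<^sub>R One)"

lemma content_cube: "\<epsilon> > 0 \<Longrightarrow> measure lborel (cube (y::'a::euclidean_space) \<epsilon>) = (2 * \<epsilon>) ^ DIM('a)"
  unfolding cube_def by (subst content_cbox') (auto simp: box_ne_empty inner_diff_left inner_add_left)

lemma norm_cube_le:
  fixes y z :: "'a::euclidean_space"
  assumes "z \<in> cube y \<epsilon>"
  shows "norm (z - y) \<le> real DIM('a) * \<epsilon>"
proof -
  have "norm (z - y) \<le> (\<Sum>b\<in>Basis. \<bar>(z - y) \<bullet> b\<bar>)" by (rule norm_le_l1)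
  also have "\<dots> \<le> (\<Sum>b\<in>(Basis::'a set). \<epsilon>)"
    using assms by (intro sum_mono)
      (auto simp: cube_def mem_box inner_diff_left inner_add_left abs_le_iff algebra_simps)
  finally show ?thesis by simp
qed

text \<open>The numerator is the cube volume to the power -1/q, left over from averaging; the
  denominator comes from integrating s^(-n/q) over [0, 1]. Both tend to 1 for fixed \<epsilon> as q
  grows.\<close>

definition morrey_const :: "nat \<Rightarrow> real \<Rightarrow> real \<Rightarrow> real" where
  "morrey_const n \<epsilon> q = ((2 * \<epsilon>) ^ n) powr (- 1 / q) / (1 - real n / q)"

text \<open>F(s), the integral of \<phi>(x + s (z - x)) over z in the cube, runs from the point
  value at s = 0 to the integral of \<phi> at s = 1. Its derivative is at most D times the integral
  of the gradient norm over the contracted cube, hence of size s^(-N/q), which is integrable at 0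
  since q > N. The point x may lie anywhere, not just near the cube.\<close>

lemma morrey_cube:
  fixes \<phi> :: "'a::euclidean_space \<Rightarrow> real"
  assumes "\<phi> \<in> test_functions \<Omega>" "\<epsilon> > 0" "q > real DIM('a)" "A > 0"
    and "(LINT z|lborel. norm (gradient \<phi> z) powr q) \<le> A powr q"
  shows "\<bar>integral (cube y \<epsilon>) \<phi> - measure lborel (cube y \<epsilon>) * \<phi> x\<bar>
    \<le> measure lborel (cube y \<epsilon>) * ((norm (x - y) + real DIM('a) * \<epsilon>) * morrey_const DIM('a) \<epsilon> q * A)"
proof -
  define \<mu> where "\<mu> = measure lborel (cube y \<epsilon>)"
  define D where "D = norm (x - y) + real DIM('a) * \<epsilon>"
  define N where "N = real DIM('a)"
  obtain a b where ab: "cube y \<epsilon> = cbox a b" by (auto simp: cube_def)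
  have q: "q > N" "q > 1" "N \<ge> 1" using assms(3) DIM_positive[where 'a = 'a] unfolding N_def by linarith+
  have \<mu>: "\<mu> = (2 * \<epsilon>) ^ DIM('a)" "\<mu> > 0"
    using content_cube[OF assms(2), of y] assms(2) by (simp_all add: \<mu>_def)
  have D: "norm (z - x) \<le> D" if "z \<in> cube y \<epsilon>" for z
    using norm_cube_le[OF that] norm_triangle_ineq[of "z - y" "y - x"]
    by (simp add: D_def norm_minus_commute)
  have D0: "D \<ge> 0" using assms(2) by (simp add: D_def)
  have C: "C_infinity \<phi> UNIV" using assms(1) by (simp add: test_functions_def)
  note cont = C_infinity_continuous[OF C, of UNIV] C_infinity_continuous_gradient[OF C, of UNIV]
  define g where "g s z = gradient \<phi> (x + s *\<^sub>R (z - x))" for s z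
  define F where "F s = integral (cbox a b) (\<lambda>z. \<phi> (x + s *\<^sub>R (z - x)))" for s
  define F' where "F' s = integral (cbox a b) (\<lambda>z. g s z \<bullet> (z - x))" for s
  have F: "(F has_vector_derivative F' s) (at s)" for s
  proof -
    have "((\<lambda>s. integral (cbox a b) (\<lambda>z. \<phi> (x + s *\<^sub>R (z - x)))) has_vector_derivative
        integral (cbox a b) (\<lambda>z. g s z \<bullet> (z - x))) (at s within UNIV)"
    proof (rule leibniz_rule_vector_derivative)
      fix s z
      have "((\<lambda>s::real. x + s *\<^sub>R (z - x)) has_derivative (\<lambda>h. h *\<^sub>R (z - x))) (at s)"
        by (auto intro!: derivative_eq_intros)
      from has_derivative_compose[OF this C_infinity_has_derivative[OF C]]
      show "((\<lambda>s. \<phi> (x + s *\<^sub>R (z - x))) has_vector_derivative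
          g s z \<bullet> (z - x)) (at s within UNIV)"
        unfolding has_vector_derivative_def
        by (simp add: g_def gradient_inner[OF C_infinity_differentiable[OF C], symmetric])
    next
      fix s
      show "(\<lambda>z. \<phi> (x + s *\<^sub>R (z - x))) integrable_on cbox a b"
        by (intro integrable_continuous continuous_on_compose2[OF cont(1)] continuous_intros) auto
    next
      show "continuous_on (UNIV \<times> cbox a b) (\<lambda>(s, z). g s z \<bullet> (z - x))"
        unfolding split_beta g_def
        by (intro continuous_intros continuous_on_compose2[OF cont(2)]) auto
    qed auto
    then show ?thesis by (simp add: F_def[abs_def] F'_def)
  qed
  define c where "c = D * \<mu> * (\<mu> powr (- 1 / q) * A)"
  define P where "P s = c * s powr (1 - N / q) / (1 - N / q)" for s
  have bound: "norm (F' s) \<le> c * s powr (- N / q)" if s: "0 < s" for s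
  proof -
    have cg: "continuous_on S (\<lambda>z. norm (g s z))" for S
      unfolding g_def by (intro continuous_intros continuous_on_compose2[OF cont(2)]) auto
    have "norm (F' s) \<le> integral (cbox a b) (\<lambda>z. D * norm (g s z))"
      unfolding F'_def
    proof (rule integral_norm_bound_integral)
      show "(\<lambda>z. g s z \<bullet> (z - x)) integrable_on cbox a b"
        unfolding g_def
        by (intro integrable_continuous continuous_intros continuous_on_compose2[OF cont(2)]) auto
      show "(\<lambda>z. D * norm (g s z)) integrable_on cbox a b"
        by (intro integrable_continuous continuous_intros cg)
      fix z assume "z \<in> cbox a b"
      then have "norm (z - x) \<le> D" using D ab by simp
      then have "norm (g s z) * norm (z - x)
          \<le> norm (g s z) * D"
        by (rule mult_left_mono) simp
      then show "norm (g s z \<bullet> (z - x))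
          \<le> D * norm (g s z)"
        using Cauchy_Schwarz_ineq2[of "g s z" "z - x"]
        by (simp add: mult.commute)
    qed
    also have "\<dots> = D * integral (cbox a b) (\<lambda>z. norm (g s z))"
      by simp
    also have "integral (cbox a b) (\<lambda>z. norm (g s z))
        \<le> \<mu> * (s powr (- N / q) * \<mu> powr (- 1 / q) * A)"
      unfolding \<mu>_def ab
    \<comment> \<open>The bound \<kappa> is chosen so that \<mu> \<kappa>^q = s^(-N) A^q: the
      contraction contributes s^(-N), and averaging over the cube divides by \<mu>.\<close>
    proof (rule integral_cbox_jensen[OF cg, where q = q])
      have gi: "integrable lborel (\<lambda>z. norm (gradient \<phi> z) powr q)"
      proof -
        define K where "K = closure {x. \<phi> x \<noteq> 0}"
        have K: "compact K" "\<phi> \<in> test_functions K"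
          using assms(1) by (simp_all add: test_functions_def K_def)
        show ?thesis
          by (rule integrable_continuous_compact_support[OF continuous_on_norm_powr[OF cont(2)] K(1)])
            (use q test_function_gradient_0[OF K(2)] in auto)
      qed
      have "integral (cbox a b) (\<lambda>z. norm (g s z) powr q)
          \<le> s powr (- N) * (LINT z|lborel. norm (gradient \<phi> z) powr q)"
        unfolding N_def g_def
        by (rule integral_cbox_affine_le[OF gi _ s continuous_on_norm_powr[OF cont(2)]])
          (use q in auto)
      also have "\<dots> \<le> s powr (- N) * A powr q" using assms(5) by (intro mult_left_mono) auto
      also have "\<dots> = \<mu> * (s powr (- N / q) * \<mu> powr (- 1 / q) * A) powr q"
      proof -
        have "(\<mu> powr (- 1 / q)) powr q = inverse \<mu>" "(s powr (- N / q)) powr q = s powr (- N)"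
          unfolding powr_powr using \<mu>(2) q(2) by (simp_all add: powr_minus)
        then show ?thesis
          using s \<mu>(2) assms(4) by (simp add: powr_mult)
      qed
      finally show "integral (cbox a b) (\<lambda>z. norm (g s z) powr q)
          \<le> measure lborel (cbox a b) * (s powr (- N / q) * measure lborel (cbox a b) powr (- 1 / q) * A) powr q"
        by (simp add: \<mu>_def ab)
    next
      have "0 < s powr (- N / q) * \<mu> powr (- 1 / q) * A"
        using s \<mu>(2) assms(4) by (intro mult_pos_pos) auto
      then show "0 < s powr (- N / q) * measure lborel (cbox a b) powr (- 1 / q) * A"
        unfolding \<mu>_def ab .
    qed (use q in auto)
    also have "D * (\<mu> * (s powr (- N / q) * \<mu> powr (- 1 / q) * A)) = c * s powr (- N / q)"
      by (simp add: c_def)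
    finally show ?thesis using D0 by (simp add: mult_left_mono)
  qed
  have "norm (F 1 - F 0) \<le> P 1 - P 0"
  \<comment> \<open>The bound on F' degenerates at s = 0, so F is compared with the antiderivative
    P, whose derivative is needed only inside (0, 1); P is continuous at 0 because 1 - N/q >
    0.\<close>
  proof (rule differentiable_bound_general[of 0 1 F P F' "\<lambda>s. c * s powr (- N / q)"])
    show "continuous_on {0..1} F"
      using F by (auto intro!: continuous_at_imp_continuous_on has_vector_derivative_continuous)
    have "N / q < 1" using q by simp
    then show "continuous_on {0..1} P"
      unfolding P_def[abs_def]
      by (intro continuous_intros continuous_on_powr') auto
    fix s :: real assume s: "0 < s" "s < 1"
    have "(P has_real_derivative c * s powr (- N / q)) (at s)"
      unfolding P_def[abs_def]
      using s q by (auto intro!: derivative_eq_intros)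
    then show "(P has_vector_derivative c * s powr (- N / q)) (at s)"
      by (simp add: has_real_derivative_iff_has_vector_derivative)
    show "norm (F' s) \<le> c * s powr (- N / q)" by (rule bound[OF s(1)])
  qed (use F in auto)
  moreover have "F 1 = integral (cube y \<epsilon>) \<phi>" by (simp add: F_def ab)
  moreover have "F 0 = \<mu> * \<phi> x" by (simp add: F_def \<mu>_def ab)
  moreover have "P 0 = 0" by (simp add: P_def)
  moreover have "P 1 = \<mu> * (D * morrey_const DIM('a) \<epsilon> q * A)"
    by (simp add: P_def c_def morrey_const_def N_def \<mu>(1))
  ultimately show ?thesis by (simp add: \<mu>_def D_def)
qed

text \<open>Both values are compared with the mean over the cube around y; each comparison
  contributes one N \<epsilon>.\<close>

lemma morrey_two_points:
  fixes \<phi> :: "'a::euclidean_space \<Rightarrow> real"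
  assumes "\<phi> \<in> test_functions \<Omega>" "\<epsilon> > 0" "q > real DIM('a)" "A > 0"
    and "(LINT z|lborel. norm (gradient \<phi> z) powr q) \<le> A powr q"
  shows "\<bar>\<phi> x - \<phi> y\<bar> \<le> (norm (x - y) + 2 * real DIM('a) * \<epsilon>) * morrey_const DIM('a) \<epsilon> q * A"
proof -
  define \<mu> where "\<mu> = measure lborel (cube y \<epsilon>)"
  have \<mu>: "\<mu> > 0" using content_cube[OF assms(2), of y] assms(2) by (simp add: \<mu>_def)
  define K where "K = morrey_const DIM('a) \<epsilon> q * A"
  have "\<bar>integral (cube y \<epsilon>) \<phi> - \<mu> * \<phi> x\<bar> \<le> \<mu> * ((norm (x - y) + real DIM('a) * \<epsilon>) * K)"
    using morrey_cube[OF assms, of y x] by (simp add: \<mu>_def K_def mult.assoc)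
  moreover have "\<bar>integral (cube y \<epsilon>) \<phi> - \<mu> * \<phi> y\<bar> \<le> \<mu> * (real DIM('a) * \<epsilon> * K)"
    using morrey_cube[OF assms, of y y] by (simp add: \<mu>_def K_def mult.assoc)
  ultimately have "\<bar>\<mu> * \<phi> x - \<mu> * \<phi> y\<bar>
      \<le> \<mu> * ((norm (x - y) + real DIM('a) * \<epsilon>) * K) + \<mu> * (real DIM('a) * \<epsilon> * K)"
    by linarith
  also have "\<dots> = \<mu> * ((norm (x - y) + 2 * real DIM('a) * \<epsilon>) * K)" by (simp add: algebra_simps)
  finally have "\<mu> * \<bar>\<phi> x - \<phi> y\<bar> \<le> \<mu> * ((norm (x - y) + 2 * real DIM('a) * \<epsilon>) * K)"
    using \<mu> by (simp add: abs_mult flip: right_diff_distrib)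
  then show ?thesis using \<mu> by (simp add: K_def mult.assoc)
qed

section \<open>Lebesgue spaces\<close>

text \<open>Convexity of the power with weights 1 - \<theta> and \<theta>. For small \<theta> the
  coefficient of a^q is close to 1, so a small perturbation b barely changes the norm; this takes
  the place of Minkowski's inequality.\<close>

lemma powr_add_le_convex:
  fixes a b :: real
  assumes "0 \<le> a" "0 \<le> b" "0 < \<theta>" "\<theta> < 1" "q \<ge> 1"
  shows "(a + b) powr q \<le> (1 - \<theta>) powr (1 - q) * a powr q + \<theta> powr (1 - q) * b powr q"
proof -
  have one: "1 \<le> t powr (1 - q)" if "0 < t" "t < 1" for t :: real
    using that assms(5) powr_mono2'[of "1 - q" t 1] by simp
  consider "a = 0" | "b = 0" | "a > 0" "b > 0" using assms by linarith
  then show ?thesis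
  proof cases
    case 1
    then show ?thesis
      using mult_right_mono[OF one[OF assms(3,4)], of "b powr q"] assms by simp
  next
    case 2
    then show ?thesis
      using mult_right_mono[OF one[of "1 - \<theta>"], of "a powr q"] assms by simp
  next
    case 3
    have "((1 - \<theta>) *\<^sub>R (a / (1 - \<theta>)) + \<theta> *\<^sub>R (b / \<theta>)) powr q
        \<le> (1 - \<theta>) * (a / (1 - \<theta>)) powr q + \<theta> * (b / \<theta>) powr q"
      using 3 assms by (intro convex_onD[OF powr_convex]) auto
    moreover have "(1 - \<theta>) *\<^sub>R (a / (1 - \<theta>)) + \<theta> *\<^sub>R (b / \<theta>) = a + b"
      using assms by simp
    moreover have "(1 - \<theta>) * (a / (1 - \<theta>)) powr q = (1 - \<theta>) powr (1 - q) * a powr q"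
      "\<theta> * (b / \<theta>) powr q = \<theta> powr (1 - q) * b powr q"
      using 3 assms by (simp_all add: powr_divide powr_diff)
    ultimately show ?thesis by simp
  qed
qed

lemma powr_interpolate_le:
  fixes t \<delta> :: real
  assumes "0 \<le> t" "0 < \<delta>" "0 < q" "q \<le> p"
  shows "t powr q \<le> \<delta> powr q + \<delta> powr (q - p) * t powr p"
proof (cases "t \<le> \<delta>")
  case True
  then have "t powr q \<le> \<delta> powr q" using assms by (intro powr_mono2) auto
  then show ?thesis by (simp add: add_increasing2)
next
  case False
  then have "t powr (q - p) \<le> \<delta> powr (q - p)"
    using assms by (intro powr_mono2') auto
  then have "t powr (q - p) * t powr p \<le> \<delta> powr (q - p) * t powr p"
    by (rule mult_right_mono) simp
  then have "t powr q \<le> \<delta> powr (q - p) * t powr p"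
    by (simp flip: powr_add)
  then show ?thesis by (simp add: add_increasing)
qed

lemma (in finite_measure) integrable_powr_le:
  fixes f :: "'a \<Rightarrow> real"
  assumes "f \<in> borel_measurable M" "\<And>x. 0 \<le> f x" "integrable M (\<lambda>x. f x powr p)" "0 < q" "q \<le> p"
  shows "integrable M (\<lambda>x. f x powr q)"
proof (rule Bochner_Integration.integrable_bound)
  show "integrable M (\<lambda>x. 1 + f x powr p)" using assms(3) by simp
  show "(\<lambda>x. f x powr q) \<in> borel_measurable M" using assms(1) by (intro powr_real_measurable) auto
  show "AE x in M. norm (f x powr q) \<le> norm (1 + f x powr p)"
    using powr_interpolate_le[OF assms(2) _ assms(4,5), of 1] by (intro AE_I2) simp
qed

text \<open>The pointwise split at \<delta> = (integral of f^p)^(1/p) balances both terms. The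
  constant is cruder than in Hoelder's inequality, but the estimate serves only to carry convergence
  to 0 from exponent p to q.\<close>

lemma (in finite_measure) integral_powr_lyapunov:
  fixes f :: "'a \<Rightarrow> real"
  assumes "f \<in> borel_measurable M" "\<And>x. 0 \<le> f x" "integrable M (\<lambda>x. f x powr p)" "0 < q" "q \<le> p"
  shows "(LINT x|M. f x powr q) \<le> (measure M (space M) + 1) * (LINT x|M. f x powr p) powr (q / p)"
proof -
  define a where "a = (LINT x|M. f x powr p)"
  have iq: "integrable M (\<lambda>x. f x powr q)" by (rule integrable_powr_le[OF assms])
  have "a \<ge> 0" unfolding a_def by (intro integral_nonneg_AE) simp
  then consider "a = 0" | "a > 0" by linarith
  then show ?thesis
  proof cases
    case 1
    then have "AE x in M. f x powr p = 0"
      using integral_nonneg_eq_0_iff_AE[OF assms(3)] by (simp add: a_def)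
    then have "AE x in M. f x powr q = 0" by eventually_elim simp
    then have "(LINT x|M. f x powr q) = 0"
      using integral_nonneg_eq_0_iff_AE[OF iq] by simp
    then show ?thesis by simp
  next
    case 2
    define \<delta> where "\<delta> = a powr (1 / p)"
    have \<delta>: "\<delta> > 0" using 2 by (simp add: \<delta>_def)
    have "(LINT x|M. f x powr q) \<le> (LINT x|M. \<delta> powr q + \<delta> powr (q - p) * f x powr p)"
      using iq assms(3) powr_interpolate_le[OF assms(2) \<delta> assms(4,5)] by (intro integral_mono) auto
    also have "\<dots> = measure M (space M) * \<delta> powr q + \<delta> powr (q - p) * a"
      using assms(3) by (simp add: a_def)
    also have "\<delta> powr q = a powr (q / p)" using 2 by (simp add: \<delta>_def powr_powr)
    also have "\<delta> powr (q - p) * a = a powr (q / p)"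
    proof -
      have "\<delta> powr (q - p) * a = a powr ((q - p) / p) * a powr 1"
        using 2 by (simp add: \<delta>_def powr_powr)
      also have "\<dots> = a powr (q / p)"
        unfolding powr_add[symmetric] using assms(4,5) by (simp add: field_simps)
      finally show ?thesis .
    qed
    finally show ?thesis by (simp add: a_def algebra_simps)
  qed
qed

lemma finite_measure_lebesgue_on_bounded:
  "open \<Omega> \<Longrightarrow> bounded \<Omega> \<Longrightarrow> finite_measure (lebesgue_on (\<Omega>::'a::euclidean_space set))"
  by (intro finite_measure_lebesgue_on lmeasurable_open)

lemma Lp_norm_nonneg: "Lp_norm \<Omega> s f \<ge> 0"
  by (simp add: Lp_norm_def)

lemma Lp_norm_powr:
  assumes "s > 0"
  shows "Lp_norm \<Omega> s f powr s = (LINT x|lebesgue_on \<Omega>. norm (f x) powr s)"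
proof -
  have "0 \<le> (LINT x|lebesgue_on \<Omega>. norm (f x) powr s)" by (intro integral_nonneg_AE) simp
  then show ?thesis using assms by (simp add: Lp_norm_def powr_powr)
qed

lemma Lp_norm_cong_AE:
  fixes f g :: "'a::euclidean_space \<Rightarrow> 'b::euclidean_space"
  assumes "f \<in> borel_measurable (lebesgue_on \<Omega>)" "g \<in> borel_measurable (lebesgue_on \<Omega>)"
    and "AE x in lebesgue_on \<Omega>. f x = g x"
  shows "Lp_norm \<Omega> s f = Lp_norm \<Omega> s g"
proof -
  have "(LINT x|lebesgue_on \<Omega>. norm (f x) powr s) = (LINT x|lebesgue_on \<Omega>. norm (g x) powr s)"
  proof (rule integral_cong_AE)
    show "AE x in lebesgue_on \<Omega>. norm (f x) powr s = norm (g x) powr s"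
      using assms(3) by eventually_elim simp
  qed (use assms in \<open>auto intro!: powr_real_measurable borel_measurable_norm\<close>)
  then show ?thesis by (simp add: Lp_norm_def)
qed

lemma Lp_space_cong_AE:
  fixes f g :: "'a::euclidean_space \<Rightarrow> 'b::euclidean_space"
  assumes "f \<in> borel_measurable (lebesgue_on \<Omega>)" "g \<in> Lp_space \<Omega> s"
    and "AE x in lebesgue_on \<Omega>. f x = g x"
  shows "f \<in> Lp_space \<Omega> s"
proof -
  have "integrable (lebesgue_on \<Omega>) (\<lambda>x. norm (f x) powr s)"
  proof (rule integrable_cong_AE_imp)
    show "integrable (lebesgue_on \<Omega>) (\<lambda>x. norm (g x) powr s)" using assms(2) by (simp add: Lp_space_def)
    show "AE x in lebesgue_on \<Omega>. norm (g x) powr s = norm (f x) powr s"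
      using assms(3) by eventually_elim simp
  qed (use assms in \<open>auto intro!: powr_real_measurable borel_measurable_norm\<close>)
  then show ?thesis using assms(1) by (simp add: Lp_space_def)
qed

lemma Lp_space_diff:
  fixes f g :: "'a::euclidean_space \<Rightarrow> 'b::euclidean_space"
  assumes "f \<in> Lp_space \<Omega> s" "g \<in> Lp_space \<Omega> s" "s \<ge> 1"
  shows "(\<lambda>x. f x - g x) \<in> Lp_space \<Omega> s"
proof -
  have m: "f \<in> borel_measurable (lebesgue_on \<Omega>)" "g \<in> borel_measurable (lebesgue_on \<Omega>)"
    and i: "integrable (lebesgue_on \<Omega>) (\<lambda>x. norm (f x) powr s)"
      "integrable (lebesgue_on \<Omega>) (\<lambda>x. norm (g x) powr s)"
    using assms by (auto simp: Lp_space_def)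
  have md: "(\<lambda>x. f x - g x) \<in> borel_measurable (lebesgue_on \<Omega>)" using m by (rule borel_measurable_diff)
  define h where "h x = (1 - 1 / 2) powr (1 - s) * norm (f x) powr s
    + (1 / 2) powr (1 - s) * norm (g x) powr s" for x
  have "integrable (lebesgue_on \<Omega>) (\<lambda>x. norm (f x - g x) powr s)"
  proof (rule Bochner_Integration.integrable_bound)
    show "integrable (lebesgue_on \<Omega>) h" using i by (simp add: h_def[abs_def])
    show "(\<lambda>x. norm (f x - g x) powr s) \<in> borel_measurable (lebesgue_on \<Omega>)"
      using md by (intro powr_real_measurable borel_measurable_norm) auto
    have "norm (f x - g x) powr s \<le> h x" for x
    proof -
      have "norm (f x - g x) powr s \<le> (norm (f x) + norm (g x)) powr s"
        using assms(3) by (intro powr_mono2 norm_triangle_ineq4) auto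
      also have "\<dots> \<le> h x"
        unfolding h_def by (rule powr_add_le_convex) (use assms(3) in auto)
      finally show ?thesis .
    qed
    then show "AE x in lebesgue_on \<Omega>. norm (norm (f x - g x) powr s)
        \<le> norm (h x)"
      by (intro AE_I2) (simp add: h_def abs_of_nonneg)
  qed
  then show ?thesis using md by (simp add: Lp_space_def)
qed

lemma Lp_space_continuous_support:
  fixes f :: "'a::euclidean_space \<Rightarrow> 'b::euclidean_space"
  assumes "open \<Omega>" "continuous_on UNIV f" "compact K" "K \<subseteq> \<Omega>" "\<And>x. x \<notin> K \<Longrightarrow> f x = 0" "s > 0"
  shows "f \<in> Lp_space \<Omega> s"
    and "(LINT x|lebesgue_on \<Omega>. norm (f x) powr s) = (LINT x|lborel. norm (f x) powr s)"
proof -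
  have c: "continuous_on UNIV (\<lambda>x. norm (f x) powr s)"
    by (rule continuous_on_norm_powr[OF assms(2,6)])
  have m: "(\<lambda>x. norm (f x) powr s) \<in> borel_measurable borel" using c by (rule borel_measurable_continuous_onI)
  have z: "norm (f x) powr s = 0" if "x \<notin> \<Omega>" for x using assms(4,5) that by auto
  have "integrable lborel (\<lambda>x. norm (f x) powr s)"
    by (rule integrable_continuous_compact_support[OF c assms(3)]) (use assms(5) in auto)
  then have i: "integrable (lebesgue_on \<Omega>) (\<lambda>x. norm (f x) powr s)"
    using integrable_lebesgue_on_eq_lborel[OF assms(1) m z] by blast
  have "f \<in> borel_measurable lebesgue"
    by (rule borel_measurable_lebesgue[OF borel_measurable_continuous_onI[OF assms(2)]])
  then have "f \<in> borel_measurable (lebesgue_on \<Omega>)" by (rule measurable_restrict_space1)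
  then show "f \<in> Lp_space \<Omega> s" using i by (simp add: Lp_space_def)
  show "(LINT x|lebesgue_on \<Omega>. norm (f x) powr s) = (LINT x|lborel. norm (f x) powr s)"
    by (rule integral_lebesgue_on_eq_lborel[OF assms(1) m z])
qed

lemma test_function_Lp:
  fixes \<phi> :: "'a::euclidean_space \<Rightarrow> real"
  assumes "open \<Omega>" "\<phi> \<in> test_functions \<Omega>" "s > 0"
  shows "\<phi> \<in> Lp_space \<Omega> s" "gradient \<phi> \<in> Lp_space \<Omega> s"
    and "(LINT x|lebesgue_on \<Omega>. norm (gradient \<phi> x) powr s) = (LINT x|lborel. norm (gradient \<phi> x) powr s)"
proof -
  define K where "K = closure {x. \<phi> x \<noteq> 0}"
  have K: "compact K" "K \<subseteq> \<Omega>" "\<phi> \<in> test_functions K" "C_infinity \<phi> UNIV"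
    using assms(2) by (simp_all add: test_functions_def K_def)
  show "\<phi> \<in> Lp_space \<Omega> s"
    by (rule Lp_space_continuous_support[OF assms(1) C_infinity_continuous[OF K(4)] K(1,2) _ assms(3)])
      (rule test_functions_0[OF K(3)])
  note * = assms(1) C_infinity_continuous_gradient[OF K(4)] K(1,2) test_function_gradient_0[OF K(3)] assms(3)
  show "gradient \<phi> \<in> Lp_space \<Omega> s" by (rule Lp_space_continuous_support(1)[OF *])
  show "(LINT x|lebesgue_on \<Omega>. norm (gradient \<phi> x) powr s) = (LINT x|lborel. norm (gradient \<phi> x) powr s)"
    by (rule Lp_space_continuous_support(2)[OF *])
qed

lemma has_weak_gradient_diff:
  assumes "open \<Omega>" "has_weak_gradient \<Omega> u G" "has_weak_gradient \<Omega> v H"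
  shows "has_weak_gradient \<Omega> (\<lambda>x. u x - v x) (\<lambda>x. G x - H x)"
  unfolding has_weak_gradient_def
proof (intro conjI ballI)
  have l: "locally_integrable \<Omega> u" "locally_integrable \<Omega> v" "locally_integrable \<Omega> G" "locally_integrable \<Omega> H"
    using assms by (auto simp: has_weak_gradient_def)
  then show "locally_integrable \<Omega> (\<lambda>x. u x - v x)" "locally_integrable \<Omega> (\<lambda>x. G x - H x)"
    by (auto intro: locally_integrable_diff)
  fix \<phi> and b :: 'a assume \<phi>: "\<phi> \<in> test_functions \<Omega>" and b: "b \<in> Basis"
  note i = integrable_test_function[OF assms(1) _ \<phi>]
    integrable_test_function[OF assms(1) _ test_function_derivative[OF \<phi>]]
  have "(LINT x|lebesgue_on \<Omega>. (u x - v x) * frechet_derivative \<phi> (at x) b)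
      = (LINT x|lebesgue_on \<Omega>. u x * frechet_derivative \<phi> (at x) b)
        - (LINT x|lebesgue_on \<Omega>. v x * frechet_derivative \<phi> (at x) b)"
    unfolding left_diff_distrib by (intro Bochner_Integration.integral_diff i l)
  also have "\<dots> = - (LINT x|lebesgue_on \<Omega>. (G x \<bullet> b) * \<phi> x) + (LINT x|lebesgue_on \<Omega>. (H x \<bullet> b) * \<phi> x)"
    by (simp add: has_weak_gradient_direction[OF assms(1,2) \<phi>] has_weak_gradient_direction[OF assms(1,3) \<phi>])
  also have "\<dots> = - (LINT x|lebesgue_on \<Omega>. (G x \<bullet> b) * \<phi> x - (H x \<bullet> b) * \<phi> x)"
    by (subst Bochner_Integration.integral_diff) (intro i l locally_integrable_inner | simp)+
  finally show "(LINT x|lebesgue_on \<Omega>. (u x - v x) * frechet_derivative \<phi> (at x) b)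
      = - (LINT x|lebesgue_on \<Omega>. ((G x - H x) \<bullet> b) * \<phi> x)"
    by (simp add: inner_diff_left left_diff_distrib)
qed

lemma W1p_weak_gradient:
  assumes "open \<Omega>" "u \<in> W1p \<Omega> s"
  shows "has_weak_gradient \<Omega> u (weak_gradient \<Omega> u)" "weak_gradient \<Omega> u \<in> Lp_space \<Omega> s"
proof -
  obtain G where G: "G \<in> Lp_space \<Omega> s" "has_weak_gradient \<Omega> u G" using assms(2) by (auto simp: W1p_def)
  show h: "has_weak_gradient \<Omega> u (weak_gradient \<Omega> u)" by (rule has_weak_gradient_weak_gradient[OF G(2)])
  show "weak_gradient \<Omega> u \<in> Lp_space \<Omega> s"
    by (rule Lp_space_cong_AE[OF has_weak_gradient_measurable(2)[OF assms(1) h] G(1)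
          weak_gradient_AE_eq[OF assms(1) G(2)]])
qed

lemma Lp_norm_weak_gradient:
  assumes "open \<Omega>" "has_weak_gradient \<Omega> u G"
  shows "Lp_norm \<Omega> s (weak_gradient \<Omega> u) = Lp_norm \<Omega> s G"
  using has_weak_gradient_weak_gradient[OF assms(2)] assms
  by (intro Lp_norm_cong_AE weak_gradient_AE_eq has_weak_gradient_measurable(2))

lemma Lp_norm_tendsto_0D:
  assumes "(\<lambda>n. Lp_norm \<Omega> s (f n)) \<longlonglongrightarrow> 0" "s > 0"
  shows "(\<lambda>n. LINT x|lebesgue_on \<Omega>. norm (f n x) powr s) \<longlonglongrightarrow> 0"
proof -
  have "(\<lambda>n. Lp_norm \<Omega> s (f n) powr s) \<longlonglongrightarrow> 0 powr s"
    by (rule tendsto_powr'[OF assms(1) tendsto_const]) (use assms(2) in \<open>simp add: Lp_norm_nonneg\<close>)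
  then show ?thesis using assms(2) by (simp add: Lp_norm_powr)
qed

text \<open>\<Omega> minus the closure of the good points is open and null, hence empty.
  Almost-everywhere facts about continuous functions thereby extend to all of
  \<open>closure \<Omega>\<close>.\<close>

lemma AE_dense:
  fixes \<Omega> :: "'a::euclidean_space set"
  assumes "open \<Omega>" "AE x in lebesgue_on \<Omega>. P x"
  shows "closure {x \<in> \<Omega>. P x} = closure \<Omega>"
proof
  show "closure {x \<in> \<Omega>. P x} \<subseteq> closure \<Omega>" by (intro closure_mono) auto
  have "\<Omega> \<subseteq> closure {x \<in> \<Omega>. P x}"
  proof (rule ccontr)
    assume "\<not> \<Omega> \<subseteq> closure {x \<in> \<Omega>. P x}"
    then have ne: "\<Omega> - closure {x \<in> \<Omega>. P x} \<noteq> {}" by blast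
    have o: "open (\<Omega> - closure {x \<in> \<Omega>. P x})" using assms(1) by (intro open_Diff) auto
    have "AE x in lebesgue. x \<in> \<Omega> \<longrightarrow> P x"
      using assms by (simp add: AE_restrict_space_iff)
    then have "AE x in lebesgue. x \<notin> \<Omega> - closure {x \<in> \<Omega>. P x}"
    proof eventually_elim
      case (elim x)
      then show ?case using closure_subset[of "{x \<in> \<Omega>. P x}"] by blast
    qed
    then have "\<Omega> - closure {x \<in> \<Omega>. P x} \<in> null_sets lebesgue"
      using o by (subst AE_iff_null_sets) auto
    then show False
      using open_not_negligible[OF o ne] by (simp add: negligible_iff_null_sets)
  qed
  then show "closure \<Omega> \<subseteq> closure {x \<in> \<Omega>. P x}" by (intro closure_minimal) auto
qed

section \<open>Continuous elements of the energy space\<close>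

text \<open>The approximating gradients converge in exponent p, hence in exponent q on the bounded
  domain, so their q-norms eventually fall below any A exceeding that of v. Discarding initial terms
  and passing to a subsequence gives the uniform bound and pointwise convergence together.\<close>

lemma W01p_approx:
  fixes v :: "'a::euclidean_space \<Rightarrow> real"
  assumes "open \<Omega>" "bounded \<Omega>" "v \<in> W01p \<Omega> p" "1 < q" "q \<le> p"
    and "A > Lp_norm \<Omega> q (weak_gradient \<Omega> v)"
  obtains \<phi> where "\<And>n::nat. \<phi> n \<in> test_functions \<Omega>"
    "\<And>n. (LINT z|lborel. norm (gradient (\<phi> n) z) powr q) \<le> A powr q"
    "AE x in lebesgue_on \<Omega>. (\<lambda>n. \<phi> n x) \<longlonglongrightarrow> v x"
proof -
  define M where "M = lebesgue_on \<Omega>"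
  interpret finite_measure M
    unfolding M_def by (rule finite_measure_lebesgue_on_bounded[OF assms(1,2)])
  have p: "p > 0" "p \<ge> 1" "q > 0" using assms by auto
  have v: "v \<in> W1p \<Omega> p" using assms(3) by (simp add: W01p_def)
  obtain \<phi> where \<phi>: "\<And>n::nat. \<phi> n \<in> test_functions \<Omega>"
    and lim: "(\<lambda>n. W1p_norm \<Omega> p (\<lambda>x. v x - \<phi> n x)) \<longlonglongrightarrow> 0"
    using assms(3) by (auto simp: W01p_def)
  define G where "G = weak_gradient \<Omega> v"
  have G: "has_weak_gradient \<Omega> v G" "G \<in> Lp_space \<Omega> p"
    unfolding G_def by (rule W1p_weak_gradient[OF assms(1) v])+
  have Gm: "G \<in> borel_measurable M" using G(2) by (simp add: Lp_space_def M_def)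
  define D where "D n x = G x - gradient (\<phi> n) x" for n x
  have lim1: "(\<lambda>n. Lp_norm \<Omega> p (\<lambda>x. v x - \<phi> n x)) \<longlonglongrightarrow> 0"
    by (rule tendsto_sandwich[OF _ _ tendsto_const lim]) (simp_all add: W1p_norm_def Lp_norm_nonneg)
  have "(\<lambda>n. Lp_norm \<Omega> p (weak_gradient \<Omega> (\<lambda>x. v x - \<phi> n x))) \<longlonglongrightarrow> 0"
    by (rule tendsto_sandwich[OF _ _ tendsto_const lim]) (simp_all add: W1p_norm_def Lp_norm_nonneg)
  then have "(\<lambda>n. Lp_norm \<Omega> p (D n)) \<longlonglongrightarrow> 0"
    by (simp add: D_def[abs_def] Lp_norm_weak_gradient[OF assms(1)
          has_weak_gradient_diff[OF assms(1) G(1) has_weak_gradient_test_function[OF assms(1) \<phi>]]])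
  then have a: "(\<lambda>n. LINT x|M. norm (D n x) powr p) \<longlonglongrightarrow> 0"
    unfolding M_def by (rule Lp_norm_tendsto_0D) (rule p)
  have DL: "D n \<in> Lp_space \<Omega> p" for n
    unfolding D_def[abs_def] by (rule Lp_space_diff[OF G(2) test_function_Lp(2)[OF assms(1) \<phi> p(1)] p(2)])
  have Dm: "(\<lambda>x. norm (D n x)) \<in> borel_measurable M" for n
    using DL[of n] by (auto simp: Lp_space_def M_def intro: borel_measurable_norm)
  have Di: "integrable M (\<lambda>x. norm (D n x) powr p)" for n
    using DL[of n] by (simp add: Lp_space_def M_def)
  have b: "(\<lambda>n. LINT x|M. norm (D n x) powr q) \<longlonglongrightarrow> 0"
  proof (rule tendsto_sandwich[OF _ _ tendsto_const])
    show "\<forall>\<^sub>F n in sequentially. (LINT x|M. norm (D n x) powr q)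
        \<le> (measure M (space M) + 1) * (LINT x|M. norm (D n x) powr p) powr (q / p)"
      by (intro always_eventually allI integral_powr_lyapunov[OF Dm _ Di p(3) assms(5)]) simp
    show "\<forall>\<^sub>F n in sequentially. 0 \<le> (LINT x|M. norm (D n x) powr q)"
      by (intro always_eventually allI integral_nonneg_AE) simp
    have "(\<lambda>n. (measure M (space M) + 1) * (LINT x|M. norm (D n x) powr p) powr (q / p))
        \<longlonglongrightarrow> (measure M (space M) + 1) * 0 powr (q / p)"
    proof (intro tendsto_mult tendsto_const tendsto_powr' a)
      show "(0::real) \<noteq> 0 \<or> q / p > 0 \<and>
          (\<forall>\<^sub>F n in sequentially. 0 \<le> (LINT x|M. norm (D n x) powr p))"
        using p by (auto intro!: always_eventually integral_nonneg_AE)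
    qed
    then show "(\<lambda>n. (measure M (space M) + 1) * (LINT x|M. norm (D n x) powr p) powr (q / p))
        \<longlonglongrightarrow> 0" by simp
  qed
  define A0 where "A0 = Lp_norm \<Omega> q G"
  have A0: "A0 < A" "0 \<le> A0" using assms(6) by (simp_all add: A0_def G_def Lp_norm_nonneg)
  have A0i: "(LINT x|M. norm (G x) powr q) = A0 powr q"
    unfolding A0_def M_def by (rule Lp_norm_powr[OF p(3), symmetric])
  have Gq: "integrable M (\<lambda>x. norm (G x) powr q)"
  proof (rule integrable_powr_le)
    show "integrable M (\<lambda>x. norm (G x) powr p)" using G(2) by (simp add: Lp_space_def M_def)
    show "(\<lambda>x. norm (G x)) \<in> borel_measurable M" using Gm by auto
  qed (use p assms(5) in simp_all)
  obtain \<theta> where \<theta>: "0 < \<theta>" "\<theta> < 1" "(1 - \<theta>) powr (1 - q) * A0 powr q < A powr q"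
  proof -
    have "((\<lambda>\<theta>. (1 - \<theta>) powr (1 - q) * A0 powr q) \<longlongrightarrow> (1 - 0) powr (1 - q) * A0 powr q) (at_right 0)"
      by (intro tendsto_intros) auto
    moreover have "(1 - 0) powr (1 - q) * A0 powr q < A powr q"
      using A0 p by (simp add: powr_less_mono2)
    ultimately have "\<forall>\<^sub>F \<theta> in at_right 0. (1 - \<theta>) powr (1 - q) * A0 powr q < A powr q"
      by (rule order_tendstoD(2))
    moreover have "\<forall>\<^sub>F \<theta> in at_right (0::real). \<theta> \<in> {0<..<1}"
      by (rule eventually_at_right_real) simp
    ultimately have "\<forall>\<^sub>F \<theta> in at_right (0::real).
        0 < \<theta> \<and> \<theta> < 1 \<and> (1 - \<theta>) powr (1 - q) * A0 powr q < A powr q"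
      by eventually_elim auto
    then show thesis using that eventually_happens'[OF trivial_limit_at_right_real] by blast
  qed
  have "(\<lambda>n. (1 - \<theta>) powr (1 - q) * A0 powr q
      + \<theta> powr (1 - q) * (LINT x|M. norm (D n x) powr q))
      \<longlonglongrightarrow> (1 - \<theta>) powr (1 - q) * A0 powr q + \<theta> powr (1 - q) * 0"
    by (intro tendsto_intros b)
  then have "\<forall>\<^sub>F n in sequentially. (1 - \<theta>) powr (1 - q) * A0 powr q
      + \<theta> powr (1 - q) * (LINT x|M. norm (D n x) powr q) < A powr q"
    by (rule order_tendstoD(2)) (use \<theta>(3) in simp)
  then obtain n0 where n0: "\<And>n. n \<ge> n0 \<Longrightarrow> (1 - \<theta>) powr (1 - q) * A0 powr q
      + \<theta> powr (1 - q) * (LINT x|M. norm (D n x) powr q) < A powr q"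
    unfolding eventually_sequentially by blast
  have bd: "(LINT z|lborel. norm (gradient (\<phi> n) z) powr q) \<le> A powr q" if "n \<ge> n0" for n
  proof -
    have iq: "integrable M (\<lambda>x. norm (D n x) powr q)"
      by (rule integrable_powr_le[OF Dm _ Di p(3) assms(5)]) simp
    have "(LINT z|lborel. norm (gradient (\<phi> n) z) powr q) = (LINT x|M. norm (gradient (\<phi> n) x) powr q)"
      unfolding M_def by (rule test_function_Lp(3)[OF assms(1) \<phi> p(3), symmetric])
    also have "\<dots> \<le> (LINT x|M. (1 - \<theta>) powr (1 - q) * norm (G x) powr q
        + \<theta> powr (1 - q) * norm (D n x) powr q)"
    proof (rule integral_mono)
      show "integrable M (\<lambda>x. norm (gradient (\<phi> n) x) powr q)"
        using test_function_Lp(2)[OF assms(1) \<phi> p(3), of n] by (simp add: M_def Lp_space_def)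
      show "integrable M (\<lambda>x. (1 - \<theta>) powr (1 - q) * norm (G x) powr q
          + \<theta> powr (1 - q) * norm (D n x) powr q)"
        using Gq iq by simp
      fix x
      have "norm (gradient (\<phi> n) x) \<le> norm (G x) + norm (D n x)"
        unfolding D_def
        by (rule norm_triangle_sub[of "gradient (\<phi> n) x" "G x", unfolded norm_minus_commute[of _ "G x"]])
      then have "norm (gradient (\<phi> n) x) powr q \<le> (norm (G x) + norm (D n x)) powr q"
        using p by (intro powr_mono2) auto
      also have "\<dots> \<le> (1 - \<theta>) powr (1 - q) * norm (G x) powr q
          + \<theta> powr (1 - q) * norm (D n x) powr q"
        by (rule powr_add_le_convex) (use \<theta> assms(4) in auto)
      finally show "norm (gradient (\<phi> n) x) powr q \<le> (1 - \<theta>) powr (1 - q) * norm (G x) powr q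
          + \<theta> powr (1 - q) * norm (D n x) powr q" .
    qed
    also have "\<dots> = (1 - \<theta>) powr (1 - q) * A0 powr q
      + \<theta> powr (1 - q) * (LINT x|M. norm (D n x) powr q)"
      using Gq iq by (simp add: A0i)
    also have "\<dots> \<le> A powr q" using n0[OF that] by simp
    finally show ?thesis .
  qed
  have i0: "integrable M (\<lambda>x. norm (v x - \<phi> n x) powr p)" for n
    using Lp_space_diff[OF _ test_function_Lp(1)[OF assms(1) \<phi> p(1)] p(2), of v n] v
    by (simp add: W1p_def Lp_space_def M_def)
  have "(\<lambda>n. LINT x|M. norm (v x - \<phi> n x) powr p) \<longlonglongrightarrow> 0"
    unfolding M_def by (rule Lp_norm_tendsto_0D[OF lim1 p(1)])
  then have "(\<lambda>n. LINT x|M. norm (norm (v x - \<phi> n x) powr p)) \<longlonglongrightarrow> 0" by simp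
  from tendsto_L1_AE_subseq[OF i0 this]
  obtain r where r: "strict_mono r" "AE x in M. (\<lambda>n. norm (v x - \<phi> (r n) x) powr p) \<longlonglongrightarrow> 0" by blast
  show thesis
  proof (rule that[of "\<lambda>n. \<phi> (r (n + n0))"])
    show "\<phi> (r (n + n0)) \<in> test_functions \<Omega>" for n by (rule \<phi>)
    have "r (n + n0) \<ge> n0" for n using seq_suble[OF r(1), of "n + n0"] by simp
    then show "(LINT z|lborel. norm (gradient (\<phi> (r (n + n0))) z) powr q) \<le> A powr q" for n
      by (rule bd)
    show "AE x in lebesgue_on \<Omega>. (\<lambda>n. \<phi> (r (n + n0)) x) \<longlonglongrightarrow> v x"
      using r(2) unfolding M_def
    proof eventually_elim
      case (elim x)
      have "(\<lambda>n. (norm (v x - \<phi> (r n) x) powr p) powr (1 / p)) \<longlonglongrightarrow> 0 powr (1 / p)"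
        by (rule tendsto_powr'[OF elim tendsto_const]) (use p in simp)
      then have "(\<lambda>n. norm (v x - \<phi> (r n) x)) \<longlonglongrightarrow> 0" using p by (simp add: powr_powr)
      then have "(\<lambda>n. v x - \<phi> (r n) x) \<longlonglongrightarrow> 0" by (rule tendsto_norm_zero_cancel)
      then have "(\<lambda>n. v x - (v x - \<phi> (r n) x)) \<longlonglongrightarrow> v x - 0" by (intro tendsto_diff tendsto_const)
      then have "(\<lambda>n. \<phi> (r n) x) \<longlonglongrightarrow> v x" by simp
      then show ?case by (rule LIMSEQ_ignore_initial_segment[of "\<lambda>n. \<phi> (r n) x"])
    qed
  qed
qed

lemma morrey_const_pos:
  assumes "0 < \<epsilon>" "real n < q"
  shows "0 < morrey_const n \<epsilon> q"
proof -
  have "((2 * \<epsilon>) ^ n) powr (- 1 / q) > 0" using assms by simp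
  moreover have "1 - real n / q > 0" using assms by simp
  ultimately show ?thesis unfolding morrey_const_def by (rule divide_pos_pos)
qed

text \<open>The estimate passes from test functions to v on the dense set of convergence points and
  then to the closure, one variable at a time. For the boundary version the zero value comes from
  the test functions at a nearest boundary point.\<close>

lemma X_space_morrey:
  fixes v :: "'a::euclidean_space \<Rightarrow> real"
  assumes "open \<Omega>" "bounded \<Omega>" "v \<in> X_space \<Omega> p" "real DIM('a) < q" "q \<le> p" "\<epsilon> > 0"
  defines "A \<equiv> Lp_norm \<Omega> q (weak_gradient \<Omega> v)"
  shows "\<And>x y. x \<in> closure \<Omega> \<Longrightarrow> y \<in> closure \<Omega> \<Longrightarrow>
      \<bar>v x - v y\<bar> \<le> (norm (x - y) + 2 * real DIM('a) * \<epsilon>) * (morrey_const DIM('a) \<epsilon> q * A)"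
    and "\<And>x. x \<in> closure \<Omega> \<Longrightarrow>
      \<bar>v x\<bar> \<le> (boundary_dist \<Omega> x + 2 * real DIM('a) * \<epsilon>) * (morrey_const DIM('a) \<epsilon> q * A)"
proof -
  define K where "K = morrey_const DIM('a) \<epsilon> q"
  define N where "N = 2 * real DIM('a) * \<epsilon>"
  have K: "K > 0" unfolding K_def by (rule morrey_const_pos[OF assms(6,4)])
  have N: "N > 0" using assms(6) by (simp add: N_def)
  have q: "1 < q" using assms(4) DIM_positive[where 'a = 'a] by linarith
  have v: "v \<in> W01p \<Omega> p" "continuous_on (closure \<Omega>) v" using assms(3) by (auto simp: X_space_def)
  have A: "A \<ge> 0" by (simp add: A_def Lp_norm_nonneg)
  have bdc: "continuous_on S (boundary_dist \<Omega>)" for S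
    unfolding boundary_dist_def[abs_def] by (intro continuous_intros)
  have key: "(\<forall>x\<in>closure \<Omega>. \<forall>y\<in>closure \<Omega>. \<bar>v x - v y\<bar> \<le> (norm (x - y) + N) * (K * B))
      \<and> (\<forall>x\<in>closure \<Omega>. \<bar>v x\<bar> \<le> (boundary_dist \<Omega> x + N) * (K * B))" if B: "B > A" for B
  proof -
    obtain \<phi> where \<phi>: "\<And>n::nat. \<phi> n \<in> test_functions \<Omega>"
      "\<And>n. (LINT z|lborel. norm (gradient (\<phi> n) z) powr q) \<le> B powr q"
      "AE x in lebesgue_on \<Omega>. (\<lambda>n. \<phi> n x) \<longlonglongrightarrow> v x"
      by (rule W01p_approx[OF assms(1,2) v(1) q assms(5) B[unfolded A_def]]) (rule that; assumption)
    have est: "\<bar>\<phi> n x - \<phi> n y\<bar> \<le> (norm (x - y) + N) * (K * B)" for n x y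
      using morrey_two_points[OF \<phi>(1) assms(6,4) _ \<phi>(2), of n x y] A B by (simp add: K_def N_def mult.assoc)
    define S where "S = {x \<in> \<Omega>. (\<lambda>n. \<phi> n x) \<longlonglongrightarrow> v x}"
    have S: "closure S = closure \<Omega>" unfolding S_def by (rule AE_dense[OF assms(1) \<phi>(3)])
    have lim: "(\<lambda>n. \<phi> n x) \<longlonglongrightarrow> v x" if "x \<in> S" for x using that by (simp add: S_def)
    have 1: "\<bar>v x - v y\<bar> - (norm (x - y) + N) * (K * B) \<le> 0" if "x \<in> S" "y \<in> S" for x y
    proof -
      have "(\<lambda>n. \<bar>\<phi> n x - \<phi> n y\<bar>) \<longlonglongrightarrow> \<bar>v x - v y\<bar>"
        by (intro tendsto_intros lim that)
      then have "\<bar>v x - v y\<bar> \<le> (norm (x - y) + N) * (K * B)"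
        by (rule LIMSEQ_le_const2) (use est in blast)
      then show ?thesis by simp
    qed
    have 2: "\<bar>v x - v y\<bar> - (norm (x - y) + N) * (K * B) \<le> 0" if "x \<in> S" "y \<in> closure S" for x y
      by (rule continuous_le_on_closure[OF _ that(2)])
        (use 1[OF that(1)] v(2) S in \<open>auto intro!: continuous_intros\<close>)
    have 3: "\<bar>v x - v y\<bar> - (norm (x - y) + N) * (K * B) \<le> 0" if "x \<in> closure S" "y \<in> closure S" for x y
      by (rule continuous_le_on_closure[OF _ that(1)])
        (use 2[OF _ that(2)] v(2) S in \<open>auto intro!: continuous_intros\<close>)
    have 4: "\<bar>v x\<bar> - (boundary_dist \<Omega> x + N) * (K * B) \<le> 0" if "x \<in> S" for x
    proof -
      have "x \<in> \<Omega>" using that by (simp add: S_def)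
      then have ne: "frontier \<Omega> \<noteq> {}" using frontier_nonempty_bounded assms(2) by blast
      obtain y where y: "y \<in> frontier \<Omega>" "boundary_dist \<Omega> x = dist x y"
        using infdist_attains_inf[OF frontier_closed ne, of x] unfolding boundary_dist_def by metis
      have "y \<notin> \<Omega>" using y(1) assms(1) by (simp add: frontier_def interior_open)
      then have "\<phi> n y = 0" for n by (rule test_functions_0[OF \<phi>(1)])
      then have "\<bar>\<phi> n x\<bar> \<le> (boundary_dist \<Omega> x + N) * (K * B)" for n
        using est[of n x y] y(2) by (simp add: dist_norm)
      moreover have "(\<lambda>n. \<bar>\<phi> n x\<bar>) \<longlonglongrightarrow> \<bar>v x\<bar>" by (intro tendsto_intros lim that)
      ultimately have "\<bar>v x\<bar> \<le> (boundary_dist \<Omega> x + N) * (K * B)"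
        by (intro LIMSEQ_le_const2[of _ "\<bar>v x\<bar>"]) auto
      then show ?thesis by simp
    qed
    have 5: "\<bar>v x\<bar> - (boundary_dist \<Omega> x + N) * (K * B) \<le> 0" if "x \<in> closure S" for x
    proof (rule continuous_le_on_closure[OF _ that 4])
      show "continuous_on (closure S) (\<lambda>x. \<bar>v x\<bar> - (boundary_dist \<Omega> x + N) * (K * B))"
        using v(2) unfolding S by (intro continuous_intros bdc)
    qed
    show ?thesis using 3 5 unfolding S by auto
  qed
  \<comment> \<open>Approximation requires B > A strictly; the bounds are continuous in B, so B
    decreases to A.\<close>
  have lim: "((\<lambda>B. c * (K * B)) \<longlongrightarrow> c * (K * A)) (at_right A)" for c
    by (intro tendsto_intros)
  have ev: "\<forall>\<^sub>F B in at_right A. B > A" by (simp add: eventually_at_right_less)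
  show "\<bar>v x - v y\<bar> \<le> (norm (x - y) + 2 * real DIM('a) * \<epsilon>) * (morrey_const DIM('a) \<epsilon> q * A)"
    if "x \<in> closure \<Omega>" "y \<in> closure \<Omega>" for x y
    unfolding K_def[symmetric] N_def[symmetric]
  proof (rule tendsto_lowerbound[OF lim])
    show "\<forall>\<^sub>F B in at_right A. \<bar>v x - v y\<bar> \<le> (norm (x - y) + N) * (K * B)"
      using ev by eventually_elim (use key that in blast)
  qed simp
  show "\<bar>v x\<bar> \<le> (boundary_dist \<Omega> x + 2 * real DIM('a) * \<epsilon>) * (morrey_const DIM('a) \<epsilon> q * A)"
    if "x \<in> closure \<Omega>" for x
    unfolding K_def[symmetric] N_def[symmetric]
  proof (rule tendsto_lowerbound[OF lim])
    show "\<forall>\<^sub>F B in at_right A. \<bar>v x\<bar> \<le> (boundary_dist \<Omega> x + N) * (K * B)"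
      using ev by eventually_elim (use key that in blast)
  qed simp
qed

section \<open>The supremum norm and \<open>\<Lambda>\<^sub>\<infinity>\<close>\<close>

lemma emeasure_lebesgue_on_open_pos:
  fixes \<Omega> :: "'a::euclidean_space set"
  assumes "open \<Omega>" "\<Omega> \<noteq> {}"
  shows "emeasure (lebesgue_on \<Omega>) \<Omega> \<noteq> 0"
  using open_not_negligible[OF assms] assms(1)
  by (auto simp: negligible_iff_null_sets null_sets_def emeasure_restrict_space)

lemma esssup_norm_nonneg:
  fixes f :: "'a::euclidean_space \<Rightarrow> 'b::euclidean_space"
  assumes "open \<Omega>" "\<Omega> \<noteq> {}"
  shows "0 \<le> esssup (lebesgue_on \<Omega>) (\<lambda>x. ereal (norm (f x)))"
proof -
  have "esssup (lebesgue_on \<Omega>) (\<lambda>x. 0 :: ereal) = 0"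
    by (rule esssup_const) (use emeasure_lebesgue_on_open_pos[OF assms] in simp)
  moreover have "esssup (lebesgue_on \<Omega>) (\<lambda>x. 0 :: ereal) \<le> esssup (lebesgue_on \<Omega>) (\<lambda>x. ereal (norm (f x)))"
    by (rule esssup_mono) auto
  ultimately show ?thesis by simp
qed

lemma Linf_norm_nonneg:
  fixes f :: "'a::euclidean_space \<Rightarrow> 'b::euclidean_space"
  assumes "open \<Omega>" "\<Omega> \<noteq> {}"
  shows "0 \<le> Linf_norm \<Omega> f"
  unfolding Linf_norm_def by (rule real_of_ereal_pos[OF esssup_norm_nonneg[OF assms]])

lemma Linf_norm_le:
  fixes f :: "'a::euclidean_space \<Rightarrow> 'b::euclidean_space"
  assumes "open \<Omega>" "\<Omega> \<noteq> {}" "f \<in> borel_measurable (lebesgue_on \<Omega>)"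
    and "AE x in lebesgue_on \<Omega>. norm (f x) \<le> C"
  shows "Linf_norm \<Omega> f \<le> C" "f \<in> Linf_space \<Omega>"
proof -
  have le: "esssup (lebesgue_on \<Omega>) (\<lambda>x. ereal (norm (f x))) \<le> ereal C"
    by (rule esssup_I) (use assms(3,4) in auto)
  then show "f \<in> Linf_space \<Omega>"
    using assms(3) by (auto simp: Linf_space_def intro: le_less_trans)
  have nn: "0 \<le> esssup (lebesgue_on \<Omega>) (\<lambda>x. ereal (norm (f x)))"
    by (rule esssup_norm_nonneg[OF assms(1,2)])
  show "Linf_norm \<Omega> f \<le> C"
    unfolding Linf_norm_def using le nn
    by (cases "esssup (lebesgue_on \<Omega>) (\<lambda>x. ereal (norm (f x)))") auto
qed

lemma AE_le_Linf_norm: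
  fixes f :: "'a::euclidean_space \<Rightarrow> 'b::euclidean_space"
  assumes "open \<Omega>" "\<Omega> \<noteq> {}" "f \<in> Linf_space \<Omega>"
  shows "AE x in lebesgue_on \<Omega>. norm (f x) \<le> Linf_norm \<Omega> f"
proof -
  have "ereal (Linf_norm \<Omega> f) = esssup (lebesgue_on \<Omega>) (\<lambda>x. ereal (norm (f x)))"
    unfolding Linf_norm_def
    using esssup_norm_nonneg[OF assms(1,2), of f] assms(3)
    by (intro ereal_real') (auto simp: Linf_space_def)
  then show ?thesis
    using esssup_AE[of "\<lambda>x. ereal (norm (f x))" "lebesgue_on \<Omega>"]
    by (metis (no_types, lifting) eventually_mono ereal_less_eq(3))
qed

lemma continuous_closure_measurable:
  fixes u :: "'a::euclidean_space \<Rightarrow> real"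
  assumes "open \<Omega>" "continuous_on (closure \<Omega>) u"
  shows "u \<in> borel_measurable (lebesgue_on \<Omega>)"
  using assms closure_subset[of \<Omega>] continuous_on_subset
  by (intro locally_integrable_measurable locally_integrable_continuous) blast+

lemma continuous_in_Linf_space:
  fixes u :: "'a::euclidean_space \<Rightarrow> real"
  assumes "open \<Omega>" "\<Omega> \<noteq> {}" "bounded \<Omega>" "continuous_on (closure \<Omega>) u"
  shows "u \<in> Linf_space \<Omega>"
proof -
  have "bounded (u ` closure \<Omega>)"
    by (intro compact_imp_bounded compact_continuous_image assms(4)) (simp add: assms(3))
  then obtain B where B: "\<And>x. x \<in> closure \<Omega> \<Longrightarrow> norm (u x) \<le> B" by (auto simp: bounded_iff)
  show ?thesis
    by (rule Linf_norm_le(2)[OF assms(1,2) continuous_closure_measurable[OF assms(1,4)], of B])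
      (use B closure_subset[of \<Omega>] in \<open>auto intro!: AE_I2\<close>)
qed

text \<open>The essential bound holds on a dense subset and extends by continuity, also to the
  boundary.\<close>

lemma abs_le_Linf_norm:
  fixes u :: "'a::euclidean_space \<Rightarrow> real"
  assumes "open \<Omega>" "\<Omega> \<noteq> {}" "bounded \<Omega>" "continuous_on (closure \<Omega>) u" "x \<in> closure \<Omega>"
  shows "\<bar>u x\<bar> \<le> Linf_norm \<Omega> u"
proof -
  have cl: "closure {x \<in> \<Omega>. norm (u x) \<le> Linf_norm \<Omega> u} = closure \<Omega>"
    by (rule AE_dense[OF assms(1) AE_le_Linf_norm[OF assms(1,2) continuous_in_Linf_space[OF assms(1-4)]]])
  show ?thesis
  proof (rule continuous_le_on_closure[where f = "\<lambda>x. \<bar>u x\<bar>"])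
    show "continuous_on (closure {x \<in> \<Omega>. norm (u x) \<le> Linf_norm \<Omega> u}) (\<lambda>x. \<bar>u x\<bar>)"
      unfolding cl by (intro continuous_intros assms(4))
    show "x \<in> closure {x \<in> \<Omega>. norm (u x) \<le> Linf_norm \<Omega> u}" unfolding cl by (rule assms(5))
  qed auto
qed

lemma continuous_Linf_norm_le:
  fixes u :: "'a::euclidean_space \<Rightarrow> real"
  assumes "open \<Omega>" "\<Omega> \<noteq> {}" "continuous_on (closure \<Omega>) u" "\<And>x. x \<in> \<Omega> \<Longrightarrow> \<bar>u x\<bar> \<le> C"
  shows "Linf_norm \<Omega> u \<le> C"
  by (rule Linf_norm_le(1)[OF assms(1,2) continuous_closure_measurable[OF assms(1,3)]])
    (use assms(4) in \<open>auto intro!: AE_I2\<close>)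

lemma Linf_norm_cmult:
  fixes u :: "'a::euclidean_space \<Rightarrow> real"
  assumes "c > 0"
  shows "Linf_norm \<Omega> (\<lambda>x. c * u x) = c * Linf_norm \<Omega> u"
proof -
  have "(\<lambda>x. ereal (norm (c * u x))) = (\<lambda>x. ereal c * ereal (norm (u x)))"
    using assms by (simp add: abs_mult)
  then show ?thesis
    using esssup_cmult[OF assms, of "lebesgue_on \<Omega>" "\<lambda>x. ereal (norm (u x))"]
    by (simp add: Linf_norm_def)
qed

section \<open>Bounded weak gradients and the value of \<open>Lambda_inf\<close>\<close>

lemma W1inf_weak_gradient:
  assumes "open \<Omega>" "\<Omega> \<noteq> {}" "u \<in> W1inf \<Omega>"
  shows "has_weak_gradient \<Omega> u (weak_gradient \<Omega> u)"
    "AE x in lebesgue_on \<Omega>. norm (weak_gradient \<Omega> u x) \<le> Linf_norm \<Omega> (weak_gradient \<Omega> u)"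
proof -
  obtain G where G: "G \<in> Linf_space \<Omega>" "has_weak_gradient \<Omega> u G" using assms(3) by (auto simp: W1inf_def)
  show h: "has_weak_gradient \<Omega> u (weak_gradient \<Omega> u)" by (rule has_weak_gradient_weak_gradient[OF G(2)])
  have "AE x in lebesgue_on \<Omega>. norm (weak_gradient \<Omega> u x) \<le> Linf_norm \<Omega> G"
    using weak_gradient_AE_eq[OF assms(1) G(2)] AE_le_Linf_norm[OF assms(1,2) G(1)]
    by eventually_elim simp
  then have "weak_gradient \<Omega> u \<in> Linf_space \<Omega>"
    by (rule Linf_norm_le(2)[OF assms(1,2) has_weak_gradient_measurable(2)[OF assms(1) h]])
  then show "AE x in lebesgue_on \<Omega>. norm (weak_gradient \<Omega> u x) \<le> Linf_norm \<Omega> (weak_gradient \<Omega> u)"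
    by (rule AE_le_Linf_norm[OF assms(1,2)])
qed

lemma test_function_C0:
  assumes "open \<Omega>" "\<phi> \<in> test_functions \<Omega>"
  shows "\<phi> \<in> C0 \<Omega>"
  using assms test_functions_0[OF assms(2)] C_infinity_continuous[of \<phi> "closure \<Omega>"]
  by (auto simp: C0_def test_functions_def frontier_def interior_open)

lemma test_function_W1inf:
  assumes "open \<Omega>" "\<Omega> \<noteq> {}" "\<phi> \<in> test_functions \<Omega>"
  shows "\<phi> \<in> W1inf \<Omega>"
proof -
  obtain B where B: "\<And>x. \<bar>\<phi> x\<bar> \<le> B" using test_function_bounded[OF assms(3)] by blast
  obtain B' where B': "\<And>x. norm (gradient \<phi> x) \<le> B'" using test_function_gradient_bounded[OF assms(3)] by blast
  have h: "has_weak_gradient \<Omega> \<phi> (gradient \<phi>)" by (rule has_weak_gradient_test_function[OF assms(1,3)])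
  note m = has_weak_gradient_measurable[OF assms(1) h]
  have "\<phi> \<in> Linf_space \<Omega>"
    by (rule Linf_norm_le(2)[OF assms(1,2) m(1), of B]) (use B in \<open>auto intro!: AE_I2\<close>)
  moreover have "gradient \<phi> \<in> Linf_space \<Omega>"
    by (rule Linf_norm_le(2)[OF assms(1,2) m(2), of B']) (use B' in \<open>auto intro!: AE_I2\<close>)
  ultimately show ?thesis using h by (auto simp: W1inf_def)
qed

lemma test_function_Linf_weak_gradient_le:
  assumes "open \<Omega>" "\<Omega> \<noteq> {}" "\<phi> \<in> test_functions \<Omega>" "\<And>x. norm (gradient \<phi> x) \<le> C"
  shows "Linf_norm \<Omega> (weak_gradient \<Omega> \<phi>) \<le> C"
proof (rule Linf_norm_le(1)[OF assms(1,2)])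
  have h: "has_weak_gradient \<Omega> \<phi> (gradient \<phi>)" by (rule has_weak_gradient_test_function[OF assms(1,3)])
  show "weak_gradient \<Omega> \<phi> \<in> borel_measurable (lebesgue_on \<Omega>)"
    by (rule has_weak_gradient_measurable(2)[OF assms(1) has_weak_gradient_weak_gradient[OF h]])
  show "AE x in lebesgue_on \<Omega>. norm (weak_gradient \<Omega> \<phi> x) \<le> C"
    using weak_gradient_AE_eq[OF assms(1) h] by eventually_elim (simp add: assms(4))
qed

lemma smooth_cone_gradient_le:
  assumes "0 < d" "d < R"
  shows "norm (gradient (smooth_cone c R d) x) \<le> 1"
proof -
  have "smooth_cone c R d \<in> test_functions UNIV" by (rule smooth_cone_test_function) (use assms in auto)
  then have "smooth_cone c R d differentiable (at x)"
    by (intro C_infinity_differentiable) (simp add: test_functions_def)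
  then have "norm (gradient (smooth_cone c R d) x) * norm (gradient (smooth_cone c R d) x)
      \<le> norm (gradient (smooth_cone c R d) x)"
    using smooth_cone_derivative_le[OF assms(1), of c R x "gradient (smooth_cone c R d) x"]
    by (simp add: gradient_inner[symmetric] dot_square_norm power2_eq_square)
  then show ?thesis by (cases "gradient (smooth_cone c R d) x = 0") auto
qed

lemma boundary_dist_attains_max:
  fixes \<Omega> :: "'a::euclidean_space set"
  assumes "open \<Omega>" "\<Omega> \<noteq> {}" "bounded \<Omega>"
  obtains c where "c \<in> \<Omega>" "boundary_dist \<Omega> c > 0" "\<And>x. x \<in> closure \<Omega> \<Longrightarrow> boundary_dist \<Omega> x \<le> boundary_dist \<Omega> c"
proof -
  have cont: "continuous_on (closure \<Omega>) (boundary_dist \<Omega>)"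
    unfolding boundary_dist_def[abs_def] by (intro continuous_intros)
  obtain c where c: "c \<in> closure \<Omega>" "\<And>x. x \<in> closure \<Omega> \<Longrightarrow> boundary_dist \<Omega> x \<le> boundary_dist \<Omega> c"
    using continuous_attains_sup[OF _ _ cont] assms by (metis closure_eq_empty compact_closure)
  have ne: "frontier \<Omega> \<noteq> {}" by (rule frontier_nonempty_bounded[OF assms(3,2)])
  have pos: "boundary_dist \<Omega> x > 0" if "x \<in> \<Omega>" for x
  proof -
    have "x \<notin> frontier \<Omega>" using that assms(1) by (simp add: frontier_def interior_open)
    then show ?thesis
      using in_closed_iff_infdist_zero[OF frontier_closed ne, of x] infdist_nonneg[of x "frontier \<Omega>"]
      by (simp add: boundary_dist_def less_le)
  qed
  obtain z where z: "z \<in> \<Omega>" using assms(2) by blast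
  have p: "boundary_dist \<Omega> c > 0"
    using pos[OF z] c(2)[of z] z closure_subset[of \<Omega>] by force
  then have "c \<notin> frontier \<Omega>" by (auto simp: boundary_dist_def)
  then have "c \<in> \<Omega>" using c(1) assms(1) by (simp add: frontier_def interior_open)
  then show thesis using that p c(2) by blast
qed

text \<open>Smoothed cones stand in for \<rho> as near minimisers: they are test functions, so their
  weak gradients are classical, and they reappear as competitors on the Nehari set.\<close>

lemma Lambda_inf_eq:
  fixes \<Omega> :: "'a::euclidean_space set"
  assumes "open \<Omega>" "bounded \<Omega>" "c \<in> \<Omega>" "R = boundary_dist \<Omega> c" "R > 0"
    and "\<And>x. x \<in> closure \<Omega> \<Longrightarrow> boundary_dist \<Omega> x \<le> R"
  shows "Lambda_inf \<Omega> = 1 / R"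
proof -
  define S where "S = {Linf_norm \<Omega> (weak_gradient \<Omega> u) / Linf_norm \<Omega> u |u.
     u \<in> W1inf \<Omega> \<inter> C0 \<Omega> \<and> \<not> (\<forall>x\<in>\<Omega>. u x = 0)}"
  have ne: "\<Omega> \<noteq> {}" using assms(3) by blast
  have lower: "1 / R \<le> s" if "s \<in> S" for s
  proof -
    obtain u where u: "s = Linf_norm \<Omega> (weak_gradient \<Omega> u) / Linf_norm \<Omega> u"
      "u \<in> W1inf \<Omega>" "u \<in> C0 \<Omega>" "\<not> (\<forall>x\<in>\<Omega>. u x = 0)"
      using \<open>s \<in> S\<close> unfolding S_def by blast
    define M where "M = Linf_norm \<Omega> (weak_gradient \<Omega> u)"
    have M: "M \<ge> 0" unfolding M_def by (rule Linf_norm_nonneg[OF assms(1) ne])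
    have c: "continuous_on (closure \<Omega>) u" using u(3) by (simp add: C0_def)
    have "\<bar>u x\<bar> \<le> M * R" if "x \<in> \<Omega>" for x
    proof -
      have "\<bar>u x\<bar> \<le> M * boundary_dist \<Omega> x"
        using C0_le_weak_gradient_boundary_dist[OF assms(1,2) u(3) W1inf_weak_gradient(1)[OF assms(1) ne u(2)] M]
          W1inf_weak_gradient(2)[OF assms(1) ne u(2)] that unfolding M_def by blast
      also have "\<dots> \<le> M * R" using assms(6)[of x] that closure_subset[of \<Omega>] M by (intro mult_left_mono) auto
      finally show ?thesis .
    qed
    then have le: "Linf_norm \<Omega> u \<le> M * R" by (rule continuous_Linf_norm_le[OF assms(1) ne c])
    obtain x where "x \<in> \<Omega>" "u x \<noteq> 0" using u(4) by blast
    then have "Linf_norm \<Omega> u > 0"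
      using abs_le_Linf_norm[OF assms(1) ne assms(2) c, of x] closure_subset[of \<Omega>] by force
    then show ?thesis using le assms(5) by (simp add: u(1) M_def[symmetric] field_simps)
  qed
  have upper: "\<exists>s\<in>S. s \<le> 1 / (R - 2 * d)" if d: "0 < d" "d < R / 2" for d
  proof -
    define w where "w = smooth_cone c R d"
    have dR: "d < R" using d assms(5) by linarith
    have sub: "ball c R \<subseteq> \<Omega>"
      using ball_infdist_frontier_subset[OF assms(3)] by (simp add: assms(4) boundary_dist_def)
    have w: "w \<in> test_functions \<Omega>"
      unfolding w_def by (rule smooth_cone_test_function[OF d(1) dR sub])
    have g: "Linf_norm \<Omega> (weak_gradient \<Omega> w) \<le> 1"
      unfolding w_def by (rule test_function_Linf_weak_gradient_le[OF assms(1) ne w[unfolded w_def]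
          smooth_cone_gradient_le[OF d(1) dR]])
    have wc: "R - 2 * d \<le> w c" unfolding w_def by (rule smooth_cone_center[OF d(1) dR])
    have C0: "w \<in> C0 \<Omega>" by (rule test_function_C0[OF assms(1) w])
    have "\<bar>w c\<bar> \<le> Linf_norm \<Omega> w"
      by (rule abs_le_Linf_norm[OF assms(1) ne assms(2)]) (use C0 assms(3) closure_subset in \<open>auto simp: C0_def\<close>)
    then have L: "R - 2 * d \<le> Linf_norm \<Omega> w" using wc by linarith
    have "w c \<noteq> 0" using wc d by linarith
    then have "Linf_norm \<Omega> (weak_gradient \<Omega> w) / Linf_norm \<Omega> w \<in> S"
      using C0 test_function_W1inf[OF assms(1) ne w] assms(3) unfolding S_def by blast
    moreover have "Linf_norm \<Omega> (weak_gradient \<Omega> w) / Linf_norm \<Omega> w \<le> 1 / (R - 2 * d)"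
      using g L d by (intro frac_le) auto
    ultimately show ?thesis by blast
  qed
  have bdd: "bdd_below S" using lower by (auto simp: bdd_below_def)
  have neS: "S \<noteq> {}" using upper[of "R / 4"] assms(5) by auto
  have "1 / R \<le> Inf S" by (rule cInf_greatest[OF neS lower])
  moreover have "Inf S \<le> 1 / R"
  proof (rule tendsto_lowerbound)
    show "((\<lambda>d. 1 / (R - 2 * d)) \<longlongrightarrow> 1 / R) (at_right 0)"
      using assms(5) by (auto intro!: tendsto_eq_intros)
    have "\<forall>\<^sub>F d in at_right (0::real). d \<in> {0<..<R / 2}"
      by (rule eventually_at_right_real) (use assms(5) in simp)
    then show "\<forall>\<^sub>F d in at_right 0. Inf S \<le> 1 / (R - 2 * d)"
    proof eventually_elim
      case (elim d)
      then obtain s where "s \<in> S" "s \<le> 1 / (R - 2 * d)" using upper[of d] by auto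
      then show ?case using cInf_lower[OF _ bdd] by fastforce
    qed
  qed simp
  ultimately show ?thesis by (simp add: Lambda_inf_def S_def)
qed

section \<open>Energy and competitors on the Nehari set\<close>

lemma gradient_cmult:
  assumes "C_infinity f UNIV"
  shows "gradient (\<lambda>x. c * f x) x = c *\<^sub>R gradient f x"
proof -
  have "((\<lambda>x. c * f x) has_derivative (\<lambda>h. c * frechet_derivative f (at x) h)) (at x)"
    by (intro has_derivative_mult_right C_infinity_has_derivative assms)
  then have "frechet_derivative (\<lambda>x. c * f x) (at x) = (\<lambda>h. c * frechet_derivative f (at x) h)"
    using frechet_derivative_at by metis
  then show ?thesis by (simp add: gradient_def scaleR_sum_right)
qed

lemma test_function_X_space:
  fixes \<phi> :: "'a::euclidean_space \<Rightarrow> real"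
  assumes "open \<Omega>" "\<phi> \<in> test_functions \<Omega>" "s > 0"
  shows "\<phi> \<in> X_space \<Omega> s"
proof -
  have h: "has_weak_gradient \<Omega> \<phi> (gradient \<phi>)" by (rule has_weak_gradient_test_function[OF assms(1,2)])
  have W: "\<phi> \<in> W1p \<Omega> s"
    using test_function_Lp(1,2)[OF assms] h by (auto simp: W1p_def)
  have "Lp_norm \<Omega> s (weak_gradient \<Omega> (\<lambda>x. \<phi> x - \<phi> x)) = 0"
    unfolding Lp_norm_weak_gradient[OF assms(1) has_weak_gradient_diff[OF assms(1) h h]]
    by (simp add: Lp_norm_def)
  then have "W1p_norm \<Omega> s (\<lambda>x. \<phi> x - \<phi> x) = 0"
    by (simp add: W1p_norm_def Lp_norm_def[of _ _ "\<lambda>x. 0 :: real"])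
  then have "\<phi> \<in> W01p \<Omega> s"
    using W assms(2) by (auto simp: W01p_def intro!: exI[of _ "\<lambda>_. \<phi>"])
  then show ?thesis
    using assms(2) C_infinity_continuous by (auto simp: X_space_def test_functions_def)
qed

text \<open>Inserting the constraint for the sup-norm term cancels the p-gradient entirely.
  Minimality thus controls the q-gradient directly.\<close>

lemma energy_on_nehari:
  assumes "u \<in> nehari \<Omega> p q l"
  shows "energy \<Omega> p q l u = (1 / q - 1 / p) * Lp_norm \<Omega> q (weak_gradient \<Omega> u) powr q"
proof -
  have "l * Linf_norm \<Omega> u powr p
      = Lp_norm \<Omega> p (weak_gradient \<Omega> u) powr p + Lp_norm \<Omega> q (weak_gradient \<Omega> u) powr q"
    using assms by (simp add: nehari_def)
  then have "l / p * Linf_norm \<Omega> u powr p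
      = (Lp_norm \<Omega> p (weak_gradient \<Omega> u) powr p + Lp_norm \<Omega> q (weak_gradient \<Omega> u) powr q) / p"
    by simp
  then show ?thesis
    unfolding energy_def by (simp add: add_divide_distrib left_diff_distrib)
qed

text \<open>The competitor is the multiple \<open>t * w\<close> lying on the Nehari set, where
  \<open>t\<close> solves \<open>B = t powr (p - q) * (l * m powr p - A)\<close>.\<close>

lemma least_energy_gradient_bound:
  fixes u :: "'a::euclidean_space \<Rightarrow> real"
  assumes "open \<Omega>" "\<Omega> \<noteq> {}" "bounded \<Omega>" "real DIM('a) < q" "q < p" "l > 0"
    and "w \<in> test_functions \<Omega>" "\<And>x. norm (gradient w x) \<le> 1" "c \<in> \<Omega>" "w c \<noteq> 0"
    and "2 * measure lebesgue \<Omega> \<le> l * Linf_norm \<Omega> w powr p"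
    and "least_energy_solution \<Omega> p q l u"
  shows "Lp_norm \<Omega> q (weak_gradient \<Omega> u)
    \<le> (2 * measure lebesgue \<Omega> / (l * Linf_norm \<Omega> w powr p)) powr (1 / (p - q))
       * measure lebesgue \<Omega> powr (1 / q)"
proof -
  define V where "V = measure lebesgue \<Omega>"
  define m where "m = Linf_norm \<Omega> w"
  define A where "A = (LINT x|lebesgue_on \<Omega>. norm (gradient w x) powr p)"
  define B where "B = (LINT x|lebesgue_on \<Omega>. norm (gradient w x) powr q)"
  interpret finite_measure "lebesgue_on \<Omega>"
    by (rule finite_measure_lebesgue_on_bounded[OF assms(1,3)])
  have pq: "0 < q" "0 < p" "1 < q" using assms(4,5) DIM_positive[where 'a = 'a] by linarith+
  have V: "V = measure (lebesgue_on \<Omega>) (space (lebesgue_on \<Omega>))"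
    using assms(1) by (simp add: V_def measure_restrict_space)
  have C: "C_infinity w UNIV" using assms(7) by (simp add: test_functions_def)
  have le_V: "(LINT x|lebesgue_on \<Omega>. norm (gradient w x) powr s) \<le> V" if "s > 0" for s
  proof -
    have "(LINT x|lebesgue_on \<Omega>. norm (gradient w x) powr s) \<le> (LINT x|lebesgue_on \<Omega>. 1)"
    proof (rule integral_mono)
      show "integrable (lebesgue_on \<Omega>) (\<lambda>x. norm (gradient w x) powr s)"
        using test_function_Lp(2)[OF assms(1,7) that] by (simp add: Lp_space_def)
      show "norm (gradient w x) powr s \<le> 1" for x
        using powr_mono2[of s "norm (gradient w x)" 1] assms(8)[of x] that by simp
    qed simp
    then show ?thesis by (simp add: V)
  qed
  have AB: "A \<le> V" "B \<le> V" unfolding A_def B_def using le_V pq by auto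
  have B0: "B \<ge> 0" unfolding B_def by (intro integral_nonneg_AE) simp
  have Lw: "Lp_norm \<Omega> s (weak_gradient \<Omega> (\<lambda>x. t * w x)) powr s
      = t powr s * (LINT x|lebesgue_on \<Omega>. norm (gradient w x) powr s)" if "s > 0" "t \<ge> 0" for s t
  proof -
    have h: "has_weak_gradient \<Omega> (\<lambda>x. t * w x) (gradient (\<lambda>x. t * w x))"
      by (rule has_weak_gradient_test_function[OF assms(1) test_functions_cmult[OF assms(7)]])
    show ?thesis
      unfolding Lp_norm_weak_gradient[OF assms(1) h] Lp_norm_powr[OF that(1)] gradient_cmult[OF C]
      using that by (simp add: powr_mult)
  qed
  have wX: "w \<in> X_space \<Omega> p" by (rule test_function_X_space[OF assms(1,7) pq(2)])
  have wc: "continuous_on (closure \<Omega>) w" using C by (rule C_infinity_continuous)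
  have cc: "c \<in> closure \<Omega>" using assms(9) closure_subset by blast
  have m: "m > 0"
    using abs_le_Linf_norm[OF assms(1-3) wc cc] assms(10) by (simp add: m_def)
  \<comment> \<open>A vanishing q-gradient would make Morrey's bound zero at c, although
    \<open>w c\<close> is nonzero.\<close>
  have "B \<noteq> 0"
  proof
    assume "B = 0"
    then have "Lp_norm \<Omega> q (weak_gradient \<Omega> w) powr q = 0" using Lw[of q 1] pq by (simp add: B_def)
    then have "Lp_norm \<Omega> q (weak_gradient \<Omega> w) = 0" by simp
    then show False
      using X_space_morrey(2)[OF assms(1,3) wX assms(4) _ zero_less_one cc] assms(5,10) by simp
  qed
  then have B: "B > 0" using B0 by simp
  have V0: "V > 0" using B AB by linarith
  define E where "E = l * m powr p"
  have E: "E > 0" "2 * V \<le> E" using assms(6,11) m by (simp_all add: E_def V_def m_def)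
  \<comment> \<open>The factor 2 in the hypothesis is spent here: A uses up at most half of E, so
    the equation for t has a positive solution that is controlled by V and E alone.\<close>
  have EA: "E - A \<ge> E / 2" "E - A > 0" using AB E V0 by linarith+
  define t where "t = (B / (E - A)) powr (1 / (p - q))"
  have t: "t > 0" using B EA by (simp add: t_def)
  have tpq: "t powr (p - q) * (E - A) = B"
    using B EA assms(5) by (simp add: t_def powr_powr)
  have tw: "(\<lambda>x. t * w x) \<in> nehari \<Omega> p q l"
  proof -
    have "(\<lambda>x. t * w x) \<in> X_space \<Omega> p"
      by (rule test_function_X_space[OF assms(1) test_functions_cmult[OF assms(7)] pq(2)])
    moreover have "\<not> (\<forall>x\<in>\<Omega>. t * w x = 0)" using t assms(9,10) by auto
    moreover have "t powr p * A + t powr q * B = l * (t * m) powr p"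
    proof -
      have "t powr q * B = t powr (q + (p - q)) * (E - A)"
        unfolding powr_add tpq[symmetric] by simp
      then show ?thesis
        using t m by (simp add: powr_mult E_def algebra_simps)
    qed
    ultimately show ?thesis
      unfolding nehari_def using t pq
      by (simp add: Lw Linf_norm_cmult A_def[symmetric] B_def[symmetric] m_def[symmetric])
  qed
  have u: "u \<in> nehari \<Omega> p q l" "energy \<Omega> p q l u \<le> energy \<Omega> p q l (\<lambda>x. t * w x)"
    using assms(12) tw by (auto simp: least_energy_solution_def)
  have "(1 / q - 1 / p) * Lp_norm \<Omega> q (weak_gradient \<Omega> u) powr q \<le> (1 / q - 1 / p) * (t powr q * B)"
    using u(2) unfolding energy_on_nehari[OF u(1)] energy_on_nehari[OF tw]
    using Lw[OF pq(1), of t] t by (simp add: B_def)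
  moreover have "1 / q - 1 / p > 0" using pq assms(5) by (simp add: field_simps)
  ultimately have "Lp_norm \<Omega> q (weak_gradient \<Omega> u) powr q \<le> t powr q * B" by simp
  also have "\<dots> \<le> t powr q * V" using AB by (intro mult_left_mono) auto
  also have "\<dots> = (t * V powr (1 / q)) powr q"
    using t V0 pq by (simp add: powr_mult powr_powr)
  finally have "Lp_norm \<Omega> q (weak_gradient \<Omega> u) \<le> t * V powr (1 / q)"
    using pq t V0 powr_less_mono2[of q "t * V powr (1 / q)" "Lp_norm \<Omega> q (weak_gradient \<Omega> u)"]
    by (meson mult_nonneg_nonneg not_le less_imp_le powr_ge_zero)
  also have "\<dots> \<le> (2 * V / E) powr (1 / (p - q)) * V powr (1 / q)"
  proof (rule mult_right_mono)
    have "B / (E - A) \<le> V / (E / 2)"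
      using AB EA E B by (intro frac_le) auto
    then have "t \<le> (V / (E / 2)) powr (1 / (p - q))"
      unfolding t_def using B EA assms(5) by (intro powr_mono2) auto
    then show "t \<le> (2 * V / E) powr (1 / (p - q))" by (simp add: mult.commute)
  qed simp
  finally show ?thesis by (simp add: V_def E_def m_def)
qed

section \<open>Energies and limits along the family\<close>

lemma morrey_const_tendsto_1:
  assumes "\<epsilon> > 0"
  shows "(morrey_const n \<epsilon> \<longlongrightarrow> 1) at_top"
proof -
  have "((\<lambda>q. ((2 * \<epsilon>) ^ n) powr (- 1 / q) / (1 - real n / q)) \<longlongrightarrow> ((2 * \<epsilon>) ^ n) powr 0 / (1 - 0)) at_top"
    using assms by (intro tendsto_intros tendsto_powr tendsto_divide_0[OF tendsto_const]
        filterlim_at_top_imp_at_infinity filterlim_ident) auto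
  then show ?thesis using assms by (simp add: morrey_const_def[abs_def])
qed

lemma powr_inverse_at_top_tendsto_1:
  "(a::real) > 0 \<Longrightarrow> ((\<lambda>p. a powr (1 / p)) \<longlongrightarrow> 1) at_top"
proof -
  assume "a > 0"
  then have "((\<lambda>p. a powr (1 / p)) \<longlongrightarrow> a powr 0) at_top"
    by (intro tendsto_powr tendsto_const tendsto_divide_0[OF tendsto_const]
        filterlim_at_top_imp_at_infinity filterlim_ident) auto
  with \<open>a > 0\<close> show ?thesis by simp
qed

lemma uniform_limit_diagonal:
  fixes f :: "nat \<Rightarrow> 'a::metric_space \<Rightarrow> real"
  assumes "uniform_limit S f u sequentially" "continuous_on S u" "x \<in> S" "y \<longlonglongrightarrow> x"
    and "\<forall>\<^sub>F n in sequentially. y n \<in> S"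
  shows "(\<lambda>n. f n (y n)) \<longlonglongrightarrow> u x"
proof -
  have "(\<lambda>n. f n (y n) - u (y n)) \<longlonglongrightarrow> 0"
  proof (rule tendstoI)
    fix e :: real assume "e > 0"
    then have "\<forall>\<^sub>F n in sequentially. \<forall>z\<in>S. dist (f n z) (u z) < e"
      using assms(1) by (simp add: uniform_limit_iff)
    then show "\<forall>\<^sub>F n in sequentially. dist (f n (y n) - u (y n)) 0 < e"
      using assms(5) by eventually_elim (auto simp: dist_real_def)
  qed
  moreover have "(\<lambda>n. u (y n)) \<longlonglongrightarrow> u x"
    by (rule continuous_on_tendsto_compose[OF assms(2,4,3,5)])
  ultimately have "(\<lambda>n. (f n (y n) - u (y n)) + u (y n)) \<longlonglongrightarrow> 0 + u x" by (rule tendsto_add)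
  then show ?thesis by simp
qed

text \<open>The hypothesis on \<Lambda> appears as \<open>\<Lambda> * R > 1\<close>, its form once
  \<open>Lambda_inf\<close> is known to be 1/R. The estimates inside hold along the full family as p
  tends to infinity; the sequence of the limit pair enters only later.\<close>

locale least_energy_family =
  fixes \<Omega> :: "'a::euclidean_space set"
    and q l :: "real \<Rightarrow> real"
    and Q \<Lambda> R :: real
    and c :: 'a
    and v :: "real \<Rightarrow> 'a \<Rightarrow> real"
  assumes open_domain: "open \<Omega>" and bounded_domain: "bounded \<Omega>" and c: "c \<in> \<Omega>"
    and R: "R = boundary_dist \<Omega> c" "R > 0" "\<And>x. x \<in> closure \<Omega> \<Longrightarrow> boundary_dist \<Omega> x \<le> R"
    and q: "\<And>p. p > real DIM('a) \<Longrightarrow> real DIM('a) < q p \<and> q p < p"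
    and q_lim: "((\<lambda>p. q p / p) \<longlongrightarrow> Q) at_top" and Q: "0 < Q" "Q < 1"
    and \<Lambda>: "\<Lambda> * R > 1"
    and l: "\<And>p. p > real DIM('a) \<Longrightarrow> l p > 0"
    and l_lim: "((\<lambda>p. l p powr (1 / p)) \<longlongrightarrow> \<Lambda>) at_top"
    and v: "\<forall>\<^sub>F p in at_top. least_energy_solution \<Omega> p (q p) (l p) (v p)"
begin

definition T :: real where "T = (1 / (R * \<Lambda>)) powr (1 / (1 - Q))"

lemma domain_nonempty: "\<Omega> \<noteq> {}" using c by blast

lemma \<Lambda>_pos: "\<Lambda> > 0"
  using \<Lambda> R(2) by (smt (verit) mult_nonneg_nonneg mult_nonpos_nonneg)

lemma T_pos: "T > 0"
  using \<Lambda>_pos R(2) by (simp add: T_def)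

lemma eventually_dim: "\<forall>\<^sub>F p in at_top. p > real DIM('a)"
  by (rule eventually_gt_at_top)

text \<open>Positivity of Q enters here: Morrey's constant tends to 1 only because q itself tends to
  infinity.\<close>

lemma q_at_top: "filterlim q at_top at_top"
proof -
  have "filterlim (\<lambda>p. q p / p * p) at_top at_top"
    by (rule filterlim_tendsto_pos_mult_at_top[OF q_lim Q(1) filterlim_ident])
  then show ?thesis
    by (rule filterlim_cong[OF refl refl, THEN iffD1, rotated])
      (use eventually_gt_at_top[of "0::real"] in eventually_elim, simp)
qed

lemma exponent_lim: "((\<lambda>p. 1 / (1 - q p / p)) \<longlongrightarrow> 1 / (1 - Q)) at_top"
  using Q by (intro tendsto_intros q_lim) auto

lemma morrey_lim:
  assumes "\<epsilon> > 0"
  shows "((\<lambda>p. morrey_const DIM('a) \<epsilon> (q p)) \<longlongrightarrow> 1) at_top"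
  using filterlim_compose[OF morrey_const_tendsto_1[OF assms] q_at_top] .

text \<open>The cone parameter d is frozen first, so small that (R - 2 d) \<Lambda> still exceeds 1
  and the limiting value stays below T'. Then p tends to infinity in the competitor bound; (R - 2 d)
  \<Lambda> > 1 makes l m^p outgrow the volume, as that bound requires.\<close>

lemma gradient_limsup:
  assumes "T' > T"
  shows "\<forall>\<^sub>F p in at_top. Lp_norm \<Omega> (q p) (weak_gradient \<Omega> (v p)) \<le> T'"
proof -
  define f where "f d = (1 / ((R - 2 * d) * \<Lambda>)) powr (1 / (1 - Q))" for d
  have "(f \<longlongrightarrow> (1 / ((R - 2 * 0) * \<Lambda>)) powr (1 / (1 - Q))) (at_right 0)"
    unfolding f_def[abs_def] using R(2) \<Lambda>_pos by (intro tendsto_intros) auto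
  then have ev1: "\<forall>\<^sub>F d in at_right 0. f d < T'"
    by (rule order_tendstoD(2)) (use assms in \<open>simp add: T_def\<close>)
  have "((\<lambda>d. (R - 2 * d) * \<Lambda>) \<longlongrightarrow> (R - 2 * 0) * \<Lambda>) (at_right 0)"
    by (intro tendsto_intros)
  then have ev2: "\<forall>\<^sub>F d in at_right 0. 1 < (R - 2 * d) * \<Lambda>"
    by (rule order_tendstoD(1)) (use \<Lambda> in \<open>simp add: mult.commute\<close>)
  have ev3: "\<forall>\<^sub>F d in at_right (0::real). d \<in> {0<..<R / 2}"
    by (rule eventually_at_right_real) (use R(2) in simp)
  have "\<forall>\<^sub>F d in at_right 0. d \<in> {0<..<R / 2} \<and> 1 < (R - 2 * d) * \<Lambda>
      \<and> f d < T'"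
    using ev1 ev2 ev3 by eventually_elim blast
  then obtain d where "d \<in> {0<..<R / 2} \<and> 1 < (R - 2 * d) * \<Lambda>
      \<and> f d < T'"
    using eventually_happens'[OF trivial_limit_at_right_real] by blast
  then have d: "0 < d" "d < R / 2" "1 < (R - 2 * d) * \<Lambda>"
      "f d < T'" by auto
  define w where "w = smooth_cone c R d"
  define m where "m = Linf_norm \<Omega> w"
  define V where "V = measure lebesgue \<Omega>"
  have dR: "d < R" using d(1,2) by linarith
  have sub: "ball c R \<subseteq> \<Omega>"
    using ball_infdist_frontier_subset[OF c] by (simp add: R(1) boundary_dist_def)
  have w: "w \<in> test_functions \<Omega>"
    unfolding w_def by (rule smooth_cone_test_function[OF d(1) dR sub])
  have wg: "norm (gradient w x) \<le> 1" for x
    unfolding w_def by (rule smooth_cone_gradient_le[OF d(1) dR])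
  have wc: "R - 2 * d \<le> w c" unfolding w_def by (rule smooth_cone_center[OF d(1) dR])
  then have wc0: "w c \<noteq> 0" using d(2) by linarith
  have "\<bar>w c\<bar> \<le> m"
    unfolding m_def by (rule abs_le_Linf_norm[OF open_domain domain_nonempty bounded_domain])
      (use test_function_C0[OF open_domain w] c closure_subset in \<open>auto simp: C0_def\<close>)
  then have m: "R - 2 * d \<le> m" "m > 0" using wc d(2) by linarith+
  have V: "V > 0"
  proof -
    have "V \<noteq> 0"
      using open_not_negligible[OF open_domain domain_nonempty] lmeasurable_open[OF bounded_domain open_domain]
      by (auto simp: V_def negligible_iff_measure0)
    then show ?thesis by (simp add: V_def less_le)
  qed
  have le: "(R - 2 * d) * \<Lambda> \<le> m * \<Lambda>" using m(1) \<Lambda>_pos by (intro mult_right_mono) auto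
  have m\<Lambda>: "m * \<Lambda> > 1" using le d(3) by linarith
  \<comment> \<open>The p-th root of 2 V / (l m^p). Eventually b < 1, which yields 2 V <= l m^p, and
    the exponent 1/(p - q) turns into the convergent exponent 1/(1 - q/p) on b.\<close>
  define b where "b p = (2 * V) powr (1 / p) / (l p powr (1 / p) * m)" for p
  have base: "(b \<longlongrightarrow> 1 / (\<Lambda> * m)) at_top"
    unfolding b_def[abs_def] using V m \<Lambda>_pos by (intro tendsto_intros powr_inverse_at_top_tendsto_1 l_lim) auto
  have "1 / (\<Lambda> * m) < 1" using m\<Lambda> by (simp add: mult.commute)
  from order_tendstoD(2)[OF base this]
  have ev4: "\<forall>\<^sub>F p in at_top. b p < 1" .
  have "((\<lambda>p. b p powr (1 / (1 - q p / p)) * V powr (1 / q p))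
      \<longlongrightarrow> (1 / (\<Lambda> * m)) powr (1 / (1 - Q)) * 1) at_top"
    using m \<Lambda>_pos
    by (intro tendsto_mult tendsto_powr base exponent_lim
        filterlim_compose[OF powr_inverse_at_top_tendsto_1[OF V] q_at_top]) auto
  moreover have "(1 / (\<Lambda> * m)) powr (1 / (1 - Q)) * 1 < T'"
  proof -
    have "1 / (\<Lambda> * m) \<le> 1 / ((R - 2 * d) * \<Lambda>)"
      using le d(3) by (intro frac_le) (auto simp: mult.commute)
    then have "(1 / (\<Lambda> * m)) powr (1 / (1 - Q)) \<le> f d"
      unfolding f_def using Q m \<Lambda>_pos by (intro powr_mono2) auto
    then show ?thesis using d(4) by simp
  qed
  ultimately have ev5: "\<forall>\<^sub>F p in at_top. b p powr (1 / (1 - q p / p))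
      * V powr (1 / q p) < T'"
    by (rule order_tendstoD(2))
  show ?thesis
    using ev4 ev5 v eventually_dim
  proof eventually_elim
    case (elim p)
    have p: "p > 0" "real DIM('a) < q p" "q p < p" "l p > 0" using q[OF elim(4)] l[OF elim(4)] elim(4) by auto
    have b: "b p > 0" unfolding b_def using V p m by (intro divide_pos_pos mult_pos_pos) auto
    have bp: "b p powr p = 2 * V / (l p * m powr p)"
      using V p m by (simp add: b_def powr_divide powr_mult powr_powr)
    have "b p powr p \<le> 1 powr p" using elim(1) b p by (intro powr_mono2) auto
    then have "2 * V \<le> l p * m powr p" using bp p m by (simp add: field_simps)
    then have "Lp_norm \<Omega> (q p) (weak_gradient \<Omega> (v p))
        \<le> (2 * V / (l p * m powr p)) powr (1 / (p - q p)) * V powr (1 / q p)"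
      unfolding V_def m_def
      by (intro least_energy_gradient_bound[where c = c] open_domain domain_nonempty bounded_domain
          p w wg c wc0 elim)
    also have "(2 * V / (l p * m powr p)) powr (1 / (p - q p)) = b p powr (1 / (1 - q p / p))"
    proof -
      have "p * (1 / (p - q p)) = 1 / (1 - q p / p)" using p by (simp add: field_simps)
      then show ?thesis unfolding bp[symmetric] powr_powr by simp
    qed
    finally show ?case using elim(2) by simp
  qed
qed

text \<open>With L the sup norm and a the q-gradient norm, Morrey gives L <= K a and the Nehari
  identity gives a^q <= l L^p. Eliminating a leaves L^(p-q) >= 1/(l K^q), a lower bound that does
  not refer to the energy.\<close>

lemma Linf_norm_liminf:
  assumes "\<epsilon> > 0" "s < (1 / (\<Lambda> * (R + \<epsilon>) powr Q)) powr (1 / (1 - Q))"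
  shows "\<forall>\<^sub>F p in at_top. s \<le> Linf_norm \<Omega> (v p)"
proof -
  define N where "N = 2 * real DIM('a)"
  \<comment> \<open>The cube size is scaled so that Morrey's additive error 2 N e, with N the
    dimension there, is exactly \<epsilon>.\<close>
  define e where "e = \<epsilon> / N"
  have N: "N > 0" by (simp add: N_def)
  have e: "e > 0" "N * e = \<epsilon>" using assms(1) N by (simp_all add: e_def)
  define K where "K p = (R + \<epsilon>) * morrey_const DIM('a) e (q p)" for p
  have K: "(K \<longlongrightarrow> (R + \<epsilon>) * 1) at_top"
    unfolding K_def[abs_def] by (intro tendsto_intros morrey_lim e)
  have "((\<lambda>p. (1 / (l p powr (1 / p) * K p powr (q p / p))) powr (1 / (1 - q p / p)))
      \<longlongrightarrow> (1 / (\<Lambda> * ((R + \<epsilon>) * 1) powr Q)) powr (1 / (1 - Q))) at_top"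
    using \<Lambda>_pos R(2) assms(1)
    by (intro tendsto_powr tendsto_divide tendsto_mult tendsto_const l_lim K q_lim exponent_lim) auto
  then have ev: "\<forall>\<^sub>F p in at_top. s < (1 / (l p powr (1 / p) * K p powr (q p / p))) powr (1 / (1 - q p / p))"
    by (rule order_tendstoD(1)) (use assms(2) in simp)
  show ?thesis using ev v eventually_dim
  proof eventually_elim
    case (elim p)
    have p: "p > 0" "real DIM('a) < q p" "q p < p" "l p > 0" "q p > 0"
      using q[OF elim(3)] l[OF elim(3)] elim(3) by auto
    define a where "a = Lp_norm \<Omega> (q p) (weak_gradient \<Omega> (v p))"
    define L where "L = Linf_norm \<Omega> (v p)"
    have nh: "v p \<in> nehari \<Omega> p (q p) (l p)" using elim(2) by (simp add: least_energy_solution_def)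
    then have X: "v p \<in> X_space \<Omega> p" and nz: "\<not> (\<forall>x\<in>\<Omega>. v p x = 0)"
      and eq: "Lp_norm \<Omega> p (weak_gradient \<Omega> (v p)) powr p + a powr q p = l p * L powr p"
      by (auto simp: nehari_def a_def L_def)
    have aq: "a powr q p \<le> l p * L powr p"
      using eq powr_ge_zero[of "Lp_norm \<Omega> p (weak_gradient \<Omega> (v p))" p] by linarith
    have cont: "continuous_on (closure \<Omega>) (v p)" using X by (simp add: X_space_def)
    obtain x where x: "x \<in> \<Omega>" "v p x \<noteq> 0" using nz by blast
    have L: "L > 0"
      using abs_le_Linf_norm[OF open_domain domain_nonempty bounded_domain cont, of x] x closure_subset[of \<Omega>]
      by (force simp: L_def)
    have mK: "morrey_const DIM('a) e (q p) > 0" by (rule morrey_const_pos[OF e(1) p(2)])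
    then have Kp: "K p > 0" using R(2) assms(1) by (simp add: K_def)
    have "L \<le> K p * a"
      unfolding L_def
    proof (rule continuous_Linf_norm_le[OF open_domain domain_nonempty cont])
      fix z assume "z \<in> \<Omega>"
      then have z: "z \<in> closure \<Omega>" using closure_subset by blast
      have "\<bar>v p z\<bar> \<le> (boundary_dist \<Omega> z + \<epsilon>) * (morrey_const DIM('a) e (q p) * a)"
        using X_space_morrey(2)[OF open_domain bounded_domain X p(2) less_imp_le[OF p(3)] e(1) z] e(2)
        by (simp add: a_def N_def)
      also have "\<dots> \<le> (R + \<epsilon>) * (morrey_const DIM('a) e (q p) * a)"
        using R(3)[OF z] mK by (intro mult_right_mono) (auto simp: a_def Lp_norm_nonneg)
      finally show "\<bar>v p z\<bar> \<le> K p * a" by (simp add: K_def mult.assoc)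
    qed
    then have "L powr q p \<le> (K p * a) powr q p" using L p by (intro powr_mono2) auto
    also have "\<dots> = K p powr q p * a powr q p"
      using Kp by (simp add: powr_mult a_def Lp_norm_nonneg)
    also have "\<dots> \<le> K p powr q p * (l p * L powr p)" by (intro mult_left_mono aq) simp
    also have "L powr p = L powr q p * L powr (p - q p)" by (simp flip: powr_add)
    finally have "1 \<le> K p powr q p * l p * L powr (p - q p)" using L by (simp add: mult_ac)
    then have "1 / (l p * K p powr q p) \<le> L powr (p - q p)" using Kp p by (simp add: field_simps)
    then have "(1 / (l p * K p powr q p)) powr (1 / (p - q p)) \<le> (L powr (p - q p)) powr (1 / (p - q p))"
      using Kp p by (intro powr_mono2) auto
    also have "\<dots> = L" using L p by (simp add: powr_powr)
    also have "(1 / (l p * K p powr q p)) powr (1 / (p - q p))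
        = (1 / (l p powr (1 / p) * K p powr (q p / p))) powr (1 / (1 - q p / p))"
    proof -
      have "1 / (l p * K p powr q p) = (1 / (l p powr (1 / p) * K p powr (q p / p))) powr p"
        using Kp p by (simp add: powr_divide powr_mult powr_powr)
      then show ?thesis using p by (simp add: powr_powr field_simps)
    qed
    finally show ?case using elim(1) by (simp add: L_def)
  qed
qed

end

text \<open>Both perturbations are driven by one parameter s, with \<epsilon> = s and T' = T +
  s.\<close>

lemma le_mult_if_le_perturbed:
  fixes a d T N :: real
  assumes "\<And>\<epsilon> T'. \<epsilon> > 0 \<Longrightarrow> T' > T \<Longrightarrow> a \<le> (d + N * \<epsilon>) * T'"
  shows "a \<le> d * T"
proof (rule tendsto_lowerbound)
  have "((\<lambda>s. (d + N * s) * (T + s)) \<longlongrightarrow> (d + N * 0) * (T + 0)) (at_right 0)"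
    by (intro tendsto_intros)
  then show "((\<lambda>s. (d + N * s) * (T + s)) \<longlongrightarrow> d * T) (at_right 0)" by simp
  show "\<forall>\<^sub>F s in at_right 0. a \<le> (d + N * s) * (T + s)"
    using eventually_at_right_less[of 0] by eventually_elim (use assms in simp)
qed simp

theorem corollary4p4:
  fixes \<Omega> :: "'a::euclidean_space set"
    and q l :: "real \<Rightarrow> real"
    and Q \<Lambda> :: real
    and u :: "'a \<Rightarrow> real"
    and x\<^sub>\<Lambda> :: 'a
  assumes "DIM('a) \<ge> 2"
    and "smooth_bounded_domain \<Omega>"
    and "\<And>p. p > real DIM('a) \<Longrightarrow> real DIM('a) < q p \<and> q p < p"
    and "((\<lambda>p. q p / p) \<longlongrightarrow> Q) at_top"
    and "0 < Q" and "Q < 1"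
    and "\<Lambda> > Lambda_inf \<Omega>"
    and "\<And>p. p > real DIM('a) \<Longrightarrow> l p > 0"
    and "((\<lambda>p. l p powr (1 / p)) \<longlongrightarrow> \<Lambda>) at_top"
    and "limit_pair \<Omega> q l u x\<^sub>\<Lambda>"
  shows "Linf_norm \<Omega> u = 1 / Lambda_inf \<Omega> * (Lambda_inf \<Omega> / \<Lambda>) powr (1 / (1 - Q))
    \<and> Lambda_inf \<Omega> = Linf_norm \<Omega> (weak_gradient \<Omega> u) / Linf_norm \<Omega> u
    \<and> is_max_point (boundary_dist \<Omega>) (closure \<Omega>) x\<^sub>\<Lambda>
    \<and> (\<forall>x\<in>closure \<Omega>. 0 \<le> u x \<and>
          u x \<le> (Lambda_inf \<Omega> / \<Lambda>) powr (1 / (1 - Q)) * boundary_dist \<Omega> x)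
    \<and> (\<forall>x\<in>frontier \<Omega> \<union> {x\<^sub>\<Lambda>}.
          u x = (Lambda_inf \<Omega> / \<Lambda>) powr (1 / (1 - Q)) * boundary_dist \<Omega> x)"
proof -
  have dom: "open \<Omega>" "\<Omega> \<noteq> {}" "bounded \<Omega>" using assms(2) by (auto simp: smooth_bounded_domain_def)
  obtain v y P where u: "u \<in> W1inf \<Omega>" "u \<in> C0 \<Omega>" "x\<^sub>\<Lambda> \<in> \<Omega>"
    and vy: "\<forall>\<^sub>F p in at_top. least_energy_solution \<Omega> p (q p) (l p) (v p) \<and>
           (\<forall>z\<in>closure \<Omega>. 0 \<le> v p z) \<and>
           (\<forall>z. is_max_point (v p) (closure \<Omega>) z \<longleftrightarrow> z = y p)"
    and P: "filterlim P at_top sequentially" "(\<lambda>n. y (P n)) \<longlonglongrightarrow> x\<^sub>\<Lambda>"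
      "uniform_limit (closure \<Omega>) (\<lambda>n. v (P n)) u sequentially"
    using assms(10) unfolding limit_pair_def by blast
  have v: "\<forall>\<^sub>F p in at_top. least_energy_solution \<Omega> p (q p) (l p) (v p)"
    using vy by eventually_elim blast
  obtain c where c: "c \<in> \<Omega>" "boundary_dist \<Omega> c > 0"
      "\<And>x. x \<in> closure \<Omega> \<Longrightarrow> boundary_dist \<Omega> x \<le> boundary_dist \<Omega> c"
    using boundary_dist_attains_max[OF dom] by blast
  define R where "R = boundary_dist \<Omega> c"
  have Linf: "Lambda_inf \<Omega> = 1 / R"
    using c by (intro Lambda_inf_eq[OF dom(1,3) c(1)]) (auto simp: R_def)
  have R0: "R > 0" using c(2) by (simp add: R_def)
  have \<Lambda>R: "\<Lambda> * R > 1" using assms(7) R0 by (simp add: Linf field_simps)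
  interpret least_energy_family \<Omega> q l Q \<Lambda> R c v
    by unfold_locales (use dom c assms(3-6,8,9) R0 \<Lambda>R v in \<open>auto simp: R_def\<close>)
  have Teq: "(Lambda_inf \<Omega> / \<Lambda>) powr (1 / (1 - Q)) = T"
    by (simp add: T_def Linf)
  have cont: "continuous_on (closure \<Omega>) u" and u0: "\<And>x. x \<in> frontier \<Omega> \<Longrightarrow> u x = 0"
    using u(2) by (auto simp: C0_def)
  have x\<Lambda>: "x\<^sub>\<Lambda> \<in> closure \<Omega>" using u(3) closure_subset by blast
  have along: "\<forall>\<^sub>F n in sequentially. S (P n)" if "\<forall>\<^sub>F p in at_top. S p" for S
    using P(1) that by (auto simp: filterlim_iff)
  have lim: "(\<lambda>n. v (P n) x) \<longlonglongrightarrow> u x" if "x \<in> closure \<Omega>" for x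
    by (rule tendsto_uniform_limitI[OF P(3) that])
  define N where "N = 2 * real DIM('a)"
  have nonneg: "0 \<le> u x" if "x \<in> closure \<Omega>" for x
  proof (rule tendsto_lowerbound[OF lim[OF that]])
    show "\<forall>\<^sub>F n in sequentially. 0 \<le> v (P n) x"
      using along[OF vy] by eventually_elim (use that in blast)
  qed simp
  have ub: "\<bar>u x\<bar> \<le> boundary_dist \<Omega> x * T" and lip: "\<bar>u x - u z\<bar> \<le> norm (x - z) * T"
    if x: "x \<in> closure \<Omega>" and z: "z \<in> closure \<Omega>" for x z
  proof -
    \<comment> \<open>For fixed \<epsilon> and T' the limit along \<open>P n\<close> sends Morrey's
      constant to 1; \<epsilon> and T' - T are removed only afterwards.\<close>
    have "\<bar>u x\<bar> \<le> (boundary_dist \<Omega> x + N * \<epsilon>) * T' \<and> \<bar>u x - u z\<bar> \<le> (norm (x - z) + N * \<epsilon>) * T'"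
      if \<epsilon>: "\<epsilon> > 0" and T': "T' > T" for \<epsilon> T'
    proof -
      have klim: "(\<lambda>n. a * (morrey_const DIM('a) \<epsilon> (q (P n)) * T')) \<longlonglongrightarrow> a * (1 * T')" for a
        by (intro tendsto_intros filterlim_compose[OF morrey_lim[OF \<epsilon>] P(1)])
      have bd: "0 \<le> boundary_dist \<Omega> x" by (simp add: boundary_dist_def infdist_nonneg)
      have N0: "N * \<epsilon> \<ge> 0" using \<epsilon> by (simp add: N_def)
      have ev: "\<forall>\<^sub>F n in sequentially.
          \<bar>v (P n) x\<bar> \<le> (boundary_dist \<Omega> x + N * \<epsilon>) * (morrey_const DIM('a) \<epsilon> (q (P n)) * T') \<and>
          \<bar>v (P n) x - v (P n) z\<bar> \<le> (norm (x - z) + N * \<epsilon>) * (morrey_const DIM('a) \<epsilon> (q (P n)) * T')"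
        using along[OF v] along[OF gradient_limsup[OF T']] along[OF eventually_dim]
      proof eventually_elim
        case (elim n)
        define p where "p = P n"
        have p: "real DIM('a) < q p" "q p \<le> p" using q[OF elim(3)] by (auto simp: p_def)
        have X: "v p \<in> X_space \<Omega> p" using elim(1) by (simp add: least_energy_solution_def nehari_def p_def)
        have g: "a * (morrey_const DIM('a) \<epsilon> (q p) * Lp_norm \<Omega> (q p) (weak_gradient \<Omega> (v p)))
            \<le> a * (morrey_const DIM('a) \<epsilon> (q p) * T')" if "a \<ge> 0" for a
          using that elim(2) morrey_const_pos[OF \<epsilon> p(1)] by (intro mult_left_mono) (auto simp: p_def)
        show ?case
          using X_space_morrey[OF dom(1,3) X p \<epsilon>] x z
            g[of "boundary_dist \<Omega> x + N * \<epsilon>"] g[of "norm (x - z) + N * \<epsilon>"] bd N0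
          unfolding N_def p_def by (auto intro: order_trans)
      qed
      show ?thesis
      proof
        show "\<bar>u x\<bar> \<le> (boundary_dist \<Omega> x + N * \<epsilon>) * T'"
          using tendsto_le[OF sequentially_bot klim tendsto_rabs[OF lim[OF x]] eventually_mono[OF ev]]
          by simp
        show "\<bar>u x - u z\<bar> \<le> (norm (x - z) + N * \<epsilon>) * T'"
          using tendsto_le[OF sequentially_bot klim
              tendsto_rabs[OF tendsto_diff[OF lim[OF x] lim[OF z]]] eventually_mono[OF ev]]
          by simp
      qed
    qed
    then show "\<bar>u x\<bar> \<le> boundary_dist \<Omega> x * T" "\<bar>u x - u z\<bar> \<le> norm (x - z) * T"
      by (auto intro: le_mult_if_le_perturbed)
  qed
  have lb: "R * T \<le> u x\<^sub>\<Lambda>"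
  proof -
    have ymax: "\<forall>\<^sub>F n in sequentially. is_max_point (v (P n)) (closure \<Omega>) (y (P n))"
      using along[OF vy] by eventually_elim blast
    then have yc: "\<forall>\<^sub>F n in sequentially. y (P n) \<in> closure \<Omega>"
      by eventually_elim (simp add: is_max_point_def)
    have vlim: "(\<lambda>n. v (P n) (y (P n))) \<longlonglongrightarrow> u x\<^sub>\<Lambda>"
      by (rule uniform_limit_diagonal[OF P(3) cont x\<Lambda> P(2) yc])
    \<comment> \<open>Nonnegativity makes the maximum of \<open>v\<close> also the maximum of its
      absolute value, so the lower bound on the norm becomes one on the value at the maximum
      point.\<close>
    have le: "\<forall>\<^sub>F n in sequentially. Linf_norm \<Omega> (v (P n)) \<le> v (P n) (y (P n))"
      using along[OF vy]
    proof eventually_elim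
      case (elim n)
      then have "continuous_on (closure \<Omega>) (v (P n))"
        by (auto simp: least_energy_solution_def nehari_def X_space_def)
      then show ?case
      proof (rule continuous_Linf_norm_le[OF dom(1,2)])
        fix z assume "z \<in> \<Omega>"
        then have "z \<in> closure \<Omega>" using closure_subset by blast
        moreover have "is_max_point (v (P n)) (closure \<Omega>) (y (P n))" using elim by blast
        ultimately show "\<bar>v (P n) z\<bar> \<le> v (P n) (y (P n))"
          using elim by (auto simp: is_max_point_def)
      qed
    qed
    define f where "f \<epsilon> = (1 / (\<Lambda> * (R + \<epsilon>) powr Q)) powr (1 / (1 - Q))" for \<epsilon>
    have low: "s \<le> u x\<^sub>\<Lambda>" if "\<epsilon> > 0" "s < f \<epsilon>" for \<epsilon> s
    proof (rule tendsto_lowerbound[OF vlim])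
      show "\<forall>\<^sub>F n in sequentially. s \<le> v (P n) (y (P n))"
        using along[OF Linf_norm_liminf[OF that[unfolded f_def]]] le by eventually_elim simp
    qed simp
    have *: "f \<epsilon> \<le> u x\<^sub>\<Lambda>" if "\<epsilon> > 0" for \<epsilon>
      by (rule dense_le) (rule low[OF that])
    have "(f
        \<longlongrightarrow> f 0) (at_right 0)"
      unfolding f_def[abs_def] using R0 \<Lambda>_pos by (intro tendsto_intros) auto
    then have "f 0 \<le> u x\<^sub>\<Lambda>"
      by (rule tendsto_upperbound)
        (use eventually_mono[OF eventually_at_right_less[of "0::real"] *] in simp_all)
    \<comment> \<open>The exponents fit: R^(-Q/(1-Q)) = R * R^(-1/(1-Q)), so the lower bound meets
      the upper bound exactly.\<close>
    moreover have "f 0 = R * T"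
    proof -
      have "1 / (\<Lambda> * R powr Q) = R powr (1 - Q) * (1 / (R * \<Lambda>))"
        using R0 \<Lambda>_pos by (simp add: powr_diff)
      then have "(1 / (\<Lambda> * R powr Q)) powr (1 / (1 - Q))
          = (R powr (1 - Q)) powr (1 / (1 - Q)) * (1 / (R * \<Lambda>)) powr (1 / (1 - Q))"
        by (simp only: powr_mult)
      then show ?thesis using R0 assms(6) by (simp add: f_def T_def powr_powr)
    qed
    ultimately show ?thesis by simp
  qed
  \<comment> \<open>Squeeze: R T <= u <= \<rho> T <= R T at the limit point, so \<rho> attains its
    maximum R there and u equals R T.\<close>
  have "u x\<^sub>\<Lambda> \<le> boundary_dist \<Omega> x\<^sub>\<Lambda> * T" using ub[OF x\<Lambda> x\<Lambda>] by linarith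
  moreover have bdR: "boundary_dist \<Omega> x\<^sub>\<Lambda> \<le> R" using R(3)[OF x\<Lambda>] .
  ultimately have "R * T \<le> boundary_dist \<Omega> x\<^sub>\<Lambda> * T" using lb by linarith
  then have bd: "boundary_dist \<Omega> x\<^sub>\<Lambda> = R" using bdR T_pos by simp
  then have ux: "u x\<^sub>\<Lambda> = R * T" using lb \<open>u x\<^sub>\<Lambda> \<le> boundary_dist \<Omega> x\<^sub>\<Lambda> * T\<close> by simp
  have norm_u: "Linf_norm \<Omega> u = R * T"
  proof (rule antisym)
    show "Linf_norm \<Omega> u \<le> R * T"
    proof (rule continuous_Linf_norm_le[OF dom(1,2) cont])
      fix x assume "x \<in> \<Omega>"
      then have x: "x \<in> closure \<Omega>" using closure_subset by blast
      have "\<bar>u x\<bar> \<le> boundary_dist \<Omega> x * T" by (rule ub[OF x x])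
      also have "\<dots> \<le> R * T" using R(3)[OF x] T_pos by simp
      finally show "\<bar>u x\<bar> \<le> R * T" .
    qed
    show "R * T \<le> Linf_norm \<Omega> u"
      using abs_le_Linf_norm[OF dom cont x\<Lambda>] ux by linarith
  qed
  have norm_grad: "Linf_norm \<Omega> (weak_gradient \<Omega> u) = T"
  proof (rule antisym)
    have h: "has_weak_gradient \<Omega> u (weak_gradient \<Omega> u)" by (rule W1inf_weak_gradient(1)[OF dom(1,2) u(1)])
    define U where "U x = (if x \<in> \<Omega> then u x else 0)" for x
    \<comment> \<open>If z lies outside \<Omega>, then |x - z| is at least \<rho>(x), so the bound
      of |u| by T \<rho> already gives the Lipschitz estimate for the zero extension.\<close>
    have 1: "\<bar>U x - U z\<bar> \<le> T * norm (x - z)" if "x \<in> \<Omega>" for x z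
    proof (cases "z \<in> \<Omega>")
      case True
      then show ?thesis
        using lip[of x z] that closure_subset[of \<Omega>] by (auto simp: U_def mult.commute)
    next
      case False
      then have "z \<notin> ball x (boundary_dist \<Omega> x)"
        using ball_infdist_frontier_subset[OF that] by (auto simp: boundary_dist_def)
      then have "boundary_dist \<Omega> x * T \<le> norm (x - z) * T"
        using T_pos by (intro mult_right_mono) (auto simp: dist_norm)
      then show ?thesis
        using ub[of x x] that False closure_subset[of \<Omega>] by (force simp: U_def mult.commute)
    qed
    have "\<bar>U x - U z\<bar> \<le> T * norm (x - z)" for x z
    proof -
      consider "x \<in> \<Omega>" | "z \<in> \<Omega>" | "x \<notin> \<Omega>" "z \<notin> \<Omega>" by blast
      then show ?thesis
        using 1[of x z] 1[of z x] T_pos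
        by cases (auto simp: abs_minus_commute norm_minus_commute U_def)
    qed
    then have "AE x in lebesgue_on \<Omega>. norm (weak_gradient \<Omega> u x) \<le> T"
      using C0_extension(2)[OF dom(1,3) u(2)] T_pos
      by (intro weak_gradient_le_lipschitz[OF dom(1) h, of U]) (auto simp: U_def[abs_def])
    then show "Linf_norm \<Omega> (weak_gradient \<Omega> u) \<le> T"
      by (rule Linf_norm_le(1)[OF dom(1,2) has_weak_gradient_measurable(2)[OF dom(1) h]])
    \<comment> \<open>At this point u = R T and \<rho> = R, so dividing by R gives the reverse
      inequality for the gradient norm.\<close>
    have "\<bar>u x\<^sub>\<Lambda>\<bar> \<le> Linf_norm \<Omega> (weak_gradient \<Omega> u) * boundary_dist \<Omega> x\<^sub>\<Lambda>"
      by (rule C0_le_weak_gradient_boundary_dist[OF dom(1,3) u(2) h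
            Linf_norm_nonneg[OF dom(1,2)] W1inf_weak_gradient(2)[OF dom(1,2) u(1)] u(3)])
    then show "T \<le> Linf_norm \<Omega> (weak_gradient \<Omega> u)"
      using R0 T_pos by (simp add: ux bd mult.commute)
  qed
  have "is_max_point (boundary_dist \<Omega>) (closure \<Omega>) x\<^sub>\<Lambda>"
    using x\<Lambda> R(3) by (simp add: is_max_point_def bd)
  moreover have "0 \<le> u x \<and> u x \<le> T * boundary_dist \<Omega> x" if "x \<in> closure \<Omega>" for x
    using nonneg[OF that] ub[OF that that] by (simp add: mult.commute)
  moreover have "u x = T * boundary_dist \<Omega> x" if "x \<in> frontier \<Omega> \<union> {x\<^sub>\<Lambda>}" for x
    using that u0 ux bd by (auto simp: boundary_dist_def mult.commute)
  ultimately show ?thesis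
    unfolding Teq using R0 T_pos by (simp add: norm_u norm_grad Linf)
qed

end
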